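(* Let $\omega$ be a radial weight on the unit disk $\mathbb D$. The following statements are equivalent: (1) $P_\omega:L^1_\omega\to L^{1,\infty}_\omega$ is bounded; (2) $P_\omega:L^p_\omega\to L^p_\omega$ is bounded for every $1<p<\infty$; (3) $P_\omega:L^p_\omega\to L^p_\omega$ is bounded for some $p\in(1,\infty)\setminus\{2\}$; (4) $\omega\in\widehat{\mathcal D}$.
   Context: $\mathbb D=\{z\in\mathbb C:|z|<1\}$ and $dA(z)=dx\,dy/\pi$ is normalized area measure on $\mathbb D$. A radial weight is a nonnegative (measurable) integrable function $\omega$ on $[0,1)$, extended to $\mathbb D$ by $\omega(z)=\omega(|z|)$, and it is assumed throughout that $\widehat\omega(r)=\int_r^1\omega(s)\,ds>0$ for all $0\le r<1$. For $1\le p<\infty$, $L^p_\omega$ is the space of measurable $f$ on $\mathbb D$ with $\|f\|_{L^p_\omega}^p=\int_{\mathbb D}|f|^p\omega\,dA<\infty$. $L^{1,\infty}_\omega$ is the set of measurable $f$ on $\mathbb D$ with $\|f\|_{L^{1,\infty}_\omega}=\sup_{t>0}t\,\omega(\{z\in\mathbb D:|f(z)|>t\})<\infty$, where $\omega(E)=\int_E\omega\,dA$. Moments: $\omega_x=\int_0^1r^x\omega(r)\,dr$, $x\ge0$. The reproducing kernel of the weighted Bergman space $A^2_\omega$ (analytic functions in $L^2_\omega$) is $B_z^\omega(\zeta)=\sum_{n=0}^\infty\frac{(\overline z\zeta)^n}{2\omega_{2n+1}}$, $z,\zeta\in\mathbb D$, and the Bergman projection is $$P_\omega f(z)=\int_{\mathbb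 D}f(\zeta)\overline{B_z^\omega(\zeta)}\,\omega(\zeta)\,dA(\zeta).$$ For each fixed $z\in\mathbb D$ the kernel $B^\omega_z$ is bounded on $\mathbb D$, so $P_\omega f(z)$ is defined for every $f\in L^1_\omega$. Boundedness of $P_\omega:X\to Y$ means there is a constant $C$ with $\|P_\omega f\|_Y\le C\|f\|_X$ for all $f\in X$. $\widehat{\mathcal D}$ is the class of radial weights $\omega$ for which there is a constant $C=C(\omega)\ge1$ with $\widehat\omega(r)\le C\,\widehat\omega\left(\frac{1+r}{2}\right)$ for all $0\le r<1$. *)

theory Defs
  imports "HOL-Analysis.Analysis"
begin

text \<open>"Measurable" means Lebesgue measurable. A radial weight is a function on \<open>[0,1)\<close>, and functions
  on the unit disk are total functions of which only the values on the disk matter.\<close>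

definition omega_hat :: "(real \<Rightarrow> real) \<Rightarrow> real \<Rightarrow> real" where
  "omega_hat \<omega> r = (LINT s:{r..<1}|lebesgue. \<omega> s)"

definition radial_weight :: "(real \<Rightarrow> real) \<Rightarrow> bool" where
  "radial_weight \<omega> \<longleftrightarrow>
     (\<forall>r\<in>{0..<1}. 0 \<le> \<omega> r) \<and> set_integrable lebesgue {0..<1} \<omega> \<and>
     (\<forall>r\<in>{0..<1}. 0 < omega_hat \<omega> r)"

definition D_hat :: "(real \<Rightarrow> real) set" where
  "D_hat = {\<omega>. radial_weight \<omega> \<and>
     (\<exists>C\<ge>1. \<forall>r\<in>{0..<1}. omega_hat \<omega> r \<le> C * omega_hat \<omega> ((1 + r) / 2))}"

abbreviation unit_disk :: "complex set" where
  "unit_disk \<equiv> ball 0 1"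

definition dA :: "complex measure" where
  "dA = density (lebesgue_on unit_disk) (\<lambda>_. ennreal (1 / pi))"

definition weighted_area :: "(real \<Rightarrow> real) \<Rightarrow> complex set \<Rightarrow> ennreal" where
  "weighted_area \<omega> E = (\<integral>\<^sup>+z\<in>E. ennreal (\<omega> (cmod z)) \<partial>dA)"

definition Lp_space :: "(real \<Rightarrow> real) \<Rightarrow> real \<Rightarrow> (complex \<Rightarrow> complex) set" where
  "Lp_space \<omega> p = {f \<in> borel_measurable dA.
     (\<integral>\<^sup>+z. ennreal (cmod (f z) powr p * \<omega> (cmod z)) \<partial>dA) < \<infinity>}"

definition Lp_norm :: "(real \<Rightarrow> real) \<Rightarrow> real \<Rightarrow> (complex \<Rightarrow> complex) \<Rightarrow> real" where
  "Lp_norm \<omega> p f = (LINT z|dA. cmod (f z) powr p * \<omega> (cmod z)) powr (1 / p)"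

definition weak_L1_sup :: "(real \<Rightarrow> real) \<Rightarrow> (complex \<Rightarrow> complex) \<Rightarrow> ennreal" where
  "weak_L1_sup \<omega> f = (SUP t\<in>{0<..}. ennreal t * weighted_area \<omega> {z \<in> unit_disk. t < cmod (f z)})"

definition weak_L1_space :: "(real \<Rightarrow> real) \<Rightarrow> (complex \<Rightarrow> complex) set" where
  "weak_L1_space \<omega> = {f \<in> borel_measurable dA. weak_L1_sup \<omega> f < \<infinity>}"

definition weak_L1_norm :: "(real \<Rightarrow> real) \<Rightarrow> (complex \<Rightarrow> complex) \<Rightarrow> real" where
  "weak_L1_norm \<omega> f = enn2real (weak_L1_sup \<omega> f)"

text \<open>The convention \<open>0 powr 0 = 0\<close> only changes the integrand at the single point \<open>r = 0\<close>.\<close>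

definition moment :: "(real \<Rightarrow> real) \<Rightarrow> real \<Rightarrow> real" where
  "moment \<omega> x = (LINT r:{0..<1}|lebesgue. r powr x * \<omega> r)"

definition bergman_kernel :: "(real \<Rightarrow> real) \<Rightarrow> complex \<Rightarrow> complex \<Rightarrow> complex" where
  "bergman_kernel \<omega> z \<zeta> =
     (\<Sum>n. (cnj z * \<zeta>) ^ n / complex_of_real (2 * moment \<omega> (2 * real n + 1)))"

definition bergman_proj :: "(real \<Rightarrow> real) \<Rightarrow> (complex \<Rightarrow> complex) \<Rightarrow> complex \<Rightarrow> complex" where
  "bergman_proj \<omega> f z =
     (LINT \<zeta>|dA. f \<zeta> * cnj (bergman_kernel \<omega> z \<zeta>) * complex_of_real (\<omega> (cmod \<zeta>)))"

definition bounded_between ::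
  "'a set \<Rightarrow> ('a \<Rightarrow> real) \<Rightarrow> 'b set \<Rightarrow> ('b \<Rightarrow> real) \<Rightarrow> ('a \<Rightarrow> 'b) \<Rightarrow> bool" where
  "bounded_between X nX Y nY T \<longleftrightarrow> (\<exists>C. \<forall>f\<in>X. T f \<in> Y \<and> nY (T f) \<le> C * nX f)"

definition bounded_Lp :: "(real \<Rightarrow> real) \<Rightarrow> real \<Rightarrow> bool" where
  "bounded_Lp \<omega> p \<longleftrightarrow>
     bounded_between (Lp_space \<omega> p) (Lp_norm \<omega> p) (Lp_space \<omega> p) (Lp_norm \<omega> p) (bergman_proj \<omega>)"

definition bounded_weak_11 :: "(real \<Rightarrow> real) \<Rightarrow> bool" where
  "bounded_weak_11 \<omega> \<longleftrightarrow>
     bounded_between (Lp_space \<omega> 1) (Lp_norm \<omega> 1) (weak_L1_space \<omega>) (weak_L1_norm \<omega>) (bergman_proj \<omega>)"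

end

theory Submission
  imports Defs
begin

text \<open>The monomials are orthogonal for \<open>\<omega> dA\<close>, so the projection is a contraction of
  \<open>L\<^sup>2\<close>, and by Marcinkiewicz interpolation and duality a weak type \<open>(1, 1)\<close> bound gives
  every \<open>L\<^sup>p\<close> bound.

  Necessity: with \<open>q\<close> the exponent conjugate to \<open>p\<close>, testing on \<open>z ^ n\<close> times a power of \<open>\<bar>z\<bar>\<close>
  bounds the gap in the convexity inequality of \<open>ln (moment \<omega> x)\<close> at the points \<open>n q\<close>, \<open>2 n\<close>, \<open>n p\<close>.
  The slopes of this function tend to \<open>0\<close>, so the gaps, summed over geometrically growing \<open>n\<close>, bound
  the slope at \<open>n\<close> by \<open>O(1 / n)\<close>. Hence the moments are doubling, which forces \<open>D_hat\<close>.

  Sufficiency: for \<open>\<omega>\<close> in \<open>D_hat\<close> the kernel coefficients are symbols, so repeated summation by parts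
  shows that the kernel is a Calderon-Zygmund kernel for the pseudo-distance \<open>\<bar>1 - cnj z * \<zeta>\<bar>\<close>
  and the measure \<open>\<omega> dA\<close>, which is doubling on Carleson tents (though not on small disks). A
  Calderon-Zygmund decomposition along dyadic tents then gives the weak type bound.\<close>

subsection \<open>Lebesgue measure on the complex plane: rotations and radial functions\<close>

text \<open>The weight is an arbitrary integrable function and may vanish on whole annuli, so every
  size is expressed by the tails \<open>W k\<close> at dyadic radii. Positivity of the tails makes
  the moments subexponential, the only a priori information in the necessity part. Boundedness for
  \<open>p = 2\<close> carries no information: the three points of the convexity inequality then
  coincide. In the sufficiency part two sizes balance at scale \<open>1 / 2 ^ k\<close>: the kernel
  is of size \<open>2 ^ k / W k\<close>, while a tent and its neighbourhood have measure of order
  \<open>W k / 2 ^ k\<close>. Hence a piece of \<open>f\<close> on the top half of a light tent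
  needs no exceptional set, because the supremum of its kernel times the measure of the
  neighbourhood is bounded. Only the neighbourhoods of heavy tents are removed, and their measures
  are charged to disjoint pieces of \<open>f\<close>. The price for spreading each top half over its
  tent is that the good function is a sum over nested tents, for which no uniform bound is
  available. It is controlled in the square mean only, which suffices because the projection
  contracts that norm.\<close>

lemma lborel_complex_mult_unit:
  fixes c :: complex
  assumes c: "cmod c = 1"
  shows "distr lborel borel ((*) c) = lborel"
proof -
  define M where "M = distr (lborel :: complex measure) borel ((*) c)"
  have [simp]: "sets M = sets borel" "space M = UNIV" by (auto simp: M_def)
  have c0: "c \<noteq> 0" using c by auto
  have Mball: "emeasure M (ball a r) = emeasure lborel (ball (a / c) r)" for a r
  proof -
    have "(*) c -` ball a r = ball (a / c) r"
    proof (intro set_eqI)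
      fix z
      have "dist (a / c) z = dist a (c * z)"
        using c c0 norm_mult[of c "a / c - z"] by (simp add: dist_norm right_diff_distrib)
      then show "z \<in> (*) c -` ball a r \<longleftrightarrow> z \<in> ball (a / c) r" by simp
    qed
    then show ?thesis by (simp add: M_def emeasure_distr)
  qed
  have transl: "distr M borel ((+) a) = M" for a
  proof -
    have "distr M borel ((+) a) = distr lborel borel ((*) c \<circ> (+) (a / c))"
      unfolding M_def by (subst distr_distr) (auto simp: o_def algebra_simps c0)
    also have "\<dots> = distr (distr lborel borel ((+) (a / c))) borel ((*) c)"
      by (subst distr_distr) auto
    also have "\<dots> = M" by (simp add: lborel_distr_plus M_def)
    finally show ?thesis .
  qed
  interpret M: sigma_finite_measure M
  proof
    show "\<exists>A. countable A \<and> A \<subseteq> sets M \<and> \<Union> A = space M \<and> (\<forall>a\<in>A. emeasure M a \<noteq> \<infinity>)"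
    proof (intro exI conjI)
      show "\<Union> (range (\<lambda>n::nat. ball (0::complex) (real n))) = space M"
        by (auto simp: reals_Archimedean2)
      show "\<forall>a\<in>range (\<lambda>n::nat. ball (0::complex) (real n)). emeasure M a \<noteq> \<infinity>"
        using Mball emeasure_lborel_ball_finite by (auto simp: less_top)
    qed auto
  qed
  interpret P: pair_sigma_finite lborel M ..
  have lt: "(\<integral>\<^sup>+x. f (x + y) \<partial>lborel) = (\<integral>\<^sup>+x. f x \<partial>lborel)"
    if "f \<in> borel_measurable borel" for f :: "complex \<Rightarrow> ennreal" and y
    using that by (subst lborel_distr_plus[of y, symmetric], subst nn_integral_distr) (auto simp: add.commute)
  have Mt: "(\<integral>\<^sup>+x. f (x + y) \<partial>M) = (\<integral>\<^sup>+x. f x \<partial>M)"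
    if "f \<in> borel_measurable borel" for f :: "complex \<Rightarrow> ennreal" and y
    using that by (subst transl[of y, symmetric], subst nn_integral_distr) (auto simp: add.commute M_def)
  define B where "B = ball (0::complex) 1"
  have [measurable]: "B \<in> sets borel" by (auto simp: B_def)
  have "emeasure M A = emeasure lborel A" if A[measurable]: "A \<in> sets borel" for A
  proof -
    have [measurable]: "(\<lambda>x. x) \<in> borel_measurable M" by (simp add: measurable_def)
    have [measurable_cong]: "sets M = sets borel" by simp
    \<comment> \<open>Uniqueness of translation invariant measures: the double integral of
      \<open>indicator B y * indicator A (x + y)\<close> is evaluated in both orders, using both
      invariances and the symmetry of the ball \<open>B\<close>. As \<open>M\<close> and
      \<open>lborel\<close> agree on \<open>B\<close>, they agree everywhere.\<close>
    have "emeasure M B * emeasure lborel A = (\<integral>\<^sup>+y. (\<integral>\<^sup>+x. indicator B y * indicator A (x + y) \<partial>lborel) \<partial>M)"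
      by (subst nn_integral_cmult, simp, subst lt, simp) (simp add: nn_integral_multc)
    also have "\<dots> = (\<integral>\<^sup>+x. (\<integral>\<^sup>+y. indicator B y * indicator A (x + y) \<partial>M) \<partial>lborel)"
      by (rule P.Fubini') measurable
    also have "\<dots> = (\<integral>\<^sup>+x. (\<integral>\<^sup>+y. indicator B (y - x) * indicator A y \<partial>M) \<partial>lborel)"
    proof (rule nn_integral_cong)
      fix x
      have "(\<integral>\<^sup>+y. indicator B (y + x - x) * indicator A (y + x) \<partial>M) = (\<integral>\<^sup>+y. indicator B (y - x) * indicator A y \<partial>M :: ennreal)"
        by (rule Mt) measurable
      then show "(\<integral>\<^sup>+y. indicator B y * indicator A (x + y) \<partial>M) = (\<integral>\<^sup>+y. indicator B (y - x) * indicator A y \<partial>M :: ennreal)"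
        by (simp add: add.commute)
    qed
    also have "\<dots> = (\<integral>\<^sup>+y. (\<integral>\<^sup>+x. indicator B (y - x) * indicator A y \<partial>lborel) \<partial>M)"
      by (rule P.Fubini'[symmetric]) measurable
    also have "\<dots> = (\<integral>\<^sup>+y. (\<integral>\<^sup>+x. indicator B (x + (- y)) * indicator A y \<partial>lborel) \<partial>M)"
      by (intro nn_integral_cong) (auto simp: B_def indicator_def dist_norm norm_minus_commute)
    also have "\<dots> = emeasure lborel B * emeasure M A"
      by (subst nn_integral_multc, simp, subst lt, simp) (simp add: nn_integral_cmult)
    finally have "emeasure M B * emeasure lborel A = emeasure lborel B * emeasure M A" .
    moreover have "emeasure M B = emeasure lborel B"
      using Mball[of 0 1] by (simp add: B_def)
    moreover have "emeasure lborel B \<noteq> 0" "emeasure lborel B \<noteq> \<infinity>"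
      using emeasure_lborel_ball_finite[of "0::complex" 1]
      by (auto simp: B_def emeasure_ball unit_ball_vol_2)
    ultimately show ?thesis by (simp add: ennreal_mult_cancel_left)
  qed
  then show ?thesis
    unfolding M_def[symmetric] by (intro measure_eqI) auto
qed

lemma emeasure_lborel_complex_ball:
  "r \<ge> 0 \<Longrightarrow> emeasure lborel (ball (0::complex) r) = ennreal (pi * r\<^sup>2)"
  by (simp add: emeasure_ball unit_ball_vol_2)

text \<open>Polar coordinates for radial functions, without any angle: open half-lines generate the
  Borel sets, and both measures give the disk area \<open>pi * r ^ 2\<close> to the half-line below
  \<open>r\<close>.\<close>

lemma distr_cmod_lborel:
  "distr lborel borel cmod = density lborel (\<lambda>r. ennreal (2 * pi * r) * indicator {0..} r)"
    (is "?M = ?N")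
proof -
  have N: "emeasure ?N {..<r} = ennreal (pi * r\<^sup>2)" if "r \<ge> 0" for r
  proof -
    have "emeasure ?N {..<r} = (\<integral>\<^sup>+x. ennreal (2 * pi * x) * indicator {0..r} x \<partial>lborel)"
    proof (subst emeasure_density)
      show "(\<integral>\<^sup>+x. ennreal (2 * pi * x) * indicator {0..} x * indicator {..<r} x \<partial>lborel) = (\<integral>\<^sup>+x. ennreal (2 * pi * x) * indicator {0..r} x \<partial>lborel)"
        using AE_lborel_singleton[of r] by (intro nn_integral_cong_AE) (auto simp: indicator_def)
    qed auto
    also have "\<dots> = ennreal (pi * r\<^sup>2 - pi * 0\<^sup>2)"
      by (rule nn_integral_FTC_Icc) (use that in \<open>auto intro!: derivative_eq_intros\<close>)
    finally show ?thesis by simp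
  qed
  have M: "emeasure ?M {..<r} = ennreal (pi * r\<^sup>2)" if "r \<ge> 0" for r
  proof -
    have "cmod -` {..<r} = ball 0 r" by auto
    then show ?thesis using that by (simp add: emeasure_distr emeasure_lborel_complex_ball)
  qed
  have neg: "emeasure ?M {..<r} = 0" "emeasure ?N {..<r} = 0" if "r < 0" for r
  proof -
    have "cmod -` {..<r} = {}" using that by (auto dest: le_less_trans[OF norm_ge_zero])
    then show "emeasure ?M {..<r} = 0" by (simp add: emeasure_distr)
    have "(\<integral>\<^sup>+x. ennreal (2 * pi * x) * indicator {0..} x * indicator {..<r} x \<partial>lborel) = (\<integral>\<^sup>+x. 0 \<partial>(lborel::real measure))"
      by (rule nn_integral_cong) (use that in \<open>auto simp: indicator_def\<close>)
    then show "emeasure ?N {..<r} = 0" by (simp add: emeasure_density)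
  qed
  show ?thesis
  proof (rule measure_eqI_generator_eq[where E = "range lessThan" and \<Omega> = UNIV and A = "\<lambda>n. {..<real n}"])
    show "Int_stable (range (lessThan :: real \<Rightarrow> _))"
    proof (clarsimp simp: Int_stable_def)
      fix a b :: real
      have "{..<a} \<inter> {..<b} = {..<min a b}" by auto
      then show "{..<a} \<inter> {..<b} \<in> range lessThan" by blast
    qed
    show "emeasure ?M X = emeasure ?N X" if X: "X \<in> range lessThan" for X
    proof -
      obtain r where "X = {..<r}" using X by auto
      then show ?thesis using M[of r] N[of r] neg[of r] by (cases "r \<ge> 0") auto
    qed
    show "sets ?M = sigma_sets UNIV (range lessThan)" "sets ?N = sigma_sets UNIV (range lessThan)"
      by (auto simp: borel_Iio[where 'a = real])
    show "(\<Union>n. {..<real n}) = UNIV" by (auto simp: reals_Archimedean2)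
    show "emeasure ?M {..<real n} \<noteq> \<infinity>" for n
      using M[of "real n"] by auto
  qed auto
qed

subsection \<open>The weighted area measure and the moments\<close>

text \<open>The image of area under \<open>cmod\<close> has a density, so a null set of radii pulls
  back to a null set of the plane.\<close>

lemma AE_cmod:
  assumes "AE r in lborel. r \<ge> 0 \<longrightarrow> Q r"
  shows "AE z in lborel. Q (cmod z)"
proof -
  have "AE r in distr lborel borel cmod. Q r"
    unfolding distr_cmod_lborel
    by (subst AE_density) (use assms in \<open>auto simp: indicator_def elim!: eventually_mono\<close>)
  then show ?thesis by (rule AE_distrD[rotated]) auto
qed

lemma borel_measurable_cnj [measurable (raw)]:
  "f \<in> borel_measurable M \<Longrightarrow> (\<lambda>x. cnj (f x)) \<in> borel_measurable M"
  by (rule borel_measurable_continuous_on[where f = cnj]) (auto intro: continuous_intros)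

locale radial =
  fixes \<omega> :: "real \<Rightarrow> real"
  assumes rw: "radial_weight \<omega>"
begin

definition \<mu> :: "complex measure" where
  "\<mu> = density dA (\<lambda>z. ennreal (\<omega> (cmod z)))"

lemma weight_nonneg: "0 \<le> r \<Longrightarrow> r < 1 \<Longrightarrow> 0 \<le> \<omega> r"
  using rw by (auto simp: radial_weight_def)

lemma weight_integrable: "set_integrable lebesgue {0..<1} \<omega>"
  using rw by (auto simp: radial_weight_def)

lemma omega_hat_pos: "0 \<le> r \<Longrightarrow> r < 1 \<Longrightarrow> 0 < omega_hat \<omega> r"
  using rw by (auto simp: radial_weight_def)

text \<open>\<open>\<omega>\<close> is only Lebesgue measurable, while image measures and
  composition with \<open>cmod\<close> ask for a Borel function. The representative is also made
  nonnegative everywhere and zero off \<open>{0..<1}\<close>, so that later integrals run over the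
  whole line without side conditions.\<close>

lemma borel_weight:
  obtains wt where "wt \<in> borel_measurable borel" "\<And>r. 0 \<le> wt r" "\<And>r. r \<notin> {0..<1} \<Longrightarrow> wt r = 0"
    "AE r in lborel. wt r = indicator {0..<1} r * \<omega> r"
proof -
  have "(\<lambda>r. indicator {0..<1} r *\<^sub>R \<omega> r) \<in> borel_measurable lebesgue"
    using weight_integrable unfolding set_integrable_def by auto
  from completion_ex_borel_measurable_real[OF this]
  obtain v where v: "v \<in> borel_measurable borel" "AE r in lborel. indicator {0..<1} r *\<^sub>R \<omega> r = v r"
    by auto
  show ?thesis
  proof
    show "(\<lambda>r. max 0 (v r) * indicator {0..<1} r) \<in> borel_measurable borel"
      using v by simp
    show "AE r in lborel. max 0 (v r) * indicator {0..<1} r = indicator {0..<1} r * \<omega> r"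
      using v(2)
    proof eventually_elim
      case (elim r)
      then show ?case
        using weight_nonneg[of r] by (cases "r \<in> {0..<1}") auto
    qed
  qed auto
qed

definition wt :: "real \<Rightarrow> real" where
  "wt = (SOME wt. wt \<in> borel_measurable borel \<and> (\<forall>r. 0 \<le> wt r) \<and> (\<forall>r. r \<notin> {0..<1} \<longrightarrow> wt r = 0) \<and>
    (AE r in lborel. wt r = indicator {0..<1} r * \<omega> r))"

lemma wt_measurable [measurable]: "wt \<in> borel_measurable borel"
  and wt_nonneg: "0 \<le> wt r"
  and wt_outside: "r \<notin> {0..<1} \<Longrightarrow> wt r = 0"
  and wt_AE: "AE r in lborel. wt r = indicator {0..<1} r * \<omega> r"
proof -
  have "\<exists>wt. wt \<in> borel_measurable borel \<and> (\<forall>r. 0 \<le> wt r) \<and> (\<forall>r. r \<notin> {0..<1} \<longrightarrow> wt r = 0) \<and>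
    (AE r in lborel. wt r = indicator {0..<1} r * \<omega> r)"
    by (rule borel_weight) blast
  from someI_ex[OF this] show "wt \<in> borel_measurable borel" "0 \<le> wt r" "r \<notin> {0..<1} \<Longrightarrow> wt r = 0"
    "AE r in lborel. wt r = indicator {0..<1} r * \<omega> r"
    unfolding wt_def[symmetric] by auto
qed

lemma wt_AE_disk: "AE z in lborel. z \<in> unit_disk \<longrightarrow> \<omega> (cmod z) = wt (cmod z)"
proof -
  have "AE z in lborel. wt (cmod z) = indicator {0..<1} (cmod z) * \<omega> (cmod z)"
    using wt_AE by (intro AE_cmod) (auto elim: eventually_mono)
  then show ?thesis by eventually_elim auto
qed

lemma space_dA [simp]: "space dA = unit_disk"
  and sets_dA: "sets dA = sets (lebesgue_on unit_disk)"
  by (simp_all add: dA_def)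

lemma borel_measurable_dA: "f \<in> borel_measurable borel \<Longrightarrow> f \<in> measurable dA borel"
  by (simp add: dA_def measurable_restrict_space1 measurable_completion)

lemma AE_dA: "AE z in lborel. z \<in> unit_disk \<longrightarrow> Q z \<Longrightarrow> AE z in dA. Q z"
  unfolding dA_def
  by (subst AE_density, simp, subst AE_restrict_space_iff) (auto intro: AE_completion)

text \<open>Composition of a Lebesgue measurable function with \<open>cmod\<close> is not measurable
  for formal reasons; it holds because the Borel function \<open>wt\<close> gives the same values
  almost everywhere and Lebesgue measure is complete.\<close>

lemma weight_measurable [measurable]: "(\<lambda>z. \<omega> (cmod z)) \<in> borel_measurable dA"
proof -
  have "(\<lambda>z. indicator unit_disk z * wt (cmod z)) \<in> borel_measurable lebesgue"
    by (intro measurable_completion borel_measurable_times borel_measurable_indicator) auto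
  moreover have "AE z in lebesgue. indicator unit_disk z * wt (cmod z) = indicator unit_disk z * \<omega> (cmod z)"
    using wt_AE_disk by (intro AE_completion) (auto elim!: eventually_mono simp: indicator_def)
  ultimately have "(\<lambda>z. indicator unit_disk z * \<omega> (cmod z)) \<in> borel_measurable lebesgue"
    by (rule borel_measurable_AE)
  then have "(\<lambda>z. indicator unit_disk z * \<omega> (cmod z)) \<in> borel_measurable (lebesgue_on unit_disk)"
    by (rule measurable_restrict_space1)
  then have "(\<lambda>z. \<omega> (cmod z)) \<in> borel_measurable (lebesgue_on unit_disk)"
    by (rule measurable_cong[THEN iffD1, rotated]) (auto simp: space_restrict_space)
  then show ?thesis by (simp add: dA_def)
qed

lemma space_mu [simp]: "space \<mu> = unit_disk"
  and sets_mu [measurable_cong]: "sets \<mu> = sets dA"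
  by (simp_all add: \<mu>_def)

lemma borel_measurable_mu: "f \<in> borel_measurable borel \<Longrightarrow> f \<in> measurable \<mu> borel"
  using borel_measurable_dA by (simp add: measurable_cong_sets[OF sets_mu refl])

lemma id_measurable_mu [measurable]: "(\<lambda>z. z) \<in> borel_measurable \<mu>"
  by (rule borel_measurable_mu) simp

lemma nn_integral_mu:
  "f \<in> borel_measurable dA \<Longrightarrow> (\<integral>\<^sup>+z. f z \<partial>\<mu>) = (\<integral>\<^sup>+z. ennreal (\<omega> (cmod z)) * f z \<partial>dA)"
  unfolding \<mu>_def by (subst nn_integral_density) auto

lemma nn_integral_mu_borel:
  assumes [measurable]: "f \<in> borel_measurable borel"
  shows "(\<integral>\<^sup>+z. f z \<partial>\<mu>) = (\<integral>\<^sup>+z. ennreal (wt (cmod z) / pi) * f z \<partial>lborel)"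
proof -
  have [measurable]: "f \<in> borel_measurable dA" using borel_measurable_dA assms by blast
  have "(\<integral>\<^sup>+z. f z \<partial>\<mu>) = (\<integral>\<^sup>+z. ennreal (\<omega> (cmod z)) * f z \<partial>dA)"
    by (rule nn_integral_mu) measurable
  also have "\<dots> = (\<integral>\<^sup>+z. ennreal (wt (cmod z)) * f z \<partial>dA)"
    using AE_dA[OF wt_AE_disk] by (intro nn_integral_cong_AE) (auto elim!: eventually_mono)
  also have "\<dots> = (\<integral>\<^sup>+z. ennreal (1 / pi) * (ennreal (wt (cmod z)) * f z) \<partial>lebesgue_on unit_disk)"
    unfolding dA_def
    by (subst nn_integral_density) (auto intro!: measurable_restrict_space1 measurable_completion)
  also have "\<dots> = (\<integral>\<^sup>+z. ennreal (1 / pi) * (ennreal (wt (cmod z)) * f z) * indicator unit_disk z \<partial>lebesgue)"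
    by (subst nn_integral_restrict_space) auto
  also have "\<dots> = (\<integral>\<^sup>+z. ennreal (1 / pi) * (ennreal (wt (cmod z)) * f z) * indicator unit_disk z \<partial>lborel)"
    by (rule nn_integral_completion)
  also have "\<dots> = (\<integral>\<^sup>+z. ennreal (wt (cmod z) / pi) * f z \<partial>lborel)"
  proof (rule nn_integral_cong)
    fix z show "ennreal (1 / pi) * (ennreal (wt (cmod z)) * f z) * indicator unit_disk z = ennreal (wt (cmod z) / pi) * f z"
      by (cases "cmod z < 1")
         (auto simp: wt_outside wt_nonneg ennreal_mult'[symmetric] mult.assoc[symmetric])
  qed
  finally show ?thesis .
qed

lemma distr_mu: "distr \<mu> borel (\<lambda>z. z) = density lborel (\<lambda>z. ennreal (wt (cmod z) / pi))"
proof (rule measure_eqI)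
  fix A assume "A \<in> sets (distr \<mu> borel (\<lambda>z. z))"
  then have [measurable]: "A \<in> sets borel" by simp
  have "emeasure (distr \<mu> borel (\<lambda>z. z)) A = (\<integral>\<^sup>+z. indicator A z \<partial>distr \<mu> borel (\<lambda>z. z))"
    by (simp del: nn_integral_distr)
  also have "\<dots> = (\<integral>\<^sup>+z. indicator A z \<partial>\<mu>)" by (subst nn_integral_distr) auto
  also have "\<dots> = emeasure (density lborel (\<lambda>z. ennreal (wt (cmod z) / pi))) A"
    by (subst nn_integral_mu_borel) (auto simp: emeasure_density)
  finally show "emeasure (distr \<mu> borel (\<lambda>z. z)) A = emeasure (density lborel (\<lambda>z. ennreal (wt (cmod z) / pi))) A" .
qed simp

lemma distr_mu_rotate:
  assumes "cmod c = 1"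
  shows "distr \<mu> borel ((*) c) = distr \<mu> borel (\<lambda>z. z)"
proof -
  have "distr \<mu> borel ((*) c) = distr (distr \<mu> borel (\<lambda>z. z)) borel ((*) c)"
    by (subst distr_distr) (auto simp: o_def)
  also have "\<dots> = distr (density lborel (\<lambda>z. ennreal (wt (cmod (c * z)) / pi))) borel ((*) c)"
    unfolding distr_mu using assms by (simp add: norm_mult)
  also have "\<dots> = density (distr lborel borel ((*) c)) (\<lambda>z. ennreal (wt (cmod z) / pi))"
    by (subst density_distr) auto
  also have "\<dots> = distr \<mu> borel (\<lambda>z. z)"
    by (simp add: lborel_complex_mult_unit[OF assms] distr_mu)
  finally show ?thesis .
qed

text \<open>The factor \<open>2 * r\<close> is the Jacobian \<open>2 * pi * r\<close> divided by the
  \<open>pi\<close> of the normalized area.\<close>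

lemma distr_mu_cmod: "distr \<mu> borel cmod = density lborel (\<lambda>r. ennreal (2 * r * wt r))"
proof -
  have "distr \<mu> borel cmod = distr (distr \<mu> borel (\<lambda>z. z)) borel cmod"
    by (subst distr_distr) (auto simp: o_def)
  also have "\<dots> = density (distr lborel borel cmod) (\<lambda>r. ennreal (wt r / pi))"
    unfolding distr_mu by (subst density_distr) auto
  also have "\<dots> = density lborel (\<lambda>r. ennreal (2 * pi * r) * indicator {0..} r * ennreal (wt r / pi))"
    unfolding distr_cmod_lborel by (subst density_density_eq) auto
  also have "(\<lambda>r. ennreal (2 * pi * r) * indicator {0..} r * ennreal (wt r / pi)) = (\<lambda>r. ennreal (2 * r * wt r))"
  proof
    fix r :: real
    show "ennreal (2 * pi * r) * indicator {0..} r * ennreal (wt r / pi) = ennreal (2 * r * wt r)"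
      by (cases "r \<ge> 0") (auto simp: ennreal_mult[symmetric] wt_outside wt_nonneg mult_ac)
  qed
  finally show ?thesis .
qed

lemma set_integral_weight:
  assumes [measurable]: "F \<in> borel_measurable borel"
  shows "(LINT r:{0..<1}|lebesgue. F r * \<omega> r) = (LINT r|lborel. F r * wt r)"
proof -
  have m: "(\<lambda>r. F r * wt r) \<in> borel_measurable lebesgue"
    by (intro measurable_completion) auto
  have ae: "AE r in lebesgue. F r * wt r = indicator {0..<1} r *\<^sub>R (F r * \<omega> r)"
    using wt_AE by (intro AE_completion) (auto elim!: eventually_mono)
  have "(LINT r|lborel. F r * wt r) = (LINT r|lebesgue. F r * wt r)"
    by (rule integral_completion[symmetric]) auto
  also have "\<dots> = (LINT r|lebesgue. indicator {0..<1} r *\<^sub>R (F r * \<omega> r))"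
    by (rule integral_cong_AE[OF m borel_measurable_AE[OF m ae] ae])
  finally show ?thesis by (simp add: set_lebesgue_integral_def)
qed

lemma integral_mu_cmod:
  assumes [measurable]: "F \<in> borel_measurable borel"
  shows "(LINT z|\<mu>. F (cmod z)) = 2 * (LINT r|lborel. r * F r * wt r)"
proof -
  have "(LINT z|\<mu>. F (cmod z)) = (LINT r|distr \<mu> borel cmod. F r)"
    by (subst integral_distr) auto
  also have "\<dots> = (LINT r|lborel. (2 * r * wt r) * F r)"
    unfolding distr_mu_cmod
  proof (subst integral_density)
    have "0 \<le> 2 * r * wt r" for r
      using wt_nonneg[of r] wt_outside[of r] by (cases "r \<in> {0..<1}") auto
    then show "AE r in lborel. 0 \<le> 2 * r * wt r" by simp
  qed auto
  also have "\<dots> = (LINT r|lborel. 2 * (r * F r * wt r))"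
    by (rule Bochner_Integration.integral_cong) auto
  finally show ?thesis by simp
qed

lemma wt_integrable: "integrable lborel wt"
proof -
  have "integrable lebesgue (\<lambda>r. indicator {0..<1} r *\<^sub>R \<omega> r)"
    using weight_integrable by (simp add: set_integrable_def)
  then have "integrable lebesgue wt"
    by (rule integrable_cong_AE_imp) (use wt_AE in \<open>auto intro!: AE_completion measurable_completion\<close>)
  then show ?thesis by (simp add: integrable_completion)
qed

lemma finite_measure_mu: "finite_measure \<mu>"
proof
  have "emeasure \<mu> (space \<mu>) = (\<integral>\<^sup>+r. 1 \<partial>distr \<mu> borel cmod)"
    by (subst nn_integral_distr) (auto simp del: nn_integral_const simp: nn_integral_const)
  also have "\<dots> = (\<integral>\<^sup>+r. ennreal (2 * r * wt r) \<partial>lborel)"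
    unfolding distr_mu_cmod by (subst nn_integral_density) auto
  also have "\<dots> \<le> (\<integral>\<^sup>+r. ennreal (2 * wt r) \<partial>lborel)"
  proof (intro nn_integral_mono ennreal_leI)
    fix r show "2 * r * wt r \<le> 2 * wt r"
      using wt_nonneg[of r] wt_outside[of r] mult_right_mono[of r 1 "wt r"] by (cases "r \<in> {0..<1}") auto
  qed
  also have "\<dots> < \<infinity>"
    using wt_integrable wt_nonneg by (subst nn_integral_eq_integral) auto
  finally show "emeasure \<mu> (space \<mu>) \<noteq> \<infinity>" by simp
qed

sublocale mu: finite_measure \<mu>
  by (rule finite_measure_mu)

lemma weighted_integrable:
  assumes [measurable]: "F \<in> borel_measurable borel" and b: "\<And>r. 0 \<le> r \<Longrightarrow> r < 1 \<Longrightarrow> \<bar>F r\<bar> \<le> B"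
  shows "integrable lborel (\<lambda>r. F r * wt r)"
proof (rule Bochner_Integration.integrable_bound[where f = "\<lambda>r. B * wt r"])
  show "integrable lborel (\<lambda>r. B * wt r)" using wt_integrable by simp
  have "norm (F r * wt r) \<le> norm (B * wt r)" for r
    using b[of r] wt_nonneg[of r] wt_outside[of r] mult_right_mono[of "\<bar>F r\<bar>" B "wt r"]
    by (cases "r \<in> {0..<1}") (auto simp: abs_mult)
  then show "AE r in lborel. norm (F r * wt r) \<le> norm (B * wt r)" by simp
qed auto

lemma weighted_integral_mono:
  assumes [measurable]: "F \<in> borel_measurable borel" "G \<in> borel_measurable borel"
    and b: "\<And>r. 0 \<le> r \<Longrightarrow> r < 1 \<Longrightarrow> 0 \<le> F r \<and> F r \<le> G r \<and> G r \<le> B"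
  shows "(LINT r|lborel. F r * wt r) \<le> (LINT r|lborel. G r * wt r)"
proof (rule integral_mono)
  show "integrable lborel (\<lambda>r. F r * wt r)" "integrable lborel (\<lambda>r. G r * wt r)"
    by (rule weighted_integrable[of _ B]; (use b in force)?)+
  show "F r * wt r \<le> G r * wt r" for r
    using b[of r] wt_nonneg[of r] wt_outside[of r]
    by (cases "r \<in> {0..<1}") (auto intro: mult_right_mono)
qed

section \<open>Tails and moments of the weight\<close>

lemma omega_hat_eq:
  assumes "0 \<le> s"
  shows "omega_hat \<omega> s = (LINT r|lborel. indicator {s..} r * wt r)"
proof -
  have "omega_hat \<omega> s = (LINT r:{0..<1}|lebesgue. indicator {s..} r * \<omega> r)"
    unfolding set_lebesgue_integral_def omega_hat_def
    by (rule Bochner_Integration.integral_cong) (use assms in \<open>auto simp: indicator_def\<close>)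
  also have "\<dots> = (LINT r|lborel. indicator {s..} r * wt r)"
    by (rule set_integral_weight) auto
  finally show ?thesis .
qed

lemma moment_eq: "moment \<omega> x = (LINT r|lborel. r powr x * wt r)"
  unfolding moment_def by (rule set_integral_weight) auto

lemma omega_hat_antimono: "0 \<le> s \<Longrightarrow> s \<le> t \<Longrightarrow> omega_hat \<omega> t \<le> omega_hat \<omega> s"
  by (simp add: omega_hat_eq, rule weighted_integral_mono[where B = 1]) (auto simp: indicator_def)

lemma moment_antimono:
  assumes "0 \<le> x" "x \<le> y"
  shows "moment \<omega> y \<le> moment \<omega> x"
proof -
  have "r powr y \<le> r powr x \<and> r powr x \<le> 1" if "0 \<le> r" "r < 1" for r :: real
    using assms that by (auto intro!: powr_mono' powr_le1)
  then show ?thesis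
    unfolding moment_eq by (intro weighted_integral_mono[where B = 1]) auto
qed

lemma moment_ge:
  assumes "0 \<le> x" "0 \<le> s" "s < 1"
  shows "s powr x * omega_hat \<omega> s \<le> moment \<omega> x"
proof -
  have "s powr x * omega_hat \<omega> s = (LINT r|lborel. (s powr x * indicator {s..} r) * wt r)"
    using assms by (simp add: omega_hat_eq mult.assoc)
  also have "\<dots> \<le> moment \<omega> x"
    unfolding moment_eq
  proof (rule weighted_integral_mono[where B = 1])
    fix r :: real assume "0 \<le> r" "r < 1"
    then show "0 \<le> s powr x * indicator {s..} r \<and> s powr x * indicator {s..} r \<le> r powr x \<and> r powr x \<le> 1"
      using assms by (auto simp: indicator_def intro!: powr_mono2 powr_le1)
  qed auto
  finally show ?thesis .
qed

lemma moment_pos: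
  assumes "0 \<le> x"
  shows "0 < moment \<omega> x"
proof -
  have "0 < (1 / 2) powr x * omega_hat \<omega> (1 / 2)"
    by (intro mult_pos_pos omega_hat_pos) auto
  also have "\<dots> \<le> moment \<omega> x" by (rule moment_ge) (use assms in auto)
  finally show ?thesis .
qed

text \<open>Below \<open>s\<close> the additional factor is at most \<open>s powr y\<close>; from
  \<open>s\<close> on, everything is at most 1. When \<open>y\<close> is a large multiple of
  \<open>1 / (1 - s)\<close>, the first term can be absorbed and the tail alone controls the
  moment.\<close>

lemma moment_add_le:
  assumes "0 \<le> x" "0 \<le> y" "0 \<le> s" "s < 1"
  shows "moment \<omega> (x + y) \<le> s powr y * moment \<omega> x + omega_hat \<omega> s"
proof -
  have "moment \<omega> (x + y) \<le> (LINT r|lborel. (s powr y * r powr x + indicator {s..} r) * wt r)"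
    unfolding moment_eq
  proof (rule weighted_integral_mono[where B = 2])
    fix r :: real assume r: "0 \<le> r" "r < 1"
    have p: "r powr x \<le> 1" "r powr y \<le> 1" "s powr y \<le> 1" using assms r by (auto intro!: powr_le1)
    have "r powr (x + y) \<le> s powr y * r powr x + indicator {s..} r"
    proof (cases "r < s")
      case True
      then have "r powr y \<le> s powr y" using r assms by (intro powr_mono2) auto
      then show ?thesis using True mult_right_mono[of "r powr y" "s powr y" "r powr x"]
        by (simp add: powr_add mult_ac)
    next
      case False
      then show ?thesis using p mult_le_one[of "r powr x" "r powr y"] by (simp add: powr_add add_increasing)
    qed
    moreover have "s powr y * r powr x \<le> 1" using p by (intro mult_le_one) auto
    ultimately show "0 \<le> r powr (x + y) \<and> r powr (x + y) \<le> s powr y * r powr x + indicator {s..} r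
      \<and> s powr y * r powr x + indicator {s..} r \<le> 2"
      by (auto simp: indicator_def)
  qed auto
  also have "\<dots> = (LINT r|lborel. s powr y * (r powr x * wt r) + indicator {s..} r * wt r)"
    by (rule Bochner_Integration.integral_cong) (auto simp: algebra_simps)
  also have "\<dots> = s powr y * moment \<omega> x + omega_hat \<omega> s"
  proof -
    have "integrable lborel (\<lambda>r. r powr x * wt r)"
      by (rule weighted_integrable[where B = 1]) (use assms in \<open>auto intro!: powr_le1\<close>)
    moreover have "integrable lborel (\<lambda>r. indicator {s..} r * wt r)"
      by (rule weighted_integrable[where B = 1]) auto
    ultimately show ?thesis using assms by (simp add: moment_eq omega_hat_eq)
  qed
  finally show ?thesis .
qed

lemma measure_annulus_eq:
  "measure \<mu> {z \<in> unit_disk. s \<le> cmod z} = 2 * (LINT r|lborel. (r * indicator {s..} r) * wt r)"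
proof -
  have "measure \<mu> {z \<in> unit_disk. s \<le> cmod z} = (LINT z|\<mu>. indicator {z \<in> unit_disk. s \<le> cmod z} z)"
    by (subst Bochner_Integration.integral_indicator) (auto intro!: arg_cong[where f = "measure \<mu>"])
  also have "\<dots> = (LINT z|\<mu>. indicator {s..} (cmod z))"
    by (rule Bochner_Integration.integral_cong) (auto simp: indicator_def)
  also have "\<dots> = 2 * (LINT r|lborel. (r * indicator {s..} r) * wt r)"
    by (rule integral_mu_cmod) auto
  finally show ?thesis .
qed

lemma measure_annulus_le:
  assumes "0 \<le> s"
  shows "measure \<mu> {z \<in> unit_disk. s \<le> cmod z} \<le> 2 * omega_hat \<omega> s"
  unfolding measure_annulus_eq omega_hat_eq[OF assms]
  by (intro mult_left_mono weighted_integral_mono[where B = 1]) (auto simp: indicator_def)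

lemma measure_annulus_ge:
  assumes "0 \<le> s"
  shows "2 * s * omega_hat \<omega> s \<le> measure \<mu> {z \<in> unit_disk. s \<le> cmod z}"
proof -
  have "s * omega_hat \<omega> s = (LINT r|lborel. (s * indicator {s..} r) * wt r)"
    by (simp add: omega_hat_eq[OF assms] mult.assoc)
  also have "\<dots> \<le> (LINT r|lborel. (r * indicator {s..} r) * wt r)"
    by (intro weighted_integral_mono[where B = 1]) (use assms in \<open>auto simp: indicator_def\<close>)
  finally show ?thesis unfolding measure_annulus_eq by simp
qed

text \<open>The exponent rises by 1 because of the Jacobian of polar coordinates.\<close>

lemma integral_powr_mu: "(LINT z|\<mu>. cmod z powr x) = 2 * moment \<omega> (x + 1)"
proof -
  have "(LINT z|\<mu>. cmod z powr x) = 2 * (LINT r|lborel. r * r powr x * wt r)"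
    by (rule integral_mu_cmod) auto
  also have "(LINT r|lborel. r * r powr x * wt r) = moment \<omega> (x + 1)"
    unfolding moment_eq
  proof (rule Bochner_Integration.integral_cong)
    fix r show "r * r powr x * wt r = r powr (x + 1) * wt r"
      by (cases "r \<ge> 0") (auto simp: wt_outside powr_add)
  qed simp
  finally show ?thesis .
qed

lemma integral_power_mu: "(LINT z|\<mu>. cmod z ^ n) = 2 * moment \<omega> (real n + 1)"
proof -
  have "(LINT z|\<mu>. cmod z ^ n) = 2 * (LINT r|lborel. r * r ^ n * wt r)"
    by (rule integral_mu_cmod) auto
  also have "(LINT r|lborel. r * r ^ n * wt r) = moment \<omega> (real n + 1)"
    unfolding moment_eq
  proof (rule Bochner_Integration.integral_cong)
    fix r show "r * r ^ n * wt r = r powr (real n + 1) * wt r"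
      by (cases "r > 0"; cases "r = 0") (auto simp: wt_outside powr_add powr_realpow)
  qed simp
  finally show ?thesis .
qed

section \<open>Rotation invariance and orthogonality of monomials\<close>

lemma integral_mu_rotate:
  fixes G :: "complex \<Rightarrow> 'a::{banach, second_countable_topology}"
  assumes [measurable]: "G \<in> borel_measurable borel" and "cmod c = 1"
  shows "(LINT z|\<mu>. G (c * z)) = (LINT z|\<mu>. G z)"
proof -
  have "(LINT z|\<mu>. G (c * z)) = (LINT z|distr \<mu> borel ((*) c). G z)"
    by (subst integral_distr) auto
  also have "\<dots> = (LINT z|\<mu>. G z)"
    unfolding distr_mu_rotate[OF assms(2)] by (subst integral_distr) auto
  finally show ?thesis .
qed

lemma measure_mu_rotate:
  assumes "A \<in> sets borel" "cmod c = 1" "A \<subseteq> unit_disk"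
  shows "measure \<mu> {z. c * z \<in> A} = measure \<mu> A"
proof -
  have u: "{z. c * z \<in> A} \<subseteq> unit_disk"
    using assms by (auto simp: norm_mult subset_eq)
  have "measure \<mu> {z. c * z \<in> A} = measure (distr \<mu> borel ((*) c)) A"
    using assms u by (subst measure_distr) (auto intro!: arg_cong[where f = "measure \<mu>"])
  also have "\<dots> = measure \<mu> A"
    unfolding distr_mu_rotate[OF assms(2)]
    using assms by (subst measure_distr) (auto intro!: arg_cong[where f = "measure \<mu>"])
  finally show ?thesis .
qed

text \<open>A rotation by \<open>c\<close> leaves the integral unchanged and also multiplies it by
  \<open>c ^ n * cnj c ^ m\<close>; some \<open>c\<close> makes this factor different from
  1.\<close>

lemma integral_monomial_mu:
  fixes F :: "real \<Rightarrow> real"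
  assumes [measurable]: "F \<in> borel_measurable borel" and "n \<noteq> m"
  shows "(LINT z|\<mu>. z ^ n * cnj z ^ m * of_real (F (cmod z))) = 0"
proof -
  obtain c :: complex where c: "cmod c = 1" "c ^ n * cnj c ^ m \<noteq> 1"
  proof
    \<comment> \<open>With this angle the factor is exactly \<open>cis 1\<close>, and
      \<open>sin 1 > 0\<close> shows that it is not 1.\<close>
    define t where "t = 1 / (real n - real m)"
    have nm: "real n - real m \<noteq> 0" using assms by auto
    show "cmod (cis t) = 1" by simp
    have "cis t ^ n * cnj (cis t) ^ m = cis (real n * t) * cis (real m * (- t))"
      by (simp only: cis_cnj Complex.DeMoivre)
    also have "\<dots> = cis (real n * t - real m * t)"
      by (simp add: cis_mult)
    also have "real n * t - real m * t = (real n - real m) * t"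
      by (simp add: left_diff_distrib)
    also have "\<dots> = 1"
      using nm by (simp add: t_def)
    also have "cis 1 \<noteq> 1"
    proof
      assume "cis 1 = 1"
      then have "sin (1::real) = 0" by (metis cis.sel(2) one_complex.sel(2))
      moreover have "sin (1::real) > 0" by (rule sin_gt_zero) (use pi_gt3 in auto)
      ultimately show False by simp
    qed
    finally show "cis t ^ n * cnj (cis t) ^ m \<noteq> 1" .
  qed
  define I where "I = (LINT z|\<mu>. z ^ n * cnj z ^ m * of_real (F (cmod z)))"
  have "I = (LINT z|\<mu>. (c * z) ^ n * cnj (c * z) ^ m * of_real (F (cmod (c * z))))"
    unfolding I_def by (rule integral_mu_rotate[symmetric]) (use c in simp_all)
  also have "\<dots> = (LINT z|\<mu>. (c ^ n * cnj c ^ m) * (z ^ n * cnj z ^ m * of_real (F (cmod z))))"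
    by (rule Bochner_Integration.integral_cong) (auto simp: norm_mult c power_mult_distrib mult_ac)
  also have "\<dots> = (c ^ n * cnj c ^ m) * I" by (simp add: I_def)
  finally show ?thesis using c(2) unfolding I_def[symmetric] by auto
qed

end

subsection \<open>The Bergman projection\<close>

context radial begin

abbreviation P :: "(complex \<Rightarrow> complex) \<Rightarrow> complex \<Rightarrow> complex" where
  "P \<equiv> bergman_proj \<omega>"

text \<open>The reciprocal of the squared norm of \<open>z ^ n\<close> in the weighted space, see
  \<open>integral_monomials\<close>.\<close>

definition coef :: "nat \<Rightarrow> real" where
  "coef n = 1 / (2 * moment \<omega> (2 * real n + 1))"

lemma coef_pos: "0 < coef n"
  using moment_pos[of "2 * real n + 1"] by (simp add: coef_def)

lemma coef_nonneg [simp]: "0 \<le> coef n"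
  using coef_pos[of n] by simp

lemma coef_mono: "n \<le> m \<Longrightarrow> coef n \<le> coef m"
  unfolding coef_def using moment_pos[of "2 * real m + 1"] moment_antimono[of "2 * real n + 1" "2 * real m + 1"]
  by (intro divide_left_mono) auto

text \<open>The tail at each \<open>s < 1\<close> is positive, so the moments are bounded below by a
  multiple of \<open>s ^ (2 * n + 1)\<close>. Taking \<open>s ^ 2\<close> halfway between
  \<open>x\<close> and 1 leaves a convergent geometric series.\<close>

lemma summable_coef:
  assumes "0 \<le> x" "x < 1"
  shows "summable (\<lambda>n. coef n * x ^ n)"
proof -
  define s where "s = sqrt ((1 + x) / 2)"
  have s: "0 < s" "s < 1" "s\<^sup>2 = (1 + x) / 2"
    using assms by (auto simp: s_def)
  have sx: "x < s\<^sup>2" using assms s by simp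
  have "summable (\<lambda>n. 1 / (2 * s * omega_hat \<omega> s) * (x / s\<^sup>2) ^ n)"
    using assms s(1) sx by (intro summable_mult summable_geometric) auto
  then show ?thesis
  proof (rule summable_comparison_test')
    fix n
    have W: "0 < omega_hat \<omega> s" using s by (intro omega_hat_pos) auto
    have "s ^ (2 * n + 1) * omega_hat \<omega> s \<le> moment \<omega> (2 * real n + 1)"
      using moment_ge[of "real (2 * n + 1)" s] powr_realpow[of s "2 * n + 1"] s by (simp add: add.commute)
    then have "coef n \<le> 1 / (2 * (s ^ (2 * n + 1) * omega_hat \<omega> s))"
      unfolding coef_def using s W moment_pos[of "2 * real n + 1"] by (intro divide_left_mono) auto
    also have "2 * (s ^ (2 * n + 1) * omega_hat \<omega> s) = (2 * s * omega_hat \<omega> s) * (s\<^sup>2) ^ n"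
      by (simp add: power_mult)
    also have "1 / \<dots> = 1 / (2 * s * omega_hat \<omega> s) * (1 / s\<^sup>2) ^ n"
      by (simp only: power_one_over times_divide_times_eq mult_1_left)
    finally have "coef n * x ^ n \<le> 1 / (2 * s * omega_hat \<omega> s) * (1 / s\<^sup>2) ^ n * x ^ n"
      using assms by (intro mult_right_mono) auto
    then show "norm (coef n * x ^ n) \<le> 1 / (2 * s * omega_hat \<omega> s) * (x / s\<^sup>2) ^ n"
      using assms coef_pos[of n] by (simp add: abs_mult power_divide)
  qed
qed

text \<open>The kernel on the positive axis; as the coefficients are nonnegative, it majorizes
  \<open>K\<close> on circles.\<close>

definition Kr :: "real \<Rightarrow> real" where
  "Kr x = (\<Sum>n. coef n * x ^ n)"

definition K :: "complex \<Rightarrow> complex" where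
  "K w = (\<Sum>n. of_real (coef n) * w ^ n)"

lemma K_summable: "cmod w < 1 \<Longrightarrow> summable (\<lambda>n. norm (of_real (coef n) * w ^ n))"
  using summable_coef[of "cmod w"] coef_pos by (simp add: norm_mult norm_power abs_of_pos)

lemma K_sums: "cmod w < 1 \<Longrightarrow> (\<lambda>n. of_real (coef n) * w ^ n) sums K w"
  unfolding K_def by (rule summable_sums, rule summable_norm_cancel, rule K_summable)

lemma Kr_mono:
  assumes "0 \<le> x" "x \<le> y" "y < 1"
  shows "Kr x \<le> Kr y"
  unfolding Kr_def
  by (rule suminf_le) (use assms summable_coef[of x] summable_coef[of y] in \<open>auto intro!: mult_left_mono power_mono\<close>)

lemma Kr_nonneg: "0 \<le> x \<Longrightarrow> x < 1 \<Longrightarrow> 0 \<le> Kr x"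
  unfolding Kr_def by (intro suminf_nonneg summable_coef) auto

lemma norm_K_le: "cmod w < 1 \<Longrightarrow> cmod (K w) \<le> Kr (cmod w)"
  unfolding K_def Kr_def using summable_norm[OF K_summable[of w]] coef_pos
  by (simp add: norm_mult norm_power abs_of_pos)

lemma K_measurable [measurable]: "K \<in> borel_measurable borel"
  unfolding K_def[abs_def] by measurable

lemma bergman_kernel_eq: "bergman_kernel \<omega> z \<zeta> = K (cnj z * \<zeta>)"
  unfolding bergman_kernel_def K_def coef_def by (intro suminf_cong) (simp add: field_simps)

lemma norm_mult_lt_1: "cmod z < 1 \<Longrightarrow> cmod \<zeta> \<le> 1 \<Longrightarrow> cmod (cnj z * \<zeta>) < 1"
  by (metis complex_mod_cnj mult_left_le norm_ge_zero norm_mult order_le_less_trans)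

lemma norm_K_mult_le:
  assumes "cmod z < 1" "cmod \<zeta> \<le> 1"
  shows "cmod (K (cnj z * \<zeta>)) \<le> Kr (cmod z)"
proof -
  have "cmod (cnj z * \<zeta>) \<le> cmod z" using assms by (simp add: norm_mult mult_left_le)
  then show ?thesis
    using norm_K_le[OF norm_mult_lt_1[OF assms]] Kr_mono[of "cmod (cnj z * \<zeta>)" "cmod z"] assms by auto
qed

lemma integrable_mult_K:
  assumes f: "integrable \<mu> f" and z: "cmod z < 1"
  shows "integrable \<mu> (\<lambda>\<zeta>. f \<zeta> * cnj (K (cnj z * \<zeta>)))"
proof (rule Bochner_Integration.integrable_bound)
  show "integrable \<mu> (\<lambda>\<zeta>. Kr (cmod z) *\<^sub>R f \<zeta>)" using f by simp
  show "(\<lambda>\<zeta>. f \<zeta> * cnj (K (cnj z * \<zeta>))) \<in> borel_measurable \<mu>"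
    using f by measurable
  have "norm (f \<zeta> * cnj (K (cnj z * \<zeta>))) \<le> norm (Kr (cmod z) *\<^sub>R f \<zeta>)" if "\<zeta> \<in> space \<mu>" for \<zeta>
    using norm_K_mult_le[of z \<zeta>] that z Kr_nonneg[of "cmod z"]
    by (simp add: norm_mult mult.commute mult_left_mono)
  then show "AE \<zeta> in \<mu>. norm (f \<zeta> * cnj (K (cnj z * \<zeta>))) \<le> norm (Kr (cmod z) *\<^sub>R f \<zeta>)"
    by (rule AE_I2)
qed

lemma integral_mu:
  fixes f :: "complex \<Rightarrow> 'a::{banach, second_countable_topology}"
  assumes "f \<in> borel_measurable \<mu>"
  shows "(LINT z|\<mu>. f z) = (LINT z|dA. \<omega> (cmod z) *\<^sub>R f z)"
  unfolding \<mu>_def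
proof (rule integral_density)
  show "f \<in> borel_measurable dA" using assms by measurable
  show "AE z in dA. 0 \<le> \<omega> (cmod z)" by (rule AE_I2) (auto intro: weight_nonneg)
qed measurable

lemma P_eq:
  assumes [measurable]: "f \<in> borel_measurable \<mu>"
  shows "P f z = (LINT \<zeta>|\<mu>. f \<zeta> * cnj (K (cnj z * \<zeta>)))"
  unfolding bergman_proj_def bergman_kernel_eq
  by (subst integral_mu) (auto simp: scaleR_conv_of_real mult_ac)

lemma norm_P_le:
  assumes f: "integrable \<mu> f" and z: "cmod z < 1"
  shows "cmod (P f z) \<le> Kr (cmod z) * (LINT \<zeta>|\<mu>. cmod (f \<zeta>))"
proof -
  have [measurable]: "f \<in> borel_measurable \<mu>" using f by auto
  have "cmod (P f z) \<le> (LINT \<zeta>|\<mu>. cmod (f \<zeta> * cnj (K (cnj z * \<zeta>))))"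
    unfolding P_eq[OF \<open>f \<in> borel_measurable \<mu>\<close>] by (rule integral_norm_bound)
  also have "\<dots> \<le> (LINT \<zeta>|\<mu>. Kr (cmod z) * cmod (f \<zeta>))"
  proof (rule integral_mono)
    show "integrable \<mu> (\<lambda>\<zeta>. cmod (f \<zeta> * cnj (K (cnj z * \<zeta>))))"
      by (rule integrable_norm, rule integrable_mult_K[OF f z])
    show "integrable \<mu> (\<lambda>\<zeta>. Kr (cmod z) * cmod (f \<zeta>))" using f by auto
    show "cmod (f \<zeta> * cnj (K (cnj z * \<zeta>))) \<le> Kr (cmod z) * cmod (f \<zeta>)" if "\<zeta> \<in> space \<mu>" for \<zeta>
      using norm_K_mult_le[of z \<zeta>] that z by (simp add: norm_mult mult.commute mult_left_mono)
  qed
  finally show ?thesis by simp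
qed

lemma P_add:
  assumes "integrable \<mu> f" "integrable \<mu> g" "cmod z < 1"
  shows "P (\<lambda>\<zeta>. f \<zeta> + g \<zeta>) z = P f z + P g z"
  using assms integrable_mult_K[OF assms(1,3)] integrable_mult_K[OF assms(2,3)]
  by (subst (1 2 3) P_eq) (auto simp: distrib_right)

lemma P_cmult:
  assumes "integrable \<mu> f"
  shows "P (\<lambda>\<zeta>. c * f \<zeta>) z = c * P f z"
  using assms by (subst (1 2) P_eq) (auto simp: mult.assoc)

lemma P_zero: "P (\<lambda>\<zeta>. 0) z = 0"
  by (simp add: bergman_proj_def)

lemma P_sum:
  assumes "finite A" "\<And>i. i \<in> A \<Longrightarrow> integrable \<mu> (f i)" "cmod z < 1"
  shows "P (\<lambda>\<zeta>. \<Sum>i\<in>A. f i \<zeta>) z = (\<Sum>i\<in>A. P (f i) z)"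
  using assms by (induction A rule: finite_induct) (auto simp: P_zero P_add)

lemma P_cong:
  assumes "\<And>z. z \<in> unit_disk \<Longrightarrow> f z = g z"
  shows "P f z = P g z"
  unfolding bergman_proj_def by (rule Bochner_Integration.integral_cong) (auto simp: assms)

definition fcoef :: "(complex \<Rightarrow> complex) \<Rightarrow> nat \<Rightarrow> complex" where
  "fcoef f n = (LINT \<zeta>|\<mu>. f \<zeta> * cnj \<zeta> ^ n)"

lemma integrable_mult_power:
  assumes f: "integrable \<mu> f"
  shows "integrable \<mu> (\<lambda>\<zeta>. f \<zeta> * cnj \<zeta> ^ n)"
proof (rule Bochner_Integration.integrable_bound[OF f])
  show "(\<lambda>\<zeta>. f \<zeta> * cnj \<zeta> ^ n) \<in> borel_measurable \<mu>" using f by measurable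
  show "AE \<zeta> in \<mu>. norm (f \<zeta> * cnj \<zeta> ^ n) \<le> norm (f \<zeta>)"
    by (rule AE_I2) (auto simp: norm_mult norm_power intro!: mult_left_le power_le_one)
qed

text \<open>Turns the projection into a power series in \<open>z\<close>, the source of its
  measurability and of the square mean bound. Integration term by term is dominated by
  \<open>coef n * cmod z ^ n\<close>, since powers of \<open>\<zeta>\<close> are at most 1 in
  modulus.\<close>

lemma P_sums:
  assumes f: "integrable \<mu> f" and z: "cmod z < 1"
  shows "(\<lambda>n. of_real (coef n) * fcoef f n * z ^ n) sums P f z"
proof -
  define F where "F n \<zeta> = (of_real (coef n) * z ^ n) * (f \<zeta> * cnj \<zeta> ^ n)" for n \<zeta>
  have iF: "integrable \<mu> (F n)" for n
    unfolding F_def using integrable_mult_power[OF f] by simp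
  have nF: "norm (F n \<zeta>) \<le> cmod (f \<zeta>) * (coef n * cmod z ^ n)" if "cmod \<zeta> < 1" for n \<zeta>
  proof -
    have "norm (F n \<zeta>) = cmod (f \<zeta>) * (coef n * cmod z ^ n) * cmod \<zeta> ^ n"
      using coef_pos[of n] by (simp add: F_def norm_mult norm_power)
    also have "\<dots> \<le> cmod (f \<zeta>) * (coef n * cmod z ^ n) * 1"
      using coef_pos[of n] that by (intro mult_left_mono power_le_one) auto
    finally show ?thesis by simp
  qed
  have "(\<lambda>n. integral\<^sup>L \<mu> (F n)) sums (LINT \<zeta>|\<mu>. (\<Sum>n. F n \<zeta>))"
  proof (rule sums_integral[OF iF])
    show "AE \<zeta> in \<mu>. summable (\<lambda>n. norm (F n \<zeta>))"
    proof (rule AE_I2)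
      fix \<zeta> assume \<zeta>: "\<zeta> \<in> space \<mu>"
      show "summable (\<lambda>n. norm (F n \<zeta>))"
        by (rule summable_comparison_test'[OF summable_mult[OF summable_coef[of "cmod z"], of "cmod (f \<zeta>)"], of 0])
           (use nF[of \<zeta>] \<zeta> z in auto)
    qed
    have "integral\<^sup>L \<mu> (\<lambda>\<zeta>. norm (F n \<zeta>)) \<le> (LINT \<zeta>|\<mu>. cmod (f \<zeta>)) * (coef n * cmod z ^ n)" for n
    proof -
      have "integral\<^sup>L \<mu> (\<lambda>\<zeta>. norm (F n \<zeta>)) \<le> (LINT \<zeta>|\<mu>. cmod (f \<zeta>) * (coef n * cmod z ^ n))"
        by (rule integral_mono) (use iF f nF in auto)
      then show ?thesis by simp
    qed
    then show "summable (\<lambda>n. integral\<^sup>L \<mu> (\<lambda>\<zeta>. norm (F n \<zeta>)))"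
      by (intro summable_comparison_test'[OF summable_mult[OF summable_coef[of "cmod z"], of "LINT \<zeta>|\<mu>. cmod (f \<zeta>)"], of 0])
         (use z in auto)
  qed
  moreover have "integral\<^sup>L \<mu> (F n) = of_real (coef n) * fcoef f n * z ^ n" for n
  proof -
    have "integral\<^sup>L \<mu> (F n) = (of_real (coef n) * z ^ n) * fcoef f n"
      unfolding F_def[abs_def] fcoef_def by simp
    then show ?thesis by (simp add: mult_ac)
  qed
  moreover have "(LINT \<zeta>|\<mu>. (\<Sum>n. F n \<zeta>)) = P f z"
  proof -
    have "(LINT \<zeta>|\<mu>. (\<Sum>n. F n \<zeta>)) = (LINT \<zeta>|\<mu>. f \<zeta> * cnj (K (cnj z * \<zeta>)))"
    proof (rule Bochner_Integration.integral_cong)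
      fix \<zeta> assume \<zeta>: "\<zeta> \<in> space \<mu>"
      have "(\<lambda>n. cnj (of_real (coef n) * (cnj z * \<zeta>) ^ n)) sums cnj (K (cnj z * \<zeta>))"
        using K_sums[OF norm_mult_lt_1, of z \<zeta>] z \<zeta> by (simp only: sums_cnj) auto
      from sums_mult[OF this, of "f \<zeta>"]
      have "(\<lambda>n. F n \<zeta>) sums (f \<zeta> * cnj (K (cnj z * \<zeta>)))"
        by (simp add: F_def power_mult_distrib mult_ac)
      then show "(\<Sum>n. F n \<zeta>) = f \<zeta> * cnj (K (cnj z * \<zeta>))" by (rule sums_unique[symmetric])
    qed simp
    then show ?thesis using f by (simp add: P_eq)
  qed
  ultimately show ?thesis by simp
qed

lemma P_measurable:
  assumes "integrable \<mu> f"
  shows "P f \<in> borel_measurable \<mu>"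
proof -
  have "(\<lambda>z. \<Sum>n. of_real (coef n) * fcoef f n * z ^ n) \<in> borel_measurable \<mu>"
    by measurable
  then show ?thesis
    by (rule measurable_cong[THEN iffD1, rotated]) (use P_sums[OF assms] in \<open>auto dest: sums_unique[symmetric]\<close>)
qed

end

subsection \<open>The projection on square integrable functions\<close>

context radial begin

lemma integrable_bounded:
  assumes "f \<in> borel_measurable \<mu>" "\<And>z. z \<in> unit_disk \<Longrightarrow> norm (f z) \<le> B"
  shows "integrable \<mu> (f :: complex \<Rightarrow> 'a::{banach, second_countable_topology})"
  by (rule mu.integrable_const_bound[where B = B]) (use assms in auto)

lemma integral_monomials:
  "(LINT z|\<mu>. z ^ n * cnj z ^ m) = (if n = m then of_real (1 / coef n) else 0)"
proof (cases "n = m")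
  case True
  have "(LINT z|\<mu>. z ^ n * cnj z ^ n) = (LINT z|\<mu>. of_real (cmod z ^ (2 * n)))"
    by (rule Bochner_Integration.integral_cong)
       (auto simp: power_mult complex_norm_square[symmetric] power_mult_distrib[symmetric])
  also have "\<dots> = of_real (LINT z|\<mu>. cmod z ^ (2 * n))"
    by (rule integral_complex_of_real)
  also have "\<dots> = of_real (2 * moment \<omega> (2 * real n + 1))"
    using integral_power_mu[of "2 * n"] by simp
  finally show ?thesis using True by (simp add: coef_def)
next
  case False
  then show ?thesis using integral_monomial_mu[of "\<lambda>_. 1" n m] by simp
qed

text \<open>Only partial sums are considered, because \<open>P f\<close> is not yet known to be
  square integrable. By orthogonality the pairing of \<open>f\<close> with \<open>p\<close> and the
  squared norm of \<open>p\<close> have the same value \<open>S\<close>; it remains to expand the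
  nonnegative integral of the square of \<open>cmod (f z - p z)\<close>.\<close>

lemma Bessel:
  fixes f :: "complex \<Rightarrow> complex" and N :: nat
  assumes f: "integrable \<mu> f" and f2: "integrable \<mu> (\<lambda>z. (cmod (f z))\<^sup>2)"
  defines "p \<equiv> \<lambda>z. \<Sum>n<N. of_real (coef n) * fcoef f n * z ^ n"
  shows "(LINT z|\<mu>. (cmod (p z))\<^sup>2) \<le> (LINT z|\<mu>. (cmod (f z))\<^sup>2)"
    and "integrable \<mu> (\<lambda>z. (cmod (p z))\<^sup>2)"
proof -
  have [measurable]: "f \<in> borel_measurable \<mu>" using f by auto
  have p_meas [measurable]: "p \<in> borel_measurable \<mu>" unfolding p_def by measurable
  define B where "B = (\<Sum>n<N. cmod (of_real (coef n) * fcoef f n))"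
  have pB: "cmod (p z) \<le> B" if "z \<in> unit_disk" for z
    unfolding p_def B_def
    by (rule sum_norm_le) (use that in \<open>auto simp: norm_mult norm_power intro!: mult_left_le power_le_one\<close>)
  have B0: "0 \<le> B" unfolding B_def by (intro sum_nonneg) auto
  show ip2: "integrable \<mu> (\<lambda>z. (cmod (p z))\<^sup>2)"
    by (rule integrable_bounded[where B = "B\<^sup>2"]) (use pB in \<open>auto intro!: power_mono\<close>)
  define S where "S = (\<Sum>n<N. coef n * (cmod (fcoef f n))\<^sup>2)"
  have ifp: "integrable \<mu> (\<lambda>z. f z * cnj (p z))"
  proof (rule Bochner_Integration.integrable_bound)
    show "integrable \<mu> (\<lambda>z. B *\<^sub>R f z)" using f by simp
    have "norm (f z * cnj (p z)) \<le> norm (B *\<^sub>R f z)" if "z \<in> space \<mu>" for z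
      using mult_left_mono[OF pB[of z], of "cmod (f z)"] that B0 by (simp add: norm_mult mult.commute)
    then show "AE z in \<mu>. norm (f z * cnj (p z)) \<le> norm (B *\<^sub>R f z)" by (rule AE_I2)
  qed measurable
  have fp: "(LINT z|\<mu>. f z * cnj (p z)) = of_real S"
  proof -
    have "(LINT z|\<mu>. f z * cnj (p z)) = (LINT z|\<mu>. (\<Sum>n<N. (of_real (coef n) * cnj (fcoef f n)) * (f z * cnj z ^ n)))"
      by (rule Bochner_Integration.integral_cong) (auto simp: p_def sum_distrib_left mult_ac)
    also have "\<dots> = (\<Sum>n<N. (of_real (coef n) * cnj (fcoef f n)) * fcoef f n)"
      unfolding fcoef_def[of f]
      by (subst Bochner_Integration.integral_sum) (use integrable_mult_power[OF f] in auto)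
    also have "\<dots> = of_real S"
      by (simp add: S_def complex_norm_square mult_ac del: of_real_power)
    finally show ?thesis .
  qed
  have pp: "(LINT z|\<mu>. of_real ((cmod (p z))\<^sup>2)) = complex_of_real S"
  proof -
    have i: "integrable \<mu> (\<lambda>z. z ^ n * cnj z ^ m)" for n m
      by (rule integrable_bounded[where B = 1])
         (auto simp: norm_mult norm_power intro!: mult_le_one power_le_one)
    define b where "b n = of_real (coef n) * fcoef f n" for n
    have pb: "p z = (\<Sum>n<N. b n * z ^ n)" for z by (simp add: p_def b_def)
    have "(LINT z|\<mu>. of_real ((cmod (p z))\<^sup>2))
       = (LINT z|\<mu>. (\<Sum>n<N. \<Sum>m<N. (b n * cnj (b m)) * (z ^ n * cnj z ^ m)))"
      by (rule Bochner_Integration.integral_cong)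
         (simp_all only: complex_norm_square pb cnj_sum sum_product complex_cnj_mult complex_cnj_power mult_ac)
    also have "\<dots> = (\<Sum>n<N. \<Sum>m<N. (b n * cnj (b m)) * (if n = m then of_real (1 / coef n) else 0))"
      using i by (simp add: integral_monomials)
    also have "\<dots> = (\<Sum>n<N. (b n * cnj (b n)) * of_real (1 / coef n))"
      by (rule sum.cong[OF refl]) (simp add: if_distrib sum.delta cong: if_cong)
    also have "\<dots> = of_real S"
      unfolding S_def of_real_sum
    proof (rule sum.cong[OF refl])
      fix n
      have "complex_of_real (coef n) \<noteq> 0" using coef_pos[of n] by simp
      then show "b n * cnj (b n) * of_real (1 / coef n) = of_real (coef n * (cmod (fcoef f n))\<^sup>2)"
        by (simp add: b_def complex_norm_square field_simps del: of_real_power)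
    qed
    finally show ?thesis .
  qed
  have pS: "(LINT z|\<mu>. (cmod (p z))\<^sup>2) = S"
  proof -
    have "complex_of_real (LINT z|\<mu>. (cmod (p z))\<^sup>2) = of_real S"
      using pp by (simp only: integral_complex_of_real)
    then show ?thesis by (simp only: of_real_eq_iff)
  qed
  have "0 \<le> (LINT z|\<mu>. (cmod (f z - p z))\<^sup>2)" by (rule integral_nonneg_AE) auto
  also have "\<dots> = (LINT z|\<mu>. (cmod (f z))\<^sup>2 - 2 * Re (f z * cnj (p z)) + (cmod (p z))\<^sup>2)"
    by (rule Bochner_Integration.integral_cong, simp, unfold cmod_power2)
       (simp add: power2_eq_square algebra_simps)
  also have "\<dots> = (LINT z|\<mu>. (cmod (f z))\<^sup>2) - 2 * (LINT z|\<mu>. Re (f z * cnj (p z))) + (LINT z|\<mu>. (cmod (p z))\<^sup>2)"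
    using f2 ip2 integrable_Re[OF ifp] by (simp del: times_complex.sel complex_mult_cnj)
  also have "(LINT z|\<mu>. Re (f z * cnj (p z))) = S"
    using integral_Re[OF ifp] fp by simp
  finally show "(LINT z|\<mu>. (cmod (p z))\<^sup>2) \<le> (LINT z|\<mu>. (cmod (f z))\<^sup>2)"
    by (simp add: pS)
qed

text \<open>Fatou's lemma along the partial sums. The nonnegative integral on the left makes square
  integrability of \<open>P f\<close> part of the conclusion.\<close>

lemma P_L2:
  assumes f: "integrable \<mu> f" and f2: "integrable \<mu> (\<lambda>z. (cmod (f z))\<^sup>2)"
  shows "(\<integral>\<^sup>+z. ennreal ((cmod (P f z))\<^sup>2) \<partial>\<mu>) \<le> ennreal (LINT z|\<mu>. (cmod (f z))\<^sup>2)"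
proof -
  define p where "p N z = (\<Sum>n<N. of_real (coef n) * fcoef f n * z ^ n)" for N :: nat and z
  have [measurable]: "p N \<in> borel_measurable \<mu>" for N unfolding p_def by measurable
  have "(\<integral>\<^sup>+z. ennreal ((cmod (P f z))\<^sup>2) \<partial>\<mu>) = (\<integral>\<^sup>+z. liminf (\<lambda>N. ennreal ((cmod (p N z))\<^sup>2)) \<partial>\<mu>)"
  proof (rule nn_integral_cong)
    fix z assume "z \<in> space \<mu>"
    then have "(\<lambda>N. p N z) \<longlonglongrightarrow> P f z" using P_sums[OF f, of z] by (simp add: sums_def p_def)
    then have "(\<lambda>N. ennreal ((cmod (p N z))\<^sup>2)) \<longlonglongrightarrow> ennreal ((cmod (P f z))\<^sup>2)"
      by (intro tendsto_ennrealI tendsto_intros)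
    then show "ennreal ((cmod (P f z))\<^sup>2) = liminf (\<lambda>N. ennreal ((cmod (p N z))\<^sup>2))"
      by (intro lim_imp_Liminf[symmetric]) auto
  qed
  also have "\<dots> \<le> liminf (\<lambda>N. \<integral>\<^sup>+z. ennreal ((cmod (p N z))\<^sup>2) \<partial>\<mu>)"
    by (rule nn_integral_liminf) measurable
  also have "\<dots> \<le> limsup (\<lambda>N. \<integral>\<^sup>+z. ennreal ((cmod (p N z))\<^sup>2) \<partial>\<mu>)"
    by (rule Liminf_le_Limsup) simp
  also have "\<dots> \<le> ennreal (LINT z|\<mu>. (cmod (f z))\<^sup>2)"
  proof (rule Limsup_bounded, rule always_eventually, rule allI)
    fix N
    have "(\<integral>\<^sup>+z. ennreal ((cmod (p N z))\<^sup>2) \<partial>\<mu>) = ennreal (LINT z|\<mu>. (cmod (p N z))\<^sup>2)"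
      using Bessel(2)[OF f f2, of N] by (intro nn_integral_eq_integral) (auto simp: p_def)
    also have "\<dots> \<le> ennreal (LINT z|\<mu>. (cmod (f z))\<^sup>2)"
      using Bessel(1)[OF f f2, of N] by (intro ennreal_leI) (auto simp: p_def)
    finally show "(\<integral>\<^sup>+z. ennreal ((cmod (p N z))\<^sup>2) \<partial>\<mu>) \<le> ennreal (LINT z|\<mu>. (cmod (f z))\<^sup>2)" .
  qed
  finally show ?thesis .
qed

definition weak_type :: "real \<Rightarrow> bool" where
  "weak_type C \<longleftrightarrow> 0 \<le> C \<and> (\<forall>f t. integrable \<mu> f \<longrightarrow> 0 < t \<longrightarrow>
     t * measure \<mu> {z \<in> unit_disk. t < cmod (P f z)} \<le> C * (LINT z|\<mu>. cmod (f z)))"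

text \<open>Cut \<open>f\<close> at height \<open>t\<close>. The large part is handled by the weak
  type bound; the small part is bounded, hence square integrable, and Chebyshev's inequality with
  the contraction applies. The level \<open>2 * t\<close> is shared equally between the two
  parts.\<close>

lemma weak_type_L2_sum:
  assumes C: "weak_type C" and f: "integrable \<mu> f" and t: "0 < t"
  shows "emeasure \<mu> {z \<in> unit_disk. 2 * t < cmod (P f z)} \<le>
    ennreal (C / t) * (\<integral>\<^sup>+z. ennreal (cmod (f z)) * indicator {t<..} (cmod (f z)) \<partial>\<mu>) +
    ennreal (1 / t\<^sup>2) * (\<integral>\<^sup>+z. ennreal ((cmod (f z))\<^sup>2) * indicator {..t} (cmod (f z)) \<partial>\<mu>)"
proof -
  have [measurable]: "f \<in> borel_measurable \<mu>" using f by auto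
  define g where "g z = (if t < cmod (f z) then f z else 0)" for z
  define h where "h z = (if t < cmod (f z) then 0 else f z)" for z
  have g_meas [measurable]: "g \<in> borel_measurable \<mu>" and h_meas [measurable]: "h \<in> borel_measurable \<mu>"
    unfolding g_def h_def by measurable
  have g: "integrable \<mu> g"
    by (rule Bochner_Integration.integrable_bound[OF f]) (auto simp: g_def)
  have h: "integrable \<mu> h"
    by (rule integrable_bounded[where B = t]) (use t in \<open>auto simp: h_def\<close>)
  have h2: "integrable \<mu> (\<lambda>z. (cmod (h z))\<^sup>2)"
    by (rule integrable_bounded[where B = "t\<^sup>2"]) (use t in \<open>auto simp: h_def intro!: power_mono\<close>)
  have [measurable]: "P f \<in> borel_measurable \<mu>" "P g \<in> borel_measurable \<mu>" "P h \<in> borel_measurable \<mu>"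
    using f g h by (auto intro: P_measurable)
  have sub: "{z \<in> unit_disk. 2 * t < cmod (P f z)} \<subseteq>
    {z \<in> unit_disk. t < cmod (P g z)} \<union> {z \<in> unit_disk. t < cmod (P h z)}"
  proof
    fix z assume z: "z \<in> {z \<in> unit_disk. 2 * t < cmod (P f z)}"
    have "P f z = P (\<lambda>\<zeta>. g \<zeta> + h \<zeta>) z" by (rule P_cong) (auto simp: g_def h_def)
    also have "\<dots> = P g z + P h z" using z by (intro P_add g h) auto
    finally have "cmod (P f z) \<le> cmod (P g z) + cmod (P h z)" by (metis norm_triangle_ineq)
    then show "z \<in> {z \<in> unit_disk. t < cmod (P g z)} \<union> {z \<in> unit_disk. t < cmod (P h z)}"
      using z by auto
  qed
  have lev: "{z \<in> unit_disk. s < cmod (G z)} \<in> sets \<mu>" if "G \<in> borel_measurable \<mu>" for s and G :: "complex \<Rightarrow> complex"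
  proof -
    have "{z \<in> space \<mu>. s < cmod (G z)} \<in> sets \<mu>" using that by measurable
    then show ?thesis by simp
  qed
  have "emeasure \<mu> {z \<in> unit_disk. 2 * t < cmod (P f z)} \<le>
     emeasure \<mu> {z \<in> unit_disk. t < cmod (P g z)} + emeasure \<mu> {z \<in> unit_disk. t < cmod (P h z)}"
    by (rule order_trans[OF emeasure_mono[OF sub] emeasure_subadditive]) (intro sets.Un lev; simp)+
  also have "\<dots> \<le> ennreal (C / t) * (\<integral>\<^sup>+z. ennreal (cmod (g z)) \<partial>\<mu>) + ennreal (1 / t\<^sup>2) * (\<integral>\<^sup>+z. ennreal ((cmod (h z))\<^sup>2) \<partial>\<mu>)"
  proof (rule add_mono)
    have "measure \<mu> {z \<in> unit_disk. t < cmod (P g z)} \<le> (C / t) * (LINT z|\<mu>. cmod (g z))"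
      using C g t by (auto simp: weak_type_def field_simps)
    then have "emeasure \<mu> {z \<in> unit_disk. t < cmod (P g z)} \<le> ennreal ((C / t) * (LINT z|\<mu>. cmod (g z)))"
      unfolding mu.emeasure_eq_measure by (rule ennreal_leI)
    also have "\<dots> = ennreal (C / t) * (\<integral>\<^sup>+z. ennreal (cmod (g z)) \<partial>\<mu>)"
      using C t g by (subst nn_integral_eq_integral) (auto simp: weak_type_def ennreal_mult[symmetric])
    finally show "emeasure \<mu> {z \<in> unit_disk. t < cmod (P g z)} \<le> ennreal (C / t) * (\<integral>\<^sup>+z. ennreal (cmod (g z)) \<partial>\<mu>)" .
  next
    have "emeasure \<mu> {z \<in> unit_disk. t < cmod (P h z)} = (\<integral>\<^sup>+z. indicator {z \<in> unit_disk. t < cmod (P h z)} z \<partial>\<mu>)"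
      using lev[of "P h" t] by simp
    also have "\<dots> \<le> (\<integral>\<^sup>+z. ennreal (1 / t\<^sup>2) * ennreal ((cmod (P h z))\<^sup>2) \<partial>\<mu>)"
    proof (rule nn_integral_mono)
      fix z
      have "1 \<le> 1 / t\<^sup>2 * (cmod (P h z))\<^sup>2" if "t < cmod (P h z)"
        using t that power_mono[of t "cmod (P h z)" 2] by (simp add: field_simps)
      then show "indicator {z \<in> unit_disk. t < cmod (P h z)} z \<le> ennreal (1 / t\<^sup>2) * ennreal ((cmod (P h z))\<^sup>2)"
        by (auto simp: indicator_def ennreal_mult[symmetric])
    qed
    also have "\<dots> = ennreal (1 / t\<^sup>2) * (\<integral>\<^sup>+z. ennreal ((cmod (P h z))\<^sup>2) \<partial>\<mu>)"
      by (rule nn_integral_cmult) measurable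
    also have "\<dots> \<le> ennreal (1 / t\<^sup>2) * (\<integral>\<^sup>+z. ennreal ((cmod (h z))\<^sup>2) \<partial>\<mu>)"
      using P_L2[OF h h2] h2 by (intro mult_left_mono) (auto simp: nn_integral_eq_integral)
    finally show "emeasure \<mu> {z \<in> unit_disk. t < cmod (P h z)} \<le> ennreal (1 / t\<^sup>2) * (\<integral>\<^sup>+z. ennreal ((cmod (h z))\<^sup>2) \<partial>\<mu>)" .
  qed
  also have "(\<integral>\<^sup>+z. ennreal (cmod (g z)) \<partial>\<mu>) = (\<integral>\<^sup>+z. ennreal (cmod (f z)) * indicator {t<..} (cmod (f z)) \<partial>\<mu>)"
    by (rule nn_integral_cong) (auto simp: g_def indicator_def)
  also have "(\<integral>\<^sup>+z. ennreal ((cmod (h z))\<^sup>2) \<partial>\<mu>) = (\<integral>\<^sup>+z. ennreal ((cmod (f z))\<^sup>2) * indicator {..t} (cmod (f z)) \<partial>\<mu>)"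
    by (rule nn_integral_cong) (auto simp: h_def indicator_def)
  finally show ?thesis .
qed

end

lemma nn_integral_powr_Ioo:
  assumes "p > 0" "y \<ge> 0"
  shows "(\<integral>\<^sup>+t. ennreal (t powr (p - 1)) * indicator {0<..<y} t \<partial>lborel) = ennreal (y powr p / p)"
proof -
  have "(\<integral>\<^sup>+t. ennreal (t powr (p - 1)) * indicator {0<..<y} t \<partial>lborel) = (\<integral>\<^sup>+t. ennreal (t powr (p - 1)) * indicator {0..y} t \<partial>lborel)"
    using AE_lborel_singleton[of 0] AE_lborel_singleton[of y]
    by (intro nn_integral_cong_AE, eventually_elim) (auto simp: indicator_def)
  also have "\<dots> = ennreal (y powr p / p)"
    using has_integral_powr_from_0[of "p - 1" y] assms
    by (intro nn_integral_has_integral_lebesgue') auto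
  finally show ?thesis .
qed

lemma nn_integral_powr_tail:
  assumes "p < 2" "y > 0"
  shows "(\<integral>\<^sup>+t. ennreal (t powr (p - 3)) * indicator {y..} t \<partial>lborel) = ennreal (y powr (p - 2) / (2 - p))"
proof -
  have "((\<lambda>t. t powr (p - 3)) has_integral (y powr (p - 2) / (2 - p))) {y..}"
    using has_integral_powr_to_inf[of "p - 3" y] assms
    by (simp add: minus_divide_right)
  then show ?thesis by (intro nn_integral_has_integral_lebesgue') auto
qed

subsection \<open>Interpolation and the adjoint\<close>

context radial begin

lemma integrable_of_powr:
  assumes "1 \<le> p" and f: "f \<in> borel_measurable \<mu>"
    and fp: "integrable \<mu> (\<lambda>z. cmod (f z) powr p)"
  shows "integrable \<mu> f"
proof (rule Bochner_Integration.integrable_bound)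
  show "integrable \<mu> (\<lambda>z. 1 + cmod (f z) powr p)" using fp by auto
  have "cmod (f z) \<le> 1 + cmod (f z) powr p" for z
  proof (cases "cmod (f z) \<le> 1")
    case False
    then have "cmod (f z) powr 1 \<le> cmod (f z) powr p" using assms by (intro powr_mono) auto
    then show ?thesis using False by simp
  qed (auto intro: add_increasing2)
  then show "AE z in \<mu>. norm (f z) \<le> norm (1 + cmod (f z) powr p)" by (auto intro!: AE_I2)
qed (use f in auto)

lemma fst_borel_mu [measurable]: "fst \<in> borel_measurable (\<mu> \<Otimes>\<^sub>M N)"
  using measurable_compose[OF measurable_fst id_measurable_mu] by simp

lemma snd_borel_mu [measurable]: "snd \<in> borel_measurable (N \<Otimes>\<^sub>M \<mu>)"
  using measurable_compose[OF measurable_snd id_measurable_mu] by simp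

sublocale mu_lborel: pair_sigma_finite \<mu> "lborel :: real measure" ..
sublocale mu_mu: pair_sigma_finite \<mu> \<mu> ..

text \<open>The layer cake formula, with level \<open>2 * t\<close> to match
  \<open>weak_type_L2_sum\<close>; this rescaling produces \<open>2 powr p\<close>.\<close>

lemma nn_integral_powr_distribution:
  assumes [measurable]: "g \<in> borel_measurable \<mu>" and p: "0 < p"
  shows "(\<integral>\<^sup>+z. ennreal (cmod (g z) powr p) \<partial>\<mu>) = ennreal (2 powr p * p) *
    (\<integral>\<^sup>+t. ennreal (t powr (p - 1)) * indicator {0<..} t * emeasure \<mu> {z \<in> unit_disk. 2 * t < cmod (g z)} \<partial>lborel)"
proof -
  have "(\<integral>\<^sup>+z. ennreal (cmod (g z) powr p) \<partial>\<mu>)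
    = (\<integral>\<^sup>+z. ennreal (2 powr p * p) * (\<integral>\<^sup>+t. ennreal (t powr (p - 1)) * indicator {0<..<cmod (g z) / 2} t \<partial>lborel) \<partial>\<mu>)"
  proof (rule nn_integral_cong)
    fix z
    have "2 powr p * p * ((cmod (g z) / 2) powr p / p) = cmod (g z) powr p"
      using p by (simp add: powr_divide)
    then show "ennreal (cmod (g z) powr p) = ennreal (2 powr p * p) * (\<integral>\<^sup>+t. ennreal (t powr (p - 1)) * indicator {0<..<cmod (g z) / 2} t \<partial>lborel)"
      using p by (simp add: nn_integral_powr_Ioo ennreal_mult[symmetric])
  qed
  also have "\<dots> = ennreal (2 powr p * p) * (\<integral>\<^sup>+z. (\<integral>\<^sup>+t. ennreal (t powr (p - 1)) * indicator {0<..<cmod (g z) / 2} t \<partial>lborel) \<partial>\<mu>)"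
    by (rule nn_integral_cmult, unfold indicator_def of_bool_def greaterThanLessThan_iff) measurable
  also have "(\<integral>\<^sup>+z. (\<integral>\<^sup>+t. ennreal (t powr (p - 1)) * indicator {0<..<cmod (g z) / 2} t \<partial>lborel) \<partial>\<mu>)
    = (\<integral>\<^sup>+t. (\<integral>\<^sup>+z. ennreal (t powr (p - 1)) * indicator {0<..<cmod (g z) / 2} t \<partial>\<mu>) \<partial>lborel)"
    by (rule mu_lborel.Fubini'[symmetric], unfold indicator_def of_bool_def greaterThanLessThan_iff) measurable
  also have "\<dots> = (\<integral>\<^sup>+t. ennreal (t powr (p - 1)) * indicator {0<..} t * emeasure \<mu> {z \<in> unit_disk. 2 * t < cmod (g z)} \<partial>lborel)"
  proof (rule nn_integral_cong)
    fix t :: real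
    have s: "{z \<in> space \<mu>. 2 * t < cmod (g z)} \<in> sets \<mu>" by measurable
    have "(\<integral>\<^sup>+z. ennreal (t powr (p - 1)) * indicator {0<..<cmod (g z) / 2} t \<partial>\<mu>)
      = (\<integral>\<^sup>+z. (ennreal (t powr (p - 1)) * indicator {0<..} t) * indicator {z \<in> space \<mu>. 2 * t < cmod (g z)} z \<partial>\<mu>)"
      by (rule nn_integral_cong) (auto simp: indicator_def)
    also have "\<dots> = ennreal (t powr (p - 1)) * indicator {0<..} t * emeasure \<mu> {z \<in> space \<mu>. 2 * t < cmod (g z)}"
      using s by (rule nn_integral_cmult_indicator)
    finally show "(\<integral>\<^sup>+z. ennreal (t powr (p - 1)) * indicator {0<..<cmod (g z) / 2} t \<partial>\<mu>)
      = ennreal (t powr (p - 1)) * indicator {0<..} t * emeasure \<mu> {z \<in> unit_disk. 2 * t < cmod (g z)}" by simp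
  qed
  finally show ?thesis .
qed

text \<open>Integrate \<open>weak_type_L2_sum\<close> against \<open>t powr (p - 1)\<close> and
  exchange the integrals. \<open>A\<close> comes from the large part and leaves
  \<open>t powr (p - 2)\<close> below \<open>cmod (f z)\<close>, integrable at 0 because
  \<open>1 < p\<close>. \<open>B\<close> comes from the small part and leaves
  \<open>t powr (p - 3)\<close> above \<open>cmod (f z)\<close>, integrable at infinity because
  \<open>p < 2\<close>.\<close>

lemma Marcinkiewicz:
  assumes C: "weak_type C" and p: "1 < p" "p < 2" and f: "integrable \<mu> f"
  shows "(\<integral>\<^sup>+z. ennreal (cmod (P f z) powr p) \<partial>\<mu>) \<le>
    ennreal (2 powr p * p * (C / (p - 1) + 1 / (2 - p))) * (\<integral>\<^sup>+z. ennreal (cmod (f z) powr p) \<partial>\<mu>)"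
proof -
  have [measurable]: "f \<in> borel_measurable \<mu>" using f by auto
  have C0: "0 \<le> C" using C by (simp add: weak_type_def)
  define A where "A z t = ennreal (C * cmod (f z)) * (ennreal (t powr (p - 2)) * indicator {0<..<cmod (f z)} t)" for z t
  define B where "B z t = ennreal ((cmod (f z))\<^sup>2) * (ennreal (t powr (p - 3)) * (indicator {0<..} t * indicator {cmod (f z)..} t))" for z t
  have Am [measurable]: "case_prod A \<in> borel_measurable (\<mu> \<Otimes>\<^sub>M lborel)"
    and Bm [measurable]: "case_prod B \<in> borel_measurable (\<mu> \<Otimes>\<^sub>M lborel)"
    unfolding A_def B_def indicator_def of_bool_def greaterThanLessThan_iff greaterThan_iff atLeast_iff split_beta' by measurable
  have Am' [measurable]: "(\<lambda>z. A z t) \<in> borel_measurable \<mu>" and Bm' [measurable]: "(\<lambda>z. B z t) \<in> borel_measurable \<mu>" for t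
    unfolding A_def B_def indicator_def of_bool_def greaterThanLessThan_iff greaterThan_iff atLeast_iff split_beta' by measurable
  have Am'' [measurable]: "A z \<in> borel_measurable borel" and Bm'' [measurable]: "B z \<in> borel_measurable borel" for z
    unfolding A_def[abs_def] B_def[abs_def] indicator_def of_bool_def greaterThanLessThan_iff greaterThan_iff atLeast_iff by measurable
  have Aint: "(\<integral>\<^sup>+t. A z t \<partial>lborel) = ennreal (C / (p - 1)) * ennreal (cmod (f z) powr p)" for z
  proof -
    have "(\<integral>\<^sup>+t. A z t \<partial>lborel) = ennreal (C * cmod (f z)) * ennreal (cmod (f z) powr (p - 1) / (p - 1))"
      unfolding A_def using nn_integral_powr_Ioo[of "p - 1" "cmod (f z)"] p
      by (subst nn_integral_cmult) auto
    also have "\<dots> = ennreal (C / (p - 1)) * ennreal (cmod (f z) powr p)"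
      using C0 p by (cases "f z = 0") (auto simp: ennreal_mult[symmetric] powr_diff)
    finally show ?thesis .
  qed
  have Bint: "(\<integral>\<^sup>+t. B z t \<partial>lborel) \<le> ennreal (1 / (2 - p)) * ennreal (cmod (f z) powr p)" for z
  proof (cases "f z = 0")
    case False
    have "(\<integral>\<^sup>+t. B z t \<partial>lborel) = ennreal ((cmod (f z))\<^sup>2) * (\<integral>\<^sup>+t. ennreal (t powr (p - 3)) * (indicator {0<..} t * indicator {cmod (f z)..} t) \<partial>lborel)"
      unfolding B_def by (subst nn_integral_cmult) auto
    also have "(\<integral>\<^sup>+t. ennreal (t powr (p - 3)) * (indicator {0<..} t * indicator {cmod (f z)..} t) \<partial>lborel)
      = (\<integral>\<^sup>+t. ennreal (t powr (p - 3)) * indicator {cmod (f z)..} t \<partial>lborel)"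
    proof -
      have "0 < cmod (f z)" using False by simp
      then show ?thesis by (intro nn_integral_cong) (auto simp: indicator_def simp del: zero_less_norm_iff)
    qed
    also have "\<dots> = ennreal (cmod (f z) powr (p - 2) / (2 - p))"
      using False p by (intro nn_integral_powr_tail) auto
    also have "ennreal ((cmod (f z))\<^sup>2) * \<dots> = ennreal (1 / (2 - p)) * ennreal (cmod (f z) powr p)"
      using False p by (simp add: ennreal_mult[symmetric] powr_diff)
    finally show ?thesis by simp
  qed (simp add: B_def)
  have "(\<integral>\<^sup>+t. ennreal (t powr (p - 1)) * indicator {0<..} t * emeasure \<mu> {z \<in> unit_disk. 2 * t < cmod (P f z)} \<partial>lborel)
    \<le> (\<integral>\<^sup>+t. (\<integral>\<^sup>+z. A z t + B z t \<partial>\<mu>) \<partial>lborel)"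
  proof (rule nn_integral_mono)
    fix t :: real
    show "ennreal (t powr (p - 1)) * indicator {0<..} t * emeasure \<mu> {z \<in> unit_disk. 2 * t < cmod (P f z)} \<le> (\<integral>\<^sup>+z. A z t + B z t \<partial>\<mu>)"
    proof (cases "0 < t")
      case True
      have A: "ennreal (t powr (p - 1)) * (ennreal (C / t) * (\<integral>\<^sup>+z. ennreal (cmod (f z)) * indicator {t<..} (cmod (f z)) \<partial>\<mu>)) = (\<integral>\<^sup>+z. A z t \<partial>\<mu>)"
      proof -
        have "ennreal (t powr (p - 1)) * (ennreal (C / t) * (\<integral>\<^sup>+z. ennreal (cmod (f z)) * indicator {t<..} (cmod (f z)) \<partial>\<mu>))
          = (\<integral>\<^sup>+z. (ennreal (t powr (p - 1)) * ennreal (C / t)) * (ennreal (cmod (f z)) * indicator {t<..} (cmod (f z))) \<partial>\<mu>)"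
          by (subst nn_integral_cmult) (auto simp: mult.assoc)
        also have "\<dots> = (\<integral>\<^sup>+z. A z t \<partial>\<mu>)"
        proof (rule nn_integral_cong)
          fix z
          have "t powr (p - 1) * (C / t) = C * t powr (p - 2)"
            using True by (simp add: powr_diff field_simps power2_eq_square)
          then have "ennreal (t powr (p - 1)) * ennreal (C / t) * ennreal (cmod (f z)) = ennreal (C * cmod (f z)) * ennreal (t powr (p - 2))"
            using C0 True by (simp add: ennreal_mult[symmetric] mult_ac)
          then show "(ennreal (t powr (p - 1)) * ennreal (C / t)) * (ennreal (cmod (f z)) * indicator {t<..} (cmod (f z))) = A z t"
            using True by (auto simp: A_def indicator_def mult.assoc)
        qed
        finally show ?thesis .
      qed
      have B: "ennreal (t powr (p - 1)) * (ennreal (1 / t\<^sup>2) * (\<integral>\<^sup>+z. ennreal ((cmod (f z))\<^sup>2) * indicator {..t} (cmod (f z)) \<partial>\<mu>)) = (\<integral>\<^sup>+z. B z t \<partial>\<mu>)"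
      proof -
        have "ennreal (t powr (p - 1)) * (ennreal (1 / t\<^sup>2) * (\<integral>\<^sup>+z. ennreal ((cmod (f z))\<^sup>2) * indicator {..t} (cmod (f z)) \<partial>\<mu>))
          = (\<integral>\<^sup>+z. (ennreal (t powr (p - 1)) * ennreal (1 / t\<^sup>2)) * (ennreal ((cmod (f z))\<^sup>2) * indicator {..t} (cmod (f z))) \<partial>\<mu>)"
          by (subst nn_integral_cmult) (auto simp: mult.assoc)
        also have "\<dots> = (\<integral>\<^sup>+z. B z t \<partial>\<mu>)"
        proof (rule nn_integral_cong)
          fix z
          have "t powr (p - 1) * (1 / t\<^sup>2) = t powr (p - 3)"
            using True by (simp add: powr_diff power2_eq_square power3_eq_cube)
          then have "ennreal (t powr (p - 1)) * ennreal (1 / t\<^sup>2) * ennreal ((cmod (f z))\<^sup>2) = ennreal ((cmod (f z))\<^sup>2) * ennreal (t powr (p - 3))"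
            using True by (simp add: ennreal_mult[symmetric] mult_ac)
          then show "(ennreal (t powr (p - 1)) * ennreal (1 / t\<^sup>2)) * (ennreal ((cmod (f z))\<^sup>2) * indicator {..t} (cmod (f z))) = B z t"
            using True by (auto simp: B_def indicator_def mult.assoc)
        qed
        finally show ?thesis .
      qed
      have "ennreal (t powr (p - 1)) * indicator {0<..} t * emeasure \<mu> {z \<in> unit_disk. 2 * t < cmod (P f z)}
        \<le> ennreal (t powr (p - 1)) * (ennreal (C / t) * (\<integral>\<^sup>+z. ennreal (cmod (f z)) * indicator {t<..} (cmod (f z)) \<partial>\<mu>) +
          ennreal (1 / t\<^sup>2) * (\<integral>\<^sup>+z. ennreal ((cmod (f z))\<^sup>2) * indicator {..t} (cmod (f z)) \<partial>\<mu>))"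
        using weak_type_L2_sum[OF C f True] True by (auto intro: mult_left_mono)
      also have "\<dots> = (\<integral>\<^sup>+z. A z t \<partial>\<mu>) + (\<integral>\<^sup>+z. B z t \<partial>\<mu>)"
        by (simp only: distrib_left A B)
      also have "\<dots> = (\<integral>\<^sup>+z. A z t + B z t \<partial>\<mu>)"
        by (rule nn_integral_add[symmetric]) measurable
      finally show ?thesis .
    qed simp
  qed
  also have "\<dots> = (\<integral>\<^sup>+z. (\<integral>\<^sup>+t. A z t + B z t \<partial>lborel) \<partial>\<mu>)"
    by (rule mu_lborel.Fubini') measurable
  also have "\<dots> \<le> (\<integral>\<^sup>+z. ennreal (C / (p - 1) + 1 / (2 - p)) * ennreal (cmod (f z) powr p) \<partial>\<mu>)"
  proof (rule nn_integral_mono)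
    fix z
    have "(\<integral>\<^sup>+t. A z t + B z t \<partial>lborel) = (\<integral>\<^sup>+t. A z t \<partial>lborel) + (\<integral>\<^sup>+t. B z t \<partial>lborel)"
      by (rule nn_integral_add) auto
    also have "\<dots> \<le> ennreal (C / (p - 1)) * ennreal (cmod (f z) powr p) + ennreal (1 / (2 - p)) * ennreal (cmod (f z) powr p)"
      using Bint[of z] by (simp only: Aint) (rule add_left_mono)
    also have "\<dots> = ennreal (C / (p - 1) + 1 / (2 - p)) * ennreal (cmod (f z) powr p)"
      using C0 p by (simp add: distrib_right[symmetric] ennreal_plus[symmetric] del: ennreal_plus)
    finally show "(\<integral>\<^sup>+t. A z t + B z t \<partial>lborel) \<le> ennreal (C / (p - 1) + 1 / (2 - p)) * ennreal (cmod (f z) powr p)" .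
  qed
  also have "\<dots> = ennreal (C / (p - 1) + 1 / (2 - p)) * (\<integral>\<^sup>+z. ennreal (cmod (f z) powr p) \<partial>\<mu>)"
    by (rule nn_integral_cmult) measurable
  finally have main: "(\<integral>\<^sup>+t. ennreal (t powr (p - 1)) * indicator {0<..} t * emeasure \<mu> {z \<in> unit_disk. 2 * t < cmod (P f z)} \<partial>lborel)
    \<le> ennreal (C / (p - 1) + 1 / (2 - p)) * (\<integral>\<^sup>+z. ennreal (cmod (f z) powr p) \<partial>\<mu>)" .
  have "(\<integral>\<^sup>+z. ennreal (cmod (P f z) powr p) \<partial>\<mu>) = ennreal (2 powr p * p) *
    (\<integral>\<^sup>+t. ennreal (t powr (p - 1)) * indicator {0<..} t * emeasure \<mu> {z \<in> unit_disk. 2 * t < cmod (P f z)} \<partial>lborel)"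
    by (rule nn_integral_powr_distribution) (use P_measurable[OF f] p in auto)
  also have "\<dots> \<le> ennreal (2 powr p * p) * (ennreal (C / (p - 1) + 1 / (2 - p)) * (\<integral>\<^sup>+z. ennreal (cmod (f z) powr p) \<partial>\<mu>))"
    by (rule mult_left_mono[OF main]) simp
  also have "\<dots> = ennreal (2 powr p * p * (C / (p - 1) + 1 / (2 - p))) * (\<integral>\<^sup>+z. ennreal (cmod (f z) powr p) \<partial>\<mu>)"
    using C0 p by (simp add: ennreal_mult mult.assoc)
  finally show ?thesis .
qed

lemma K_cnj:
  assumes "cmod v < 1"
  shows "K (cnj v) = cnj (K v)"
proof (rule sums_unique2)
  show "(\<lambda>n. of_real (coef n) * cnj v ^ n) sums K (cnj v)"
    using K_sums[of "cnj v"] assms by simp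
  show "(\<lambda>n. of_real (coef n) * cnj v ^ n) sums cnj (K v)"
    using sums_cnj[THEN iffD2, OF K_sums[OF assms]] by simp
qed

text \<open>Fubini's theorem is applied with a uniformly bounded kernel, which is guaranteed as soon
  as one variable stays in a smaller disk; hence the support condition on \<open>h\<close>. The
  exchange then rests on \<open>K_cnj\<close>.\<close>

lemma P_adjoint:
  assumes f: "integrable \<mu> f" and h: "h \<in> borel_measurable \<mu>" "\<And>z. z \<in> unit_disk \<Longrightarrow> cmod (h z) \<le> B"
    and supp: "\<And>z. z \<in> unit_disk \<Longrightarrow> R < cmod z \<Longrightarrow> h z = 0" and R: "0 \<le> R" "R < 1"
  shows "(LINT z|\<mu>. P f z * cnj (h z)) = (LINT z|\<mu>. f z * cnj (P h z))"
proof -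
  have [measurable]: "f \<in> borel_measurable \<mu>" "h \<in> borel_measurable \<mu>" using f h by auto
  have B0: "0 \<le> B" using h(2)[of 0] norm_ge_zero[of "h 0"] by (simp del: norm_ge_zero)
  define G where "G z \<zeta> = f \<zeta> * cnj (K (cnj z * \<zeta>)) * cnj (h z)" for z \<zeta>
  have Gm [measurable]: "case_prod G \<in> borel_measurable (\<mu> \<Otimes>\<^sub>M \<mu>)"
    unfolding G_def split_beta' by measurable
  have Gb: "cmod (G z \<zeta>) \<le> (B * Kr R) * cmod (f \<zeta>)" if "z \<in> unit_disk" "\<zeta> \<in> unit_disk" for z \<zeta>
  proof (cases "R < cmod z")
    case True
    then show ?thesis using supp[of z] that B0 Kr_nonneg[OF R] by (simp add: G_def)
  next
    case False
    have "cmod (K (cnj z * \<zeta>)) \<le> Kr R"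
      using norm_K_mult_le[of z \<zeta>] Kr_mono[of "cmod z" R] that R False by auto
    then have "cmod (K (cnj z * \<zeta>)) * cmod (h z) \<le> Kr R * B"
      using h(2)[OF that(1)] Kr_nonneg[OF R] by (intro mult_mono) auto
    then show ?thesis
      using mult_left_mono[of "cmod (K (cnj z * \<zeta>)) * cmod (h z)" "Kr R * B" "cmod (f \<zeta>)"]
      by (simp add: G_def norm_mult mult_ac)
  qed
  have Gi: "integrable (\<mu> \<Otimes>\<^sub>M \<mu>) (case_prod G)"
  proof (rule mu_mu.Fubini_integrable)
    show "integrable \<mu> (\<lambda>z. LINT \<zeta>|\<mu>. norm (case_prod G (z, \<zeta>)))"
    proof (rule integrable_bounded)
      show "(\<lambda>z. LINT \<zeta>|\<mu>. norm (case_prod G (z, \<zeta>))) \<in> borel_measurable \<mu>" by measurable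
      fix z :: complex assume z: "z \<in> unit_disk"
      have "(LINT \<zeta>|\<mu>. cmod (G z \<zeta>)) \<le> (LINT \<zeta>|\<mu>. (B * Kr R) * cmod (f \<zeta>))"
      proof (rule integral_mono_AE')
        show "AE \<zeta> in \<mu>. cmod (G z \<zeta>) \<le> (B * Kr R) * cmod (f \<zeta>)" by (rule AE_I2) (use Gb[OF z] in auto)
      qed (use f B0 Kr_nonneg[OF R] in auto)
      then show "norm (LINT \<zeta>|\<mu>. norm (case_prod G (z, \<zeta>))) \<le> (B * Kr R) * (LINT \<zeta>|\<mu>. cmod (f \<zeta>))"
        by simp
    qed
    show "AE z in \<mu>. integrable \<mu> (\<lambda>\<zeta>. case_prod G (z, \<zeta>))"
    proof (rule AE_I2)
      fix z assume z: "z \<in> space \<mu>"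
      have "integrable \<mu> (\<lambda>\<zeta>. f \<zeta> * cnj (K (cnj z * \<zeta>)) * cnj (h z))"
        using integrable_mult_K[OF f, of z] z by auto
      then show "integrable \<mu> (\<lambda>\<zeta>. case_prod G (z, \<zeta>))" by (simp add: G_def)
    qed
  qed measurable
  have "(LINT z|\<mu>. P f z * cnj (h z)) = (LINT z|\<mu>. (LINT \<zeta>|\<mu>. G z \<zeta>))"
    unfolding G_def by (rule Bochner_Integration.integral_cong) (auto simp: P_eq)
  also have "\<dots> = (LINT \<zeta>|\<mu>. (LINT z|\<mu>. G z \<zeta>))"
    by (rule mu_mu.Fubini_integral[OF Gi, symmetric])
  also have "\<dots> = (LINT \<zeta>|\<mu>. f \<zeta> * cnj (P h \<zeta>))"
  proof (rule Bochner_Integration.integral_cong)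
    fix \<zeta> assume \<zeta>: "\<zeta> \<in> space \<mu>"
    have "cnj (P h \<zeta>) = (LINT z|\<mu>. cnj (h z * cnj (K (cnj \<zeta> * z))))"
      unfolding P_eq[OF h(1)] by (rule Bochner_Integration.integral_cnj[symmetric])
    then have "f \<zeta> * cnj (P h \<zeta>) = (LINT z|\<mu>. f \<zeta> * (cnj (h z) * K (cnj \<zeta> * z)))" by simp
    also have "\<dots> = (LINT z|\<mu>. G z \<zeta>)"
    proof (rule Bochner_Integration.integral_cong)
      fix z assume z: "z \<in> space \<mu>"
      have "K (cnj \<zeta> * z) = cnj (K (cnj z * \<zeta>))"
        using K_cnj[OF norm_mult_lt_1, of z \<zeta>] z \<zeta> by (simp add: mult.commute)
      then show "f \<zeta> * (cnj (h z) * K (cnj \<zeta> * z)) = G z \<zeta>" by (simp add: G_def)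
    qed simp
    finally show "(LINT z|\<mu>. G z \<zeta>) = f \<zeta> * cnj (P h \<zeta>)" by simp
  qed simp
  finally show ?thesis .
qed

end

subsection \<open>Duality and the boundedness notions\<close>

context radial begin

definition strong_type :: "real \<Rightarrow> real \<Rightarrow> bool" where
  "strong_type p C \<longleftrightarrow> 0 \<le> C \<and> (\<forall>f. f \<in> borel_measurable \<mu> \<longrightarrow> integrable \<mu> (\<lambda>z. cmod (f z) powr p) \<longrightarrow>
     (\<integral>\<^sup>+z. ennreal (cmod (P f z) powr p) \<partial>\<mu>) \<le> ennreal C * (\<integral>\<^sup>+z. ennreal (cmod (f z) powr p) \<partial>\<mu>))"

text \<open>Test against \<open>h\<close>, the conjugate power of \<open>P f\<close>: its pairing
  with \<open>P f\<close> is the integral of \<open>cmod (F z) powr p\<close>, and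
  \<open>cmod (h z) powr q\<close> has the same integral. Cutting off at radius \<open>R\<close>
  makes this integral finite, so that half of it can be absorbed; Fatou's lemma then removes the
  cut-off.\<close>

lemma strong_type_dual:
  assumes C: "strong_type q C" and q: "1 < q" "q < 2" and pq: "1 / p + 1 / q = 1"
  shows "strong_type p (2 * (2 * C + 1) powr (p / q))"
  unfolding strong_type_def
proof (intro conjI allI impI)
  have C0: "0 \<le> C" using C by (simp add: strong_type_def)
  have pe: "p = q / (q - 1)"
  proof -
    have "1 / p = (q - 1) / q" using pq q by (simp add: field_simps)
    then have "p = 1 / ((q - 1) / q)" by (metis div_by_1 divide_divide_eq_right mult_1)
    then show ?thesis by simp
  qed
  have p1: "1 < p" using pe q by simp
  have pq1: "(p - 1) * q = p" using pe q by (simp add: field_simps)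
  show "0 \<le> 2 * (2 * C + 1) powr (p / q)" by simp
  fix f assume fm [measurable]: "f \<in> borel_measurable \<mu>" and fp: "integrable \<mu> (\<lambda>z. cmod (f z) powr p)"
  have f: "integrable \<mu> f" by (rule integrable_of_powr[OF _ fm fp]) (use p1 in simp)
  define Nf where "Nf = (LINT z|\<mu>. cmod (f z) powr p)"
  have Pm [measurable]: "P f \<in> borel_measurable \<mu>" by (rule P_measurable[OF f])
  have trunc: "(LINT z|\<mu>. cmod (P f z) powr p * indicator {..R} (cmod z)) \<le> 2 * (2 * C + 1) powr (p / q) * Nf"
    and trunc_int: "integrable \<mu> (\<lambda>z. cmod (P f z) powr p * indicator {..R} (cmod z))"
    if R: "0 \<le> R" "R < 1" for R
  proof -
    define F where "F z = (if cmod z \<le> R then P f z else 0)" for z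
    define L where "L = Kr R * (LINT \<zeta>|\<mu>. cmod (f \<zeta>))"
    have FL: "cmod (F z) \<le> L" if "z \<in> unit_disk" for z
    proof (cases "cmod z \<le> R")
      case True
      have "cmod (P f z) \<le> Kr (cmod z) * (LINT \<zeta>|\<mu>. cmod (f \<zeta>))"
        using norm_P_le[OF f, of z] that by simp
      also have "\<dots> \<le> L" unfolding L_def
        using Kr_mono[of "cmod z" R] True R by (intro mult_right_mono) auto
      finally show ?thesis by (simp add: F_def True)
    qed (use Kr_nonneg[OF R] in \<open>simp add: F_def L_def\<close>)
    have Fm [measurable]: "F \<in> borel_measurable \<mu>" unfolding F_def[abs_def] by measurable
    have e: "cmod (P f z) powr p * indicator {..R} (cmod z) = cmod (F z) powr p" for z
      using p1 by (auto simp: F_def indicator_def)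
    define h where "h z = F z * of_real (cmod (F z) powr (p - 2))" for z
    have hm [measurable]: "h \<in> borel_measurable \<mu>" unfolding h_def[abs_def] by measurable
    have hn: "cmod (h z) = cmod (F z) powr (p - 1)" for z
    proof (cases "F z = 0")
      case False
      then have "cmod (h z) = cmod (F z) powr 1 * cmod (F z) powr (p - 2)" by (simp add: h_def norm_mult)
      also have "\<dots> = cmod (F z) powr (p - 1)" by (simp only: powr_add[symmetric]) simp
      finally show ?thesis .
    qed (simp add: h_def)
    have hq: "cmod (h z) powr q = cmod (F z) powr p" for z
      by (simp add: hn powr_powr pq1)
    have Fh: "P f z * cnj (h z) = of_real (cmod (F z) powr p)" for z
    proof (cases "F z = 0")
      case False
      then have "P f z = F z" by (auto simp: F_def split: if_splits)
      then have "P f z * cnj (h z) = (F z * cnj (F z)) * of_real (cmod (F z) powr (p - 2))"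
        by (simp add: h_def)
      also have "\<dots> = of_real ((cmod (F z))\<^sup>2 * cmod (F z) powr (p - 2))"
        by (simp add: complex_norm_square del: of_real_power)
      also have "(cmod (F z))\<^sup>2 * cmod (F z) powr (p - 2) = cmod (F z) powr p"
        using False by (simp add: powr_diff)
      finally show ?thesis .
    qed (simp add: h_def)
    have Fp: "integrable \<mu> (\<lambda>z. cmod (F z) powr p)"
      by (rule integrable_bounded[where B = "L powr p"]) (use FL p1 in \<open>auto intro!: powr_mono2\<close>)
    then show "integrable \<mu> (\<lambda>z. cmod (P f z) powr p * indicator {..R} (cmod z))" by (simp only: e)
    define A where "A = (LINT z|\<mu>. cmod (F z) powr p)"
    have hb: "cmod (h z) \<le> L powr (p - 1)" if "z \<in> unit_disk" for z
      using FL[OF that] p1 by (simp add: hn powr_mono2)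
    have h: "integrable \<mu> h" by (rule integrable_bounded[OF hm hb])
    have hqi: "integrable \<mu> (\<lambda>z. cmod (h z) powr q)" using Fp by (simp add: hq)
    have [measurable]: "P h \<in> borel_measurable \<mu>" by (rule P_measurable[OF h])
    have "(\<integral>\<^sup>+z. ennreal (cmod (P h z) powr q) \<partial>\<mu>) \<le> ennreal C * (\<integral>\<^sup>+z. ennreal (cmod (h z) powr q) \<partial>\<mu>)"
      using C hqi hm by (simp add: strong_type_def)
    also have "\<dots> = ennreal C * ennreal A"
      using Fp by (simp add: hq A_def nn_integral_eq_integral)
    also have "\<dots> = ennreal (C * A)"
      using C0 by (simp add: ennreal_mult A_def)
    finally have Phq: "(\<integral>\<^sup>+z. ennreal (cmod (P h z) powr q) \<partial>\<mu>) \<le> ennreal (C * A)" .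
    have A0: "0 \<le> A" unfolding A_def by simp
    have Phi: "integrable \<mu> (\<lambda>z. cmod (P h z) powr q)"
      by (rule integrableI_bounded) (use Phq in \<open>auto intro: le_less_trans\<close>)
    have PhA: "(LINT z|\<mu>. cmod (P h z) powr q) \<le> C * A"
      using Phq Phi C0 A0 by (simp add: nn_integral_eq_integral)
    \<comment> \<open>The weight in Young's inequality: the term with \<open>P h\<close> receives
      the factor \<open>1 / (2 * C + 1)\<close>, so by \<open>PhA\<close> it contributes at most
      \<open>A / 2\<close>, which is absorbed on the left.\<close>
    define s where "s = (2 * C + 1) powr (1 / q)"
    have s0: "0 < s" using C0 by (simp add: s_def)
    have sq: "s powr q = 2 * C + 1" using C0 q by (simp add: s_def powr_powr)
    have young: "cmod (f z * cnj (P h z)) \<le> s powr p * cmod (f z) powr p + cmod (P h z) powr q / (2 * C + 1)" for z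
    proof -
      have "cmod (f z * cnj (P h z)) = (s * cmod (f z)) * (cmod (P h z) / s)"
        using s0 by (simp add: norm_mult)
      also have "\<dots> \<le> (s * cmod (f z)) powr p / p + (cmod (P h z) / s) powr q / q"
        by (rule Youngs_inequality) (use p1 q pq s0 in auto)
      also have "\<dots> \<le> (s * cmod (f z)) powr p + (cmod (P h z) / s) powr q"
        using p1 q by (intro add_mono) (auto simp: divide_le_eq mult_le_cancel_left1 mult_le_cancel_right1)
      also have "\<dots> = s powr p * cmod (f z) powr p + cmod (P h z) powr q / (2 * C + 1)"
        using s0 by (simp add: powr_mult powr_divide sq)
      finally show ?thesis .
    qed
    have "complex_of_real A = (LINT z|\<mu>. P f z * cnj (h z))"
      unfolding Fh A_def by (rule integral_complex_of_real[symmetric])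
    also have "\<dots> = (LINT z|\<mu>. f z * cnj (P h z))"
      by (rule P_adjoint[OF f hm hb _ R]) (simp_all add: h_def F_def)
    finally have "A = cmod (LINT z|\<mu>. f z * cnj (P h z))" using A0 by (metis norm_of_real abs_of_nonneg)
    also have "\<dots> \<le> (LINT z|\<mu>. cmod (f z * cnj (P h z)))"
      by (rule integral_norm_bound)
    also have "\<dots> \<le> (LINT z|\<mu>. s powr p * cmod (f z) powr p + cmod (P h z) powr q / (2 * C + 1))"
    proof (rule integral_mono_AE')
      show "AE z in \<mu>. cmod (f z * cnj (P h z)) \<le> s powr p * cmod (f z) powr p + cmod (P h z) powr q / (2 * C + 1)"
        by (rule AE_I2) (rule young)
    qed (use fp Phi C0 in auto)
    also have "\<dots> = s powr p * Nf + (LINT z|\<mu>. cmod (P h z) powr q) / (2 * C + 1)"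
      using fp Phi by (simp add: Nf_def)
    also have "\<dots> \<le> s powr p * Nf + A / 2"
    proof -
      have "(LINT z|\<mu>. cmod (P h z) powr q) / (2 * C + 1) \<le> C * A / (2 * C + 1)"
        using PhA C0 by (intro divide_right_mono) auto
      also have "\<dots> \<le> A / 2" using C0 A0 by (simp add: field_simps)
      finally show ?thesis by simp
    qed
    finally have "A \<le> 2 * s powr p * Nf" by simp
    moreover have "s powr p = (2 * C + 1) powr (p / q)" by (simp add: s_def powr_powr)
    ultimately show "(LINT z|\<mu>. cmod (P f z) powr p * indicator {..R} (cmod z)) \<le> 2 * (2 * C + 1) powr (p / q) * Nf"
      by (simp add: e A_def)
  qed
  define R where "R n = 1 - 1 / real (Suc n)" for n
  have "(\<integral>\<^sup>+z. ennreal (cmod (P f z) powr p) \<partial>\<mu>) = (\<integral>\<^sup>+z. liminf (\<lambda>n. ennreal (cmod (P f z) powr p * indicator {..R n} (cmod z))) \<partial>\<mu>)"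
  proof (rule nn_integral_cong)
    fix z assume z: "z \<in> space \<mu>"
    have "R \<longlonglongrightarrow> 1 - 0" unfolding R_def by (intro tendsto_intros LIMSEQ_inverse_real_of_nat[unfolded inverse_eq_divide])
    then have "\<forall>\<^sub>F n in sequentially. cmod z < R n" by (rule order_tendstoD) (use z in simp)
    then have "\<forall>\<^sub>F n in sequentially. ennreal (cmod (P f z) powr p * indicator {..R n} (cmod z)) = ennreal (cmod (P f z) powr p)"
      by eventually_elim (auto simp: indicator_def)
    then have "(\<lambda>n. ennreal (cmod (P f z) powr p * indicator {..R n} (cmod z))) \<longlonglongrightarrow> ennreal (cmod (P f z) powr p)"
      by (rule tendsto_eventually)
    then show "ennreal (cmod (P f z) powr p) = liminf (\<lambda>n. ennreal (cmod (P f z) powr p * indicator {..R n} (cmod z)))"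
      by (intro lim_imp_Liminf[symmetric]) auto
  qed
  also have "\<dots> \<le> liminf (\<lambda>n. \<integral>\<^sup>+z. ennreal (cmod (P f z) powr p * indicator {..R n} (cmod z)) \<partial>\<mu>)"
    by (rule nn_integral_liminf) measurable
  also have "\<dots> \<le> limsup (\<lambda>n. \<integral>\<^sup>+z. ennreal (cmod (P f z) powr p * indicator {..R n} (cmod z)) \<partial>\<mu>)"
    by (rule Liminf_le_Limsup) simp
  also have "\<dots> \<le> ennreal (2 * (2 * C + 1) powr (p / q) * Nf)"
  proof (rule Limsup_bounded, rule always_eventually, rule allI)
    fix n
    have R: "0 \<le> R n" "R n < 1" by (auto simp: R_def)
    show "(\<integral>\<^sup>+z. ennreal (cmod (P f z) powr p * indicator {..R n} (cmod z)) \<partial>\<mu>) \<le> ennreal (2 * (2 * C + 1) powr (p / q) * Nf)"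
      using trunc_int[OF R] trunc[OF R] by (subst nn_integral_eq_integral) (auto intro: ennreal_leI)
  qed
  also have "\<dots> = ennreal (2 * (2 * C + 1) powr (p / q)) * (\<integral>\<^sup>+z. ennreal (cmod (f z) powr p) \<partial>\<mu>)"
    using fp by (subst nn_integral_eq_integral) (auto simp: Nf_def ennreal_mult[symmetric])
  finally show "(\<integral>\<^sup>+z. ennreal (cmod (P f z) powr p) \<partial>\<mu>) \<le> ennreal (2 * (2 * C + 1) powr (p / q)) * (\<integral>\<^sup>+z. ennreal (cmod (f z) powr p) \<partial>\<mu>)" .
qed

lemma strong_type_2: "strong_type 2 1"
  unfolding strong_type_def
proof (intro conjI allI impI)
  fix f assume f: "f \<in> borel_measurable \<mu>" "integrable \<mu> (\<lambda>z. cmod (f z) powr 2)"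
  then have "integrable \<mu> f" by (intro integrable_of_powr[of 2]) auto
  then show "(\<integral>\<^sup>+z. ennreal (cmod (P f z) powr 2) \<partial>\<mu>) \<le> ennreal 1 * (\<integral>\<^sup>+z. ennreal (cmod (f z) powr 2) \<partial>\<mu>)"
    using P_L2[of f] f by (simp add: nn_integral_eq_integral)
qed simp

lemma strong_type_of_weak_type:
  assumes C: "weak_type C" and p: "1 < p"
  shows "\<exists>C. strong_type p C"
proof -
  have lt2: "\<exists>C. strong_type q C" if q: "1 < q" "q < 2" for q
  proof
    show "strong_type q (2 powr q * q * (C / (q - 1) + 1 / (2 - q)))"
      unfolding strong_type_def
    proof (intro conjI allI impI)
      show "0 \<le> 2 powr q * q * (C / (q - 1) + 1 / (2 - q))" using C q by (auto simp: weak_type_def)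
      fix f assume "f \<in> borel_measurable \<mu>" "integrable \<mu> (\<lambda>z. cmod (f z) powr q)"
      then show "(\<integral>\<^sup>+z. ennreal (cmod (P f z) powr q) \<partial>\<mu>) \<le>
        ennreal (2 powr q * q * (C / (q - 1) + 1 / (2 - q))) * (\<integral>\<^sup>+z. ennreal (cmod (f z) powr q) \<partial>\<mu>)"
        using q by (intro Marcinkiewicz[OF C] integrable_of_powr[of q]) auto
    qed
  qed
  consider "p < 2" | "p = 2" | "2 < p" by linarith
  then show ?thesis
  proof cases
    case 1 then show ?thesis using lt2 p by blast
  next
    case 2 then show ?thesis using strong_type_2 by blast
  next
    case 3
    define q where "q = p / (p - 1)"
    have "1 < q" "q < 2" "1 / p + 1 / q = 1" using 3 by (auto simp: q_def field_simps)
    then show ?thesis using lt2[of q] strong_type_dual by blast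
  qed
qed

section \<open>The function spaces and boundedness notions in terms of \<open>\<mu>\<close>\<close>

lemma mem_Lp_space_iff:
  "f \<in> Lp_space \<omega> p \<longleftrightarrow> f \<in> borel_measurable \<mu> \<and> integrable \<mu> (\<lambda>z. cmod (f z) powr p)"
proof (cases "f \<in> borel_measurable \<mu>")
  case True
  then have fm [measurable]: "f \<in> borel_measurable \<mu>" "f \<in> borel_measurable dA"
    by (auto simp: measurable_cong_sets[OF sets_mu refl])
  have "(\<integral>\<^sup>+z. ennreal (cmod (f z) powr p * \<omega> (cmod z)) \<partial>dA) = (\<integral>\<^sup>+z. ennreal (cmod (f z) powr p) \<partial>\<mu>)"
    by (subst nn_integral_mu, measurable, rule nn_integral_cong)
       (auto simp: ennreal_mult'' weight_nonneg mult.commute)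
  then show ?thesis using True fm
    by (auto simp: Lp_space_def integrable_iff_bounded)
next
  case False
  then show ?thesis by (auto simp: Lp_space_def measurable_cong_sets[OF sets_mu refl])
qed

lemma Lp_norm_eq:
  assumes "f \<in> borel_measurable \<mu>"
  shows "Lp_norm \<omega> p f = (LINT z|\<mu>. cmod (f z) powr p) powr (1 / p)"
proof -
  have "(\<lambda>z. cmod (f z) powr p) \<in> borel_measurable \<mu>" using assms by measurable
  then show ?thesis unfolding Lp_norm_def by (subst integral_mu) (auto simp: mult.commute)
qed

lemma bounded_Lp_iff:
  assumes p: "1 \<le> p"
  shows "bounded_Lp \<omega> p \<longleftrightarrow> (\<exists>C. strong_type p C)"
proof
  assume "bounded_Lp \<omega> p"
  then obtain C where C: "\<And>f. f \<in> Lp_space \<omega> p \<Longrightarrow> P f \<in> Lp_space \<omega> p \<and> Lp_norm \<omega> p (P f) \<le> C * Lp_norm \<omega> p f"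
    unfolding bounded_Lp_def bounded_between_def by blast
  \<comment> \<open>\<open>bounded_between\<close> admits negative constants.\<close>
  have "strong_type p (max 0 C powr p)"
    unfolding strong_type_def
  proof (intro conjI allI impI)
    fix f assume f: "f \<in> borel_measurable \<mu>" "integrable \<mu> (\<lambda>z. cmod (f z) powr p)"
    define If where "If = (LINT z|\<mu>. cmod (f z) powr p)"
    define IP where "IP = (LINT z|\<mu>. cmod (P f z) powr p)"
    have nn: "0 \<le> If" "0 \<le> IP" by (auto simp: If_def IP_def)
    have *: "P f \<in> borel_measurable \<mu>" "integrable \<mu> (\<lambda>z. cmod (P f z) powr p)"
      "IP powr (1 / p) \<le> C * If powr (1 / p)"
      using C[of f] f by (auto simp: mem_Lp_space_iff Lp_norm_eq If_def IP_def)
    have "IP powr (1 / p) \<le> max 0 C * If powr (1 / p)"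
      by (rule order_trans[OF *(3)]) (auto intro: mult_right_mono)
    then have "(IP powr (1 / p)) powr p \<le> (max 0 C * If powr (1 / p)) powr p"
      using p by (intro powr_mono2) auto
    then have "IP \<le> max 0 C powr p * If"
      using p nn by (simp add: powr_powr powr_mult)
    then show "(\<integral>\<^sup>+z. ennreal (cmod (P f z) powr p) \<partial>\<mu>) \<le> ennreal (max 0 C powr p) * (\<integral>\<^sup>+z. ennreal (cmod (f z) powr p) \<partial>\<mu>)"
      using f * nn by (simp add: nn_integral_eq_integral If_def IP_def ennreal_mult[symmetric] ennreal_leI)
  qed simp
  then show "\<exists>C. strong_type p C" by blast
next
  assume "\<exists>C. strong_type p C"
  then obtain C where C: "strong_type p C" ..
  show "bounded_Lp \<omega> p"
    unfolding bounded_Lp_def bounded_between_def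
  proof (intro exI ballI)
    fix f assume "f \<in> Lp_space \<omega> p"
    then have f: "f \<in> borel_measurable \<mu>" "integrable \<mu> (\<lambda>z. cmod (f z) powr p)"
      by (auto simp: mem_Lp_space_iff)
    have fi: "integrable \<mu> f" by (rule integrable_of_powr[OF p f])
    have Pm [measurable]: "P f \<in> borel_measurable \<mu>" by (rule P_measurable[OF fi])
    have C0: "0 \<le> C" using C by (simp add: strong_type_def)
    have le: "(\<integral>\<^sup>+z. ennreal (cmod (P f z) powr p) \<partial>\<mu>) \<le> ennreal (C * (LINT z|\<mu>. cmod (f z) powr p))"
      using C f C0 by (auto simp: strong_type_def nn_integral_eq_integral ennreal_mult)
    have Pi: "integrable \<mu> (\<lambda>z. cmod (P f z) powr p)"
      by (rule integrableI_bounded) (use le in \<open>auto intro: le_less_trans\<close>)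
    have "(LINT z|\<mu>. cmod (P f z) powr p) \<le> C * (LINT z|\<mu>. cmod (f z) powr p)"
      using le Pi C0 by (simp add: nn_integral_eq_integral)
    then have "(LINT z|\<mu>. cmod (P f z) powr p) powr (1 / p) \<le> (C * (LINT z|\<mu>. cmod (f z) powr p)) powr (1 / p)"
      using p by (intro powr_mono2) auto
    then show "P f \<in> Lp_space \<omega> p \<and> Lp_norm \<omega> p (P f) \<le> C powr (1 / p) * Lp_norm \<omega> p f"
      using f Pi C0 by (simp add: mem_Lp_space_iff Lp_norm_eq powr_mult)
  qed
qed

lemma weighted_area_eq:
  assumes "E \<in> sets \<mu>"
  shows "weighted_area \<omega> E = emeasure \<mu> E"
proof -
  have E: "E \<in> sets dA" using assms by (simp add: sets_mu)
  show ?thesis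
    unfolding weighted_area_def \<mu>_def by (subst emeasure_density[OF _ E]) auto
qed

lemma bounded_weak_11_iff: "bounded_weak_11 \<omega> \<longleftrightarrow> (\<exists>C. weak_type C)"
proof -
  have lev: "{z \<in> unit_disk. t < cmod (g z)} \<in> sets \<mu>" if "g \<in> borel_measurable \<mu>" for g :: "complex \<Rightarrow> complex" and t
  proof -
    have "{z \<in> space \<mu>. t < cmod (g z)} \<in> sets \<mu>" using that by measurable
    then show ?thesis by simp
  qed
  have sup: "weak_L1_sup \<omega> g = (SUP t\<in>{0<..}. ennreal (t * measure \<mu> {z \<in> unit_disk. t < cmod (g z)}))"
    if "g \<in> borel_measurable \<mu>" for g
    unfolding weak_L1_sup_def using lev[OF that]
    by (intro SUP_cong) (auto simp: weighted_area_eq mu.emeasure_eq_measure ennreal_mult)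
  have L1: "f \<in> Lp_space \<omega> 1 \<longleftrightarrow> integrable \<mu> f" for f :: "complex \<Rightarrow> complex"
    by (auto simp: mem_Lp_space_iff integrable_norm_iff)
  have N1: "Lp_norm \<omega> 1 f = (LINT z|\<mu>. cmod (f z))" if "integrable \<mu> f" for f :: "complex \<Rightarrow> complex"
    using that by (subst Lp_norm_eq) auto
  show ?thesis
  proof
    assume "bounded_weak_11 \<omega>"
    then obtain C where C: "\<And>f. f \<in> Lp_space \<omega> 1 \<Longrightarrow> P f \<in> weak_L1_space \<omega> \<and> weak_L1_norm \<omega> (P f) \<le> C * Lp_norm \<omega> 1 f"
      unfolding bounded_weak_11_def bounded_between_def by blast
    have "weak_type (max 0 C)"
      unfolding weak_type_def
    proof (intro conjI allI impI)
      fix f :: "complex \<Rightarrow> complex" and t :: real assume f: "integrable \<mu> f" and t: "0 < t"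
      have Pm: "P f \<in> borel_measurable \<mu>" by (rule P_measurable[OF f])
      \<comment> \<open>Finiteness is recorded separately because \<open>enn2real\<close> sends
        infinity to 0.\<close>
      have *: "weak_L1_sup \<omega> (P f) < \<infinity>" "enn2real (weak_L1_sup \<omega> (P f)) \<le> C * (LINT z|\<mu>. cmod (f z))"
        using C[of f] f by (auto simp: L1 N1 weak_L1_space_def weak_L1_norm_def)
      have "ennreal (t * measure \<mu> {z \<in> unit_disk. t < cmod (P f z)}) \<le> weak_L1_sup \<omega> (P f)"
        unfolding sup[OF Pm] by (rule SUP_upper) (use t in simp)
      then have "t * measure \<mu> {z \<in> unit_disk. t < cmod (P f z)} \<le> enn2real (weak_L1_sup \<omega> (P f))"
        using *(1) t by (metis enn2real_ennreal enn2real_mono infinity_ennreal_def less_imp_le measure_nonneg zero_le_mult_iff)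
      also note *(2)
      also have "C * (LINT z|\<mu>. cmod (f z)) \<le> max 0 C * (LINT z|\<mu>. cmod (f z))"
        by (intro mult_right_mono) auto
      finally show "t * measure \<mu> {z \<in> unit_disk. t < cmod (P f z)} \<le> max 0 C * (LINT z|\<mu>. cmod (f z))" .
    qed simp
    then show "\<exists>C. weak_type C" ..
  next
    assume "\<exists>C. weak_type C"
    then obtain C where C: "weak_type C" ..
    show "bounded_weak_11 \<omega>"
      unfolding bounded_weak_11_def bounded_between_def
    proof (intro exI ballI)
      fix f assume "f \<in> Lp_space \<omega> 1"
      then have f: "integrable \<mu> f" by (simp add: L1)
      have Pm: "P f \<in> borel_measurable \<mu>" by (rule P_measurable[OF f])
      have le: "weak_L1_sup \<omega> (P f) \<le> ennreal (C * (LINT z|\<mu>. cmod (f z)))"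
        unfolding sup[OF Pm] by (rule SUP_least, rule ennreal_leI) (use C f in \<open>auto simp: weak_type_def\<close>)
      have "enn2real (weak_L1_sup \<omega> (P f)) \<le> enn2real (ennreal (C * (LINT z|\<mu>. cmod (f z))))"
        by (rule enn2real_mono[OF le]) simp
      also have "\<dots> = C * (LINT z|\<mu>. cmod (f z))" using C by (intro enn2real_ennreal) (auto simp: weak_type_def)
      finally show "P f \<in> weak_L1_space \<omega> \<and> weak_L1_norm \<omega> (P f) \<le> C * Lp_norm \<omega> 1 f"
        using le Pm by (auto simp: weak_L1_space_def weak_L1_norm_def N1[OF f] measurable_cong_sets[OF sets_mu refl] intro: le_less_trans)
    qed
  qed
qed

end

subsection \<open>Necessity of the doubling condition\<close>

text \<open>Both slopes are compared with the slope of the chord over \<open>[x, v]\<close>. The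
  signs are reversed because the application is to a decreasing function.\<close>

lemma convex_slope_mono:
  fixes \<psi> :: "real \<Rightarrow> real"
  assumes \<psi>: "convex_on {0..} \<psi>" and o: "0 \<le> x" "x < y" "x \<le> u" "u < v" "y \<le> v"
  shows "(\<psi> u - \<psi> v) / (v - u) \<le> (\<psi> x - \<psi> y) / (y - x)"
proof -
  have conv: "\<psi> b \<le> ((c - b) * \<psi> a + (b - a) * \<psi> c) / (c - a)" if "0 \<le> a" "a \<le> b" "b \<le> c" "a < c" for a b c
  proof -
    define t where "t = (b - a) / (c - a)"
    have t: "0 \<le> t" "t \<le> 1" using that by (auto simp: t_def)
    have bt: "(1 - t) * a + t * c = b"
    proof -
      have "t * (c - a) = b - a" using that by (simp add: t_def)
      then show ?thesis by (simp add: algebra_simps)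
    qed
    have "\<psi> ((1 - t) * a + t * c) \<le> (1 - t) * \<psi> a + t * \<psi> c"
      using convex_onD[OF \<psi> t, of a c] that by simp
    also have "\<dots> = ((c - b) * \<psi> a + (b - a) * \<psi> c) / (c - a)"
    proof -
      have "1 - t = (c - b) / (c - a)" using that by (simp add: t_def field_simps)
      then show ?thesis by (simp add: t_def add_divide_distrib)
    qed
    finally show ?thesis by (simp add: bt)
  qed
  have "\<psi> y * (v - x) \<le> (v - y) * \<psi> x + (y - x) * \<psi> v"
    using conv[of x y v] o by (simp add: pos_le_divide_eq)
  then have 1: "(\<psi> x - \<psi> v) / (v - x) \<le> (\<psi> x - \<psi> y) / (y - x)"
    using o by (simp add: divide_le_eq le_divide_eq) (simp add: field_simps)
  have "\<psi> u * (v - x) \<le> (v - u) * \<psi> x + (u - x) * \<psi> v"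
    using conv[of x u v] o by (simp add: pos_le_divide_eq)
  then have 2: "(\<psi> u - \<psi> v) / (v - u) \<le> (\<psi> x - \<psi> v) / (v - x)"
    using o by (simp add: divide_le_eq le_divide_eq) (simp add: field_simps)
  show ?thesis using 1 2 by simp
qed

text \<open>The point \<open>2 * n\<close> is the mean of \<open>n * q\<close> and
  \<open>n * p\<close> with weights \<open>1 / q\<close> and \<open>1 / p\<close>, so
  \<open>hyp\<close> says that Jensen's inequality is sharp up to \<open>c\<close>. It bounds the
  drop of \<open>\<psi>\<close> from \<open>n * q\<close> to \<open>2 * n\<close> by the drop from
  \<open>2 * n\<close> to \<open>n * p\<close>, and convexity bounds that one by the drop from
  \<open>m * q\<close> to \<open>2 * m\<close> for a larger \<open>m\<close>. Because
  \<open>(p - 2) / p = (2 - q) / q\<close>, the constants cancel and leave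
  \<open>\<delta> n \<le> (n / m) * \<delta> m + q * c\<close>.\<close>

lemma bounded_gap_of_convex:
  fixes \<psi> :: "real \<Rightarrow> real" and p q c :: real
  assumes \<psi>: "convex_on {0..} \<psi>" and q: "1 < q" "q < 2" and pq: "1 / p + 1 / q = 1"
    and hyp: "\<And>n. 1 \<le> n \<Longrightarrow> \<psi> (real n * q + 1) / q + \<psi> (real n * p + 1) / p \<le> \<psi> (2 * real n + 1) + c"
    and small: "\<And>\<epsilon>. 0 < \<epsilon> \<Longrightarrow> \<exists>L. \<forall>m\<ge>L. \<psi> (real m * q + 1) - \<psi> (2 * real m + 1) \<le> \<epsilon> * real m"
    and c: "0 \<le> c"
  obtains B N where "\<And>n. N \<le> n \<Longrightarrow> \<psi> (real n * q + 1) - \<psi> (2 * real n + 1) \<le> B"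
proof -
  have pe: "p = q / (q - 1)"
  proof -
    have "1 / p = (q - 1) / q" using pq q by (simp add: field_simps)
    then have "p = 1 / ((q - 1) / q)" by (metis div_by_1 divide_divide_eq_right mult_1)
    then show ?thesis by simp
  qed
  have p2: "2 < p" unfolding pe using q by (simp add: less_divide_eq)
  have pq2: "(p - 2) / p = (2 - q) / q"
  proof -
    have "1 - 2 * (1 / p) = 2 * (1 / q) - 1" using pq by simp
    then show ?thesis using p2 q by (simp add: diff_divide_distrib)
  qed
  define \<delta> where "\<delta> n = \<psi> (real n * q + 1) - \<psi> (2 * real n + 1)" for n
  \<comment> \<open>The largest ratio \<open>m / n\<close> with \<open>m * q \<le> 2 * n\<close> and
    \<open>2 * m \<le> n * p\<close>, the two conditions of the slope comparison.\<close>
  define k where "k = min (2 / q) (p / 2)"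
  have k: "1 < k" "k \<le> 2 / q" "k \<le> p / 2" using q p2 by (auto simp: k_def)
  \<comment> \<open>Halfway between 1 and \<open>k\<close>: rounding in \<open>m\<close> costs at
    most 1, hence at most \<open>(k - 1) * n / 2\<close> once \<open>N \<le> n\<close>.\<close>
  define \<kappa> where "\<kappa> = (1 + k) / 2"
  have \<kappa>: "1 < \<kappa>" using k by (simp add: \<kappa>_def)
  define N where "N = nat \<lceil>2 / (k - 1)\<rceil> + 1"
  have step: "\<exists>m. \<kappa> * real n \<le> real m \<and> \<delta> n \<le> (real n / real m) * \<delta> m + q * c" if n: "N \<le> n" for n
  proof -
    define m where "m = nat \<lfloor>k * real n\<rfloor>"
    have n1: "1 \<le> n" using n by (simp add: N_def)
    have "2 / (k - 1) \<le> real n" using n by (simp add: N_def) linarith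
    then have n2: "2 \<le> (k - 1) * real n" using k by (simp add: field_simps)
    have m1: "real m \<le> k * real n" using k unfolding m_def by (simp add: of_nat_floor)
    have m2: "k * real n - 1 \<le> real m" unfolding m_def by linarith
    have \<kappa>n: "\<kappa> * real n \<le> real m"
    proof -
      have "\<kappa> * real n = k * real n - (k - 1) * real n / 2" by (simp add: \<kappa>_def field_simps)
      then show ?thesis using n2 m2 by simp
    qed
    have m0: "0 < real m" using \<kappa>n \<kappa> n1 by (smt (verit) mult_pos_pos of_nat_1 of_nat_mono)
    have a1: "real m * q \<le> 2 * real n"
    proof -
      have "real m * q \<le> (2 / q * real n) * q"
        using m1 k(2) q mult_right_mono[of k "2 / q" "real n"] by (intro mult_right_mono) auto
      then show ?thesis using q by simp
    qed
    have a2: "2 * real m \<le> real n * p"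
      using m1 k(3) mult_right_mono[of k "p / 2" "real n"] by (simp add: mult.commute)
    have "(\<psi> (2 * real n + 1) - \<psi> (real n * p + 1)) / (real n * p + 1 - (2 * real n + 1))
       \<le> (\<psi> (real m * q + 1) - \<psi> (2 * real m + 1)) / (2 * real m + 1 - (real m * q + 1))"
      by (rule convex_slope_mono[OF \<psi>]) (use a1 a2 m0 n1 q p2 in \<open>auto simp: mult.commute\<close>)
    also have "2 * real m + 1 - (real m * q + 1) = (2 - q) * real m" by (simp add: algebra_simps)
    also have "real n * p + 1 - (2 * real n + 1) = (p - 2) * real n" by (simp add: algebra_simps)
    finally have sl: "\<psi> (2 * real n + 1) - \<psi> (real n * p + 1) \<le> (p - 2) * real n * (\<delta> m / ((2 - q) * real m))"
      using n1 p2 by (simp add: divide_le_eq \<delta>_def mult_ac)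
    have "\<delta> n / q \<le> (\<psi> (2 * real n + 1) - \<psi> (real n * p + 1)) / p + c"
    proof -
      have "\<psi> (2 * real n + 1) = \<psi> (2 * real n + 1) * (1 / p + 1 / q)" using pq by simp
      then have "\<psi> (2 * real n + 1) = \<psi> (2 * real n + 1) / p + \<psi> (2 * real n + 1) / q" by (simp add: distrib_left)
      then show ?thesis using hyp[OF n1] by (simp add: \<delta>_def diff_divide_distrib)
    qed
    also have "\<dots> \<le> ((p - 2) * real n * (\<delta> m / ((2 - q) * real m))) / p + c"
      using sl p2 by (intro add_right_mono divide_right_mono) auto
    also have "((p - 2) * real n * (\<delta> m / ((2 - q) * real m))) / p = ((p - 2) / p) * (real n * (\<delta> m / ((2 - q) * real m)))"
      by (simp add: mult_ac)
    also have "\<dots> = (real n / real m) * \<delta> m / q"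
      unfolding pq2 using q by simp
    finally have le: "\<delta> n / q \<le> (real n / real m) * \<delta> m / q + c" .
    have "\<delta> n \<le> T + q * c" if "\<delta> n / q \<le> T / q + c" for T
      using that q by (simp add: field_simps)
    from this[OF le] have "\<delta> n \<le> (real n / real m) * \<delta> m + q * c" .
    then show ?thesis using \<kappa>n by blast
  qed
  \<comment> \<open>The fixed point of the map sending \<open>B\<close> to
    \<open>B / \<kappa> + q * c\<close>, so that \<open>step\<close> reproduces the bound.\<close>
  define B where "B = q * c * \<kappa> / (\<kappa> - 1)"
  have B: "B / \<kappa> + q * c = B" "0 \<le> B"
    using \<kappa> q c by (auto simp: B_def field_simps)
  have "\<delta> n \<le> B" if n: "N \<le> n" for n
  proof (rule field_le_epsilon)
    fix e :: real assume e: "0 < e"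
    have n0: "0 < real n" using n by (simp add: N_def)
    define \<epsilon> where "\<epsilon> = e / real n"
    have "0 < \<epsilon>" using e n0 by (simp add: \<epsilon>_def)
    from small[OF this] obtain L where L: "\<And>m. L \<le> m \<Longrightarrow> \<delta> m \<le> \<epsilon> * real m" unfolding \<delta>_def by blast
    \<comment> \<open>Induction downwards from \<open>L\<close>, beyond which the bound holds by
      \<open>small\<close>. A step from \<open>m'\<close> back to \<open>m\<close> keeps the slope
      \<open>\<epsilon>\<close> and does not enlarge \<open>B\<close>. The choice of
      \<open>\<epsilon>\<close> turns the linear term at \<open>n\<close> into
      \<open>e\<close>.\<close>
    have "\<delta> m \<le> \<epsilon> * real m + B" if "N \<le> m" for m
      using that
    proof (induction "L - m" arbitrary: m rule: less_induct)
      case less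
      show ?case
      proof (cases "L \<le> m")
        case True then show ?thesis using L[of m] B by simp
      next
        case False
        obtain m' where m': "\<kappa> * real m \<le> real m'" "\<delta> m \<le> (real m / real m') * \<delta> m' + q * c"
          using step[OF less.prems] by blast
        have m0: "0 < real m" using less.prems by (simp add: N_def)
        have lt: "m < m'"
        proof -
          have "real m < \<kappa> * real m" using \<kappa> m0 by simp
          then show ?thesis using m'(1) by linarith
        qed
        have "\<delta> m' \<le> \<epsilon> * real m' + B"
          by (rule less.hyps) (use False lt less.prems in auto)
        then have "(real m / real m') * \<delta> m' \<le> (real m / real m') * (\<epsilon> * real m' + B)"
          by (intro mult_left_mono) auto
        also have "\<dots> = \<epsilon> * real m + (real m / real m') * B"
          using lt by (simp add: field_simps)
        also have "(real m / real m') * B \<le> (1 / \<kappa>) * B"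
          using m'(1) lt \<kappa> B(2) by (intro mult_right_mono) (auto simp: field_simps)
        finally show ?thesis using m'(2) B(1) by simp
      qed
    qed
    from this[OF n] show "\<delta> n \<le> B + e" using n0 by (simp add: \<epsilon>_def)
  qed
  then show ?thesis using that unfolding \<delta>_def by blast
qed

text \<open>The left-hand power increases with \<open>k\<close>, since \<open>(1 - h) ^ 2\<close> is
  at least \<open>1 - 2 * h\<close>, and equals \<open>1 / 4\<close> at
  \<open>k = 1\<close>.\<close>

lemma one_minus_half_power_ge: "1 \<le> k \<Longrightarrow> 1 / 4 \<le> (1 - 1 / 2 ^ k :: real) ^ (2 ^ k)"
proof (induction k rule: dec_induct)
  case base show ?case by (simp add: power2_eq_square)
next
  case (step k)
  have "0 \<le> (1::real) - 1 / 2 ^ k" by (simp add: field_simps)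
  moreover have "1 - 1 / 2 ^ k \<le> (1 - 1 / 2 ^ Suc k :: real)\<^sup>2"
    by (simp add: power2_eq_square algebra_simps)
  ultimately have "(1 - 1 / 2 ^ k :: real) ^ (2 ^ k) \<le> ((1 - 1 / 2 ^ Suc k)\<^sup>2) ^ (2 ^ k)"
    by (intro power_mono)
  then show ?case using step.IH by (simp add: power_mult[symmetric])
qed

section \<open>Dyadic tails, test functions, and doubling of the moments\<close>

context radial begin

definition W :: "nat \<Rightarrow> real" where
  "W k = omega_hat \<omega> (1 - 1 / 2 ^ k)"

lemma dyadic_radius: "0 \<le> (1 - 1 / 2 ^ k :: real)" "(1 - 1 / 2 ^ k :: real) < 1"
  by (auto simp: field_simps)

lemma W_pos: "0 < W k"
  unfolding W_def by (intro omega_hat_pos dyadic_radius)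

lemma W_antimono: "k \<le> l \<Longrightarrow> W l \<le> W k"
  unfolding W_def by (intro omega_hat_antimono dyadic_radius) (auto simp: field_simps)

lemma D_hat_dyadicD:
  assumes "\<omega> \<in> D_hat"
  obtains D where "1 \<le> D" "\<And>k. W k \<le> D * W (Suc k)"
proof -
  from assms obtain C where C: "1 \<le> C" "\<And>r. r \<in> {0..<1} \<Longrightarrow> omega_hat \<omega> r \<le> C * omega_hat \<omega> ((1 + r) / 2)"
    by (auto simp: D_hat_def)
  have "W k \<le> C * W (Suc k)" for k
  proof -
    have "(1 + (1 - 1 / 2 ^ k)) / 2 = (1 - 1 / 2 ^ Suc k :: real)" by (simp add: field_simps)
    moreover have "(1 - 1 / 2 ^ k :: real) \<in> {0..<1}" using dyadic_radius[of k] by simp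
    ultimately show ?thesis using C(2)[of "1 - 1 / 2 ^ k"] unfolding W_def by metis
  qed
  then show ?thesis using that C(1) by blast
qed

text \<open>The finitely many levels below \<open>k0\<close> only change the constant, because all
  tails are positive. If \<open>r\<close> lies between two consecutive dyadic radii, then
  \<open>(1 + r) / 2\<close> lies between the next two; two dyadic steps therefore suffice, whence
  \<open>D ^ 2\<close>.\<close>

lemma D_hat_dyadicI:
  assumes C: "\<And>k. k0 \<le> k \<Longrightarrow> W k \<le> C * W (Suc k)"
  shows "\<omega> \<in> D_hat"
proof -
  define D where "D = max (max 1 C) (W 0 / W k0)"
  have D1: "1 \<le> D" by (simp add: D_def)
  have D: "W k \<le> D * W (Suc k)" for k
  proof (cases "k0 \<le> k")
    case True
    have "C * W (Suc k) \<le> D * W (Suc k)"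
      using W_pos[of "Suc k"] by (intro mult_right_mono) (auto simp: D_def)
    then show ?thesis using C[OF True] by simp
  next
    case False
    have "W k \<le> W 0" by (rule W_antimono) simp
    also have "\<dots> = W 0 / W k0 * W k0" using W_pos[of k0] by simp
    also have "\<dots> \<le> D * W (Suc k)"
      using False W_pos[of k0] W_pos[of 0] D1
      by (intro mult_mono W_antimono) (auto simp: D_def less_imp_le)
    finally show ?thesis .
  qed
  have "omega_hat \<omega> r \<le> D ^ 2 * omega_hat \<omega> ((1 + r) / 2)" if r: "r \<in> {0..<1}" for r
  proof -
    have ex: "\<exists>k. r < 1 - 1 / 2 ^ Suc k"
    proof -
      obtain n where "(1 / 2) ^ n < 1 - r" using real_arch_pow_inv[of "1 - r" "1 / 2"] r by auto
      moreover have "(1 / 2 :: real) ^ Suc n \<le> (1 / 2) ^ n" by (rule power_decreasing) auto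
      ultimately have "(1 / 2) ^ Suc n < 1 - r" by (rule le_less_trans[rotated])
      then have "r < 1 - (1 / 2) ^ Suc n" by linarith
      then show ?thesis by (auto simp: power_one_over)
    qed
    define k where "k = (LEAST k. r < 1 - 1 / 2 ^ Suc k)"
    have k1: "r < 1 - 1 / 2 ^ Suc k" unfolding k_def by (rule LeastI_ex[OF ex])
    have k2: "1 - 1 / 2 ^ k \<le> r"
    proof (cases k)
      case 0 then show ?thesis using r by simp
    next
      case (Suc j)
      have "\<not> r < 1 - 1 / 2 ^ Suc j"
        by (rule not_less_Least) (use Suc in \<open>simp add: k_def\<close>)
      then show ?thesis using Suc by simp
    qed
    have "omega_hat \<omega> r \<le> W k" unfolding W_def by (intro omega_hat_antimono dyadic_radius k2)
    also have "\<dots> \<le> D * W (Suc k)" by (rule D)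
    also have "\<dots> \<le> D * (D * W (Suc (Suc k)))" using D[of "Suc k"] D1 by (intro mult_left_mono) auto
    also have "W (Suc (Suc k)) \<le> omega_hat \<omega> ((1 + r) / 2)"
      unfolding W_def
    proof (rule omega_hat_antimono)
      have "(1 + r) / 2 \<le> (1 + (1 - 1 / 2 ^ Suc k)) / 2" using k1 by simp
      also have "\<dots> = 1 - 1 / 2 ^ Suc (Suc k)" by (simp add: field_simps)
      finally show "(1 + r) / 2 \<le> 1 - 1 / 2 ^ Suc (Suc k)" .
    qed (use r in auto)
    finally show ?thesis using D1 by (simp add: power2_eq_square mult.assoc mult_left_mono)
  qed
  moreover have "1 \<le> D ^ 2" using D1 by simp
  ultimately show ?thesis using rw unfolding D_hat_def by blast
qed

text \<open>The radial power in \<open>f\<close> is chosen so that \<open>cmod (f z) powr p\<close>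
  and \<open>f z * cnj z ^ n\<close> are the same function \<open>cmod z powr (n * q)\<close>. By
  orthogonality a single coefficient survives and \<open>P f z\<close> is
  \<open>(Mq / M2) * z ^ n\<close>, so the strong type bound becomes an inequality between three
  moments.\<close>

lemma strong_type_moments:
  assumes C: "strong_type p C" and p: "1 < p" and n: "1 \<le> n" and q: "q = p / (p - 1)"
  shows "moment \<omega> (real n * q + 1) powr (p - 1) * moment \<omega> (real n * p + 1) \<le> C * moment \<omega> (2 * real n + 1) powr p"
proof -
  have q1: "1 < q" "(q - 1) * p = q" unfolding q using p by (auto simp: field_simps)
  have C0: "0 \<le> C" using C by (simp add: strong_type_def)
  define Mq where "Mq = moment \<omega> (real n * q + 1)"
  define Mp where "Mp = moment \<omega> (real n * p + 1)"
  define M2 where "M2 = moment \<omega> (2 * real n + 1)"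
  have pos: "0 < Mq" "0 < Mp" "0 < M2"
    using p q1 by (auto simp: Mq_def Mp_def M2_def intro!: moment_pos add_nonneg_nonneg mult_nonneg_nonneg)
  define f where "f z = z ^ n * of_real (cmod z powr (real n * (q - 2)))" for z :: complex
  have fm: "f \<in> borel_measurable \<mu>" unfolding f_def[abs_def] by measurable
  have fn: "cmod (f z) = cmod z powr (real n * (q - 1))" for z
  proof (cases "z = 0")
    case False
    then have "cmod (f z) = cmod z powr real n * cmod z powr (real n * (q - 2))"
      by (simp add: f_def norm_mult norm_power powr_realpow)
    also have "\<dots> = cmod z powr (real n * (q - 1))"
      by (simp add: powr_add[symmetric] algebra_simps)
    finally show ?thesis .
  qed (use n in \<open>simp add: f_def\<close>)
  have fp: "cmod (f z) powr p = cmod z powr (real n * q)" for z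
    using q1(2) by (simp add: fn powr_powr mult.assoc)
  have f: "integrable \<mu> f"
    by (rule integrable_bounded[OF fm, where B = 1]) (use q1 in \<open>auto simp: fn intro!: powr_le1\<close>)
  have fpi: "integrable \<mu> (\<lambda>z. cmod (f z) powr p)"
    by (rule integrable_bounded[where B = 1]) (use fm q1 in \<open>auto simp: fp intro!: powr_le1\<close>)
  have fpI: "(LINT z|\<mu>. cmod (f z) powr p) = 2 * Mq"
    unfolding fp Mq_def by (rule integral_powr_mu)
  have fc: "fcoef f m = (if m = n then of_real (2 * Mq) else 0)" for m
  proof (cases "m = n")
    case False
    have "fcoef f m = (LINT z|\<mu>. z ^ n * cnj z ^ m * of_real (cmod z powr (real n * (q - 2))))"
      unfolding fcoef_def by (rule Bochner_Integration.integral_cong) (auto simp: f_def)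
    also have "\<dots> = 0" using False by (intro integral_monomial_mu) auto
    finally show ?thesis using False by simp
  next
    case True
    have "fcoef f n = (LINT z|\<mu>. of_real (cmod z powr (real n * q)))"
      unfolding fcoef_def
    proof (rule Bochner_Integration.integral_cong)
      fix z
      show "f z * cnj z ^ n = of_real (cmod z powr (real n * q))"
      proof (cases "z = 0")
        case False
        have "f z * cnj z ^ n = (z * cnj z) ^ n * of_real (cmod z powr (real n * (q - 2)))"
          by (simp add: f_def power_mult_distrib)
        also have "\<dots> = of_real (((cmod z)\<^sup>2) ^ n * cmod z powr (real n * (q - 2)))"
          unfolding complex_norm_square[symmetric] by simp
        also have "((cmod z)\<^sup>2) ^ n * cmod z powr (real n * (q - 2)) = cmod z powr (real (2 * n)) * cmod z powr (real n * (q - 2))"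
          using False by (subst powr_realpow) (auto simp: power_mult)
        also have "\<dots> = cmod z powr (real n * q)"
          by (simp add: powr_add[symmetric] algebra_simps)
        finally show ?thesis .
      qed (use n in simp)
    qed simp
    also have "\<dots> = of_real (LINT z|\<mu>. cmod z powr (real n * q))" by (rule integral_complex_of_real)
    also have "\<dots> = of_real (2 * Mq)" unfolding Mq_def by (simp only: integral_powr_mu)
    finally show ?thesis using True by simp
  qed
  have Pf: "cmod (P f z) powr p = (Mq / M2) powr p * cmod z powr (real n * p)" if "z \<in> space \<mu>" for z
  proof -
    have "(\<lambda>m. of_real (coef m) * fcoef f m * z ^ m) sums P f z"
      using that by (intro P_sums[OF f]) auto
    moreover have "(\<lambda>m. of_real (coef m) * fcoef f m * z ^ m) sums (of_real (coef n) * fcoef f n * z ^ n)"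
    proof -
      have "(\<lambda>m. of_real (coef m) * fcoef f m * z ^ m) =
        (\<lambda>m. if m = n then of_real (coef m) * fcoef f m * z ^ m else 0)"
        by (auto simp: fc)
      then show ?thesis using sums_single[of n "\<lambda>m. of_real (coef m) * fcoef f m * z ^ m"] by simp
    qed
    ultimately have "P f z = of_real (coef n) * fcoef f n * z ^ n" by (rule sums_unique2)
    also have "\<dots> = of_real (Mq / M2) * z ^ n" by (simp add: fc coef_def M2_def)
    finally have "cmod (P f z) = (Mq / M2) * cmod z ^ n"
      using pos by (simp add: norm_mult norm_divide norm_power)
    also have "cmod z ^ n = cmod z powr real n" using n by (cases "z = 0") (auto simp: powr_realpow)
    finally have e: "cmod (P f z) = Mq / M2 * cmod z powr real n" .
    show ?thesis unfolding e powr_mult using pos by (simp add: powr_powr)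
  qed
  have zi: "integrable \<mu> (\<lambda>z. cmod z powr (real n * p))"
    by (rule integrable_bounded[where B = 1]) (use p in \<open>auto intro!: powr_le1\<close>)
  have "(\<integral>\<^sup>+z. ennreal (cmod (P f z) powr p) \<partial>\<mu>) = (\<integral>\<^sup>+z. ennreal ((Mq / M2) powr p * cmod z powr (real n * p)) \<partial>\<mu>)"
    by (rule nn_integral_cong) (simp add: Pf)
  also have "\<dots> = ennreal ((Mq / M2) powr p * (2 * Mp))"
    using zi integral_powr_mu[of "real n * p"] by (subst nn_integral_eq_integral) (auto simp: Mp_def)
  finally have "ennreal ((Mq / M2) powr p * (2 * Mp)) \<le> ennreal C * ennreal (2 * Mq)"
    using C fm fpi fpI by (auto simp: strong_type_def nn_integral_eq_integral)
  then have "(Mq / M2) powr p * (2 * Mp) \<le> C * (2 * Mq)"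
    using C0 pos by (simp add: ennreal_mult[symmetric])
  then have "Mq powr p * Mp \<le> C * Mq * M2 powr p"
    using pos by (simp add: powr_divide field_simps)
  also have "Mq powr p = Mq powr (p - 1) * Mq" using pos by (simp add: powr_diff)
  finally have "Mq * (Mq powr (p - 1) * Mp) \<le> Mq * (C * M2 powr p)" by (simp add: mult_ac)
  then have "Mq powr (p - 1) * Mp \<le> C * M2 powr p" using pos by (simp only: mult_le_cancel_left_pos)
  then show ?thesis by (simp only: Mq_def Mp_def M2_def)
qed

text \<open>Hoelder's inequality, by integrating Young's inequality for the normalized powers
  \<open>r powr x / A\<close> and \<open>r powr y / B\<close>; \<open>G\<close> is the weighted
  geometric mean of the two moments.\<close>

lemma convex_ln_moment: "convex_on {0..} (\<lambda>x. ln (moment \<omega> x))"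
proof (rule convex_onI)
  fix t x y :: real assume t: "0 < t" "t < 1" and xy: "x \<in> {0..}" "y \<in> {0..}"
  define A where "A = moment \<omega> x"
  define B where "B = moment \<omega> y"
  have pos: "0 < A" "0 < B" "0 < moment \<omega> ((1 - t) * x + t * y)"
    using xy t by (auto simp: A_def B_def intro!: moment_pos)
  define G where "G = A powr (1 - t) * B powr t"
  have G: "0 < G" using pos by (simp add: G_def)
  have "moment \<omega> ((1 - t) * x + t * y) = (LINT r|lborel. r powr ((1 - t) * x + t * y) * wt r)"
    by (rule moment_eq)
  also have "\<dots> \<le> (LINT r|lborel. (G * ((1 - t) / A * r powr x + t / B * r powr y)) * wt r)"
  proof (rule weighted_integral_mono[where B = "G * ((1 - t) / A + t / B)"])
    fix r :: real assume r: "0 \<le> r" "r < 1"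
    have le1: "r powr x \<le> 1" "r powr y \<le> 1" using r xy by (auto intro!: powr_le1)
    have "r powr ((1 - t) * x + t * y) \<le> G * ((1 - t) / A * r powr x + t / B * r powr y)"
    proof (cases "r = 0")
      case False
      then have r0: "0 < r" using r by simp
      have "(r powr x / A) powr (1 - t) * (r powr y / B) powr t \<le> (1 - t) * (r powr x / A) + t * (r powr y / B)"
        by (rule Youngs_inequality_0) (use t r0 pos in auto)
      also have "(r powr x / A) powr (1 - t) * (r powr y / B) powr t = r powr ((1 - t) * x + t * y) / G"
        using r0 pos by (simp add: powr_divide powr_powr powr_add G_def mult.commute)
      finally show ?thesis using G by (simp add: pos_divide_le_eq mult.commute)
    qed (use pos G t in auto)
    moreover have "(1 - t) / A * r powr x + t / B * r powr y \<le> (1 - t) / A + t / B"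
      using t pos le1 by (intro add_mono mult_left_le) auto
    ultimately show "0 \<le> r powr ((1 - t) * x + t * y) \<and>
      r powr ((1 - t) * x + t * y) \<le> G * ((1 - t) / A * r powr x + t / B * r powr y) \<and>
      G * ((1 - t) / A * r powr x + t / B * r powr y) \<le> G * ((1 - t) / A + t / B)"
      using G by simp
  qed auto
  also have "\<dots> = (LINT r|lborel. (G * (1 - t) / A) * (r powr x * wt r) + (G * t / B) * (r powr y * wt r))"
    by (rule Bochner_Integration.integral_cong) (auto simp: algebra_simps)
  also have "\<dots> = (G * (1 - t) / A) * A + (G * t / B) * B"
  proof -
    have "integrable lborel (\<lambda>r. r powr x * wt r)" "integrable lborel (\<lambda>r. r powr y * wt r)"
      by (rule weighted_integrable[where B = 1]; use xy in \<open>auto intro!: powr_le1\<close>)+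
    then show ?thesis by (simp add: A_def B_def moment_eq)
  qed
  also have "\<dots> = G" using pos by (simp add: right_diff_distrib)
  finally have "ln (moment \<omega> ((1 - t) * x + t * y)) \<le> ln G" using pos by simp
  also have "ln G = (1 - t) * ln A + t * ln B" using pos by (simp add: G_def ln_mult ln_powr)
  finally show "ln (moment \<omega> ((1 - t) *\<^sub>R x + t *\<^sub>R y)) \<le> (1 - t) * ln (moment \<omega> x) + t * ln (moment \<omega> y)"
    by (simp add: A_def B_def)
qed simp

text \<open>Provides the hypothesis \<open>small\<close> of \<open>bounded_gap_of_convex\<close>:
  the tails are positive at every radius below 1, so the moments decay more slowly than any
  exponential.\<close>

lemma moment_subexponential:
  assumes e: "0 < \<epsilon>" and q: "0 < q"
  shows "\<exists>L. \<forall>m\<ge>L. ln (moment \<omega> (real m * q + 1)) - ln (moment \<omega> (2 * real m + 1)) \<le> \<epsilon> * real m"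
proof -
  \<comment> \<open>The logarithm of \<open>r powr (2 * m + 1)\<close> then costs
    \<open>\<epsilon> * m / 2\<close> up to a constant, and the other half of
    \<open>\<epsilon> * m\<close> pays for \<open>c\<close>.\<close>
  define r where "r = exp (- \<epsilon> / 4)"
  have r: "0 < r" "r < 1" using e by (auto simp: r_def)
  define c where "c = ln (moment \<omega> 0) + \<epsilon> / 4 - ln (omega_hat \<omega> r)"
  define L where "L = nat \<lceil>2 * \<bar>c\<bar> / \<epsilon>\<rceil>"
  have "ln (moment \<omega> (real m * q + 1)) - ln (moment \<omega> (2 * real m + 1)) \<le> \<epsilon> * real m" if m: "L \<le> m" for m
  proof -
    have W: "0 < omega_hat \<omega> r" using r by (intro omega_hat_pos) auto
    have "ln (moment \<omega> (real m * q + 1)) \<le> ln (moment \<omega> 0)"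
      using q by (intro ln_mono moment_antimono moment_pos) auto
    moreover have "ln (r powr (2 * real m + 1) * omega_hat \<omega> r) \<le> ln (moment \<omega> (2 * real m + 1))"
      using r W by (intro ln_mono moment_ge moment_pos mult_pos_pos) auto
    moreover have "ln (r powr (2 * real m + 1) * omega_hat \<omega> r) = - (\<epsilon> / 4) * (2 * real m + 1) + ln (omega_hat \<omega> r)"
      using r W by (simp add: ln_mult ln_powr r_def)
    ultimately have "ln (moment \<omega> (real m * q + 1)) - ln (moment \<omega> (2 * real m + 1)) \<le> c + \<epsilon> / 2 * real m"
      unfolding c_def by (simp add: algebra_simps)
    also have "c \<le> \<epsilon> / 2 * real m"
    proof -
      have "2 * \<bar>c\<bar> / \<epsilon> \<le> real m" using m unfolding L_def by linarith
      then show ?thesis using e by (simp add: field_simps)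
    qed
    finally show ?thesis by simp
  qed
  then show ?thesis by blast
qed

text \<open>Applying \<open>dbl\<close> \<open>j\<close> times costs \<open>exp b ^ j\<close>.
  Splitting the moment at \<open>\<eta> ^ j * x\<close>, where \<open>x = 2 ^ k\<close>, at the
  dyadic radius of level \<open>k + 1\<close> gains \<open>exp (- (\<eta> ^ j - 1) / 2)\<close>,
  which wins for large \<open>j\<close>. So half of the moment at \<open>x\<close> is absorbed and
  the rest is bounded by \<open>W (Suc k)\<close>, while \<open>W k / 4\<close> is a lower bound for
  the moment.\<close>

lemma D_hat_of_moment_doubling:
  assumes E: "0 \<le> b" and \<eta>: "1 < \<eta>"
    and dbl: "\<And>x. X \<le> x \<Longrightarrow> moment \<omega> x \<le> exp b * moment \<omega> (\<eta> * x)" and X: "0 \<le> X"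
  shows "\<omega> \<in> D_hat"
proof -
  have iter: "moment \<omega> x \<le> exp b ^ j * moment \<omega> (\<eta> ^ j * x)" if x: "X \<le> x" for x j
  proof (induction j)
    case (Suc j)
    have "X \<le> \<eta> ^ j * x"
      using x X \<eta> mult_mono[of 1 "\<eta> ^ j" X x] by (simp add: one_le_power)
    from dbl[OF this] have "exp b ^ j * moment \<omega> (\<eta> ^ j * x) \<le> exp b ^ j * (exp b * moment \<omega> (\<eta> * (\<eta> ^ j * x)))"
      by (intro mult_left_mono) auto
    from order_trans[OF Suc.IH this] show ?case by (simp add: mult_ac)
  qed simp
  obtain j where j: "exp b ^ j * exp (- (\<eta> ^ j - 1) / 2) \<le> 1 / 2"
  proof -
    have "(\<lambda>j. real j * (1 / \<eta>) ^ j) \<longlonglongrightarrow> 0"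
      by (rule powser_times_n_limit_0) (use \<eta> in simp)
    then have "\<forall>\<^sub>F j in sequentially. real j * (1 / \<eta>) ^ j < 1 / (4 * (b + 1))"
      by (rule order_tendstoD) (use E in simp)
    moreover have "\<forall>\<^sub>F j in sequentially. 8 \<le> \<eta> ^ j"
    proof -
      obtain j0 where "8 < \<eta> ^ j0" using real_arch_pow[OF \<eta>] by blast
      then have "8 \<le> \<eta> ^ j" if "j0 \<le> j" for j
        using power_increasing[OF that, of \<eta>] \<eta> by linarith
      then show ?thesis unfolding eventually_sequentially by blast
    qed
    ultimately have "\<forall>\<^sub>F j in sequentially. real j * (1 / \<eta>) ^ j < 1 / (4 * (b + 1)) \<and> 8 \<le> \<eta> ^ j"
      by (rule eventually_conj)
    \<comment> \<open>The first condition gives \<open>b * j \<le> \<eta> ^ j / 4\<close>; with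
      \<open>8 \<le> \<eta> ^ j\<close> the total exponent is at most -1, and
      \<open>exp (- 1)\<close> is below one half.\<close>
    then obtain j where j: "real j * (1 / \<eta>) ^ j < 1 / (4 * (b + 1))" "8 \<le> \<eta> ^ j"
      by (auto dest: eventually_happens)
    have "real j * (b + 1) < \<eta> ^ j / 4"
      using j(1) E \<eta> by (simp add: power_one_over field_simps)
    then have "b * real j \<le> \<eta> ^ j / 4" using E by (simp add: algebra_simps)
    moreover have "- (\<eta> ^ j - 1) / 2 = 1 / 2 - \<eta> ^ j / 2" by (simp add: diff_divide_distrib)
    ultimately have "b * real j + - (\<eta> ^ j - 1) / 2 \<le> - 1" using j(2) by linarith
    then have "exp (b * real j + - (\<eta> ^ j - 1) / 2) \<le> exp (- 1)" by simp
    also have "exp (- 1 :: real) \<le> 1 / 2"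
      using exp_ge_add_one_self[of "1::real"] by (simp add: exp_minus field_simps)
    finally have "exp b ^ j * exp (- (\<eta> ^ j - 1) / 2) \<le> 1 / 2"
      by (simp only: exp_add exp_of_nat_mult[symmetric] mult.commute[of b])
    then show ?thesis using that by blast
  qed
  obtain k0 :: nat where k0: "X \<le> 2 ^ k0" "1 \<le> k0"
  proof -
    obtain n where "X < 2 ^ n" using real_arch_pow[of 2 X] by auto
    moreover have "(2::real) ^ n \<le> 2 ^ (n + 1)" by simp
    ultimately show ?thesis using that[of "n + 1"] by linarith
  qed
  show ?thesis
  proof (rule D_hat_dyadicI[of k0 "8 * exp b ^ j"])
    fix k assume k: "k0 \<le> k"
    define x where "x = (2::real) ^ k"
    have x0: "0 \<le> x" by (simp add: x_def)
    have xX: "X \<le> x"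
      unfolding x_def by (rule order_trans[OF k0(1)]) (use k in simp)
    define s where "s = (1 - 1 / 2 ^ Suc k :: real)"
    have s: "0 < s" "s < 1"
      using one_less_power[of "2::real" "Suc k"] by (auto simp: s_def field_simps simp del: power_Suc)
    define y where "y = (\<eta> ^ j - 1) * x"
    have y0: "0 \<le> y" using \<eta> x0 by (simp add: y_def one_le_power)
    have "moment \<omega> (\<eta> ^ j * x) = moment \<omega> (x + y)" by (simp add: y_def algebra_simps)
    also have "\<dots> \<le> s powr y * moment \<omega> x + W (Suc k)"
      unfolding W_def s_def[symmetric] by (rule moment_add_le) (use x0 y0 s in auto)
    also have "s powr y \<le> exp (- (\<eta> ^ j - 1) / 2)"
    proof -
      have "s \<le> exp (- 1 / 2 ^ Suc k)"
        unfolding s_def using exp_ge_add_one_self[of "- 1 / 2 ^ Suc k :: real"] by simp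
      then have "s powr y \<le> exp (- 1 / 2 ^ Suc k) powr y" using s y0 by (intro powr_mono2) auto
      also have "\<dots> = exp (- (\<eta> ^ j - 1) / 2)"
        by (simp add: exp_powr_real y_def x_def field_simps)
      finally show ?thesis .
    qed
    finally have "moment \<omega> (\<eta> ^ j * x) \<le> exp (- (\<eta> ^ j - 1) / 2) * moment \<omega> x + W (Suc k)"
      using moment_pos[OF x0] by (simp add: mult_right_mono)
    then have "exp b ^ j * moment \<omega> (\<eta> ^ j * x) \<le> exp b ^ j * (exp (- (\<eta> ^ j - 1) / 2) * moment \<omega> x + W (Suc k))"
      by (intro mult_left_mono) auto
    also have "\<dots> = (exp b ^ j * exp (- (\<eta> ^ j - 1) / 2)) * moment \<omega> x + exp b ^ j * W (Suc k)"
      by (simp add: algebra_simps)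
    also have "\<dots> \<le> 1 / 2 * moment \<omega> x + exp b ^ j * W (Suc k)"
      using j moment_pos[OF x0] by (intro add_right_mono mult_right_mono) auto
    finally have m: "moment \<omega> x \<le> 2 * exp b ^ j * W (Suc k)"
      using iter[OF xX, of j] by simp
    have "1 / 4 * W k \<le> (1 - 1 / 2 ^ k) ^ (2 ^ k) * W k"
      using one_minus_half_power_ge[of k] k k0 W_pos[of k] by (intro mult_right_mono) auto
    also have "(1 - 1 / 2 ^ k :: real) ^ (2 ^ k) = (1 - 1 / 2 ^ k) powr x"
    proof -
      have "0 < (1 - 1 / 2 ^ k :: real)"
        using one_less_power[of "2::real" k] k k0 by (auto simp: field_simps)
      then show ?thesis using powr_realpow[of "1 - 1 / 2 ^ k" "2 ^ k"] by (simp add: x_def)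
    qed
    also have "\<dots> * W k \<le> moment \<omega> x"
      unfolding W_def by (rule moment_ge) (use x0 dyadic_radius[of k] in auto)
    finally show "W k \<le> 8 * exp b ^ j * W (Suc k)" using m by simp
  qed
qed

lemma D_hat_of_strong_type:
  assumes C: "strong_type p C" and p: "1 < p" "p \<noteq> 2"
  shows "\<omega> \<in> D_hat"
proof -
  define C' where "C' = max C 1"
  have C'1: "1 \<le> C'" by (simp add: C'_def)
  define \<psi> where "\<psi> x = ln (moment \<omega> x)" for x
  define p' where "p' = p / (p - 1)"
  have p': "1 < p'" "1 / p + 1 / p' = 1" using p by (auto simp: p'_def field_simps)
  have hyp: "\<psi> (real n * p' + 1) / p' + \<psi> (real n * p + 1) / p \<le> \<psi> (2 * real n + 1) + ln C' / p" if n: "1 \<le> n" for n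
  proof -
    have pos: "0 < moment \<omega> (real n * p' + 1)" "0 < moment \<omega> (real n * p + 1)" "0 < moment \<omega> (2 * real n + 1)"
      using p p' by (auto intro!: moment_pos add_nonneg_nonneg mult_nonneg_nonneg)
    have "moment \<omega> (real n * p' + 1) powr (p - 1) * moment \<omega> (real n * p + 1) \<le> C * moment \<omega> (2 * real n + 1) powr p"
      by (rule strong_type_moments[OF C p(1) n p'_def])
    also have "\<dots> \<le> C' * moment \<omega> (2 * real n + 1) powr p" by (rule mult_right_mono) (auto simp: C'_def)
    finally have "ln (moment \<omega> (real n * p' + 1) powr (p - 1) * moment \<omega> (real n * p + 1)) \<le> ln (C' * moment \<omega> (2 * real n + 1) powr p)"
      using pos by (intro ln_mono) (auto simp: C'_def)
    then have "(p - 1) * \<psi> (real n * p' + 1) + \<psi> (real n * p + 1) \<le> ln C' + p * \<psi> (2 * real n + 1)"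
      using pos C'1 by (simp add: ln_mult ln_powr \<psi>_def)
    then have "((p - 1) * \<psi> (real n * p' + 1) + \<psi> (real n * p + 1)) / p \<le> (ln C' + p * \<psi> (2 * real n + 1)) / p"
      using p by (intro divide_right_mono) auto
    moreover have "(p - 1) / p = 1 / p'" using p by (simp add: p'_def)
    ultimately show ?thesis using p
      by (simp add: add_divide_distrib) (metis times_divide_eq_left mult.commute times_divide_eq_right mult_1 add.commute)
  qed
  have cvx: "convex_on {0..} \<psi>" unfolding \<psi>_def by (rule convex_ln_moment)
  have c0: "0 \<le> ln C' / p" using p by (simp add: C'_def)
  \<comment> \<open>The moment inequality, divided by \<open>p\<close>, is symmetric in the
    conjugate exponents, so one argument with \<open>q\<close> the smaller of them covers both
    cases.\<close>
  have concl: "\<omega> \<in> D_hat" if q: "1 < q" "q < 2" and pq: "1 / P' + 1 / q = 1"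
    and hyp': "\<And>n. 1 \<le> n \<Longrightarrow> \<psi> (real n * q + 1) / q + \<psi> (real n * P' + 1) / P' \<le> \<psi> (2 * real n + 1) + ln C' / p" for P' q
  proof -
    obtain B N where B: "\<And>n. N \<le> n \<Longrightarrow> \<psi> (real n * q + 1) - \<psi> (2 * real n + 1) \<le> B"
      by (rule bounded_gap_of_convex[OF cvx q pq hyp' _ c0])
         (use moment_subexponential[of _ q] q in \<open>auto simp: \<psi>_def\<close>)
    define b where "b = max 0 B"
    \<comment> \<open>For \<open>n\<close> near \<open>x / q\<close> the point
      \<open>2 * n + 1\<close> is near \<open>2 * x / q\<close>. An \<open>\<eta>\<close> halfway
      between 1 and \<open>2 / q\<close> leaves room for the rounding as soon as
      \<open>X \<le> x\<close>.\<close>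
    define \<eta> where "\<eta> = (1 + 2 / q) / 2"
    have \<eta>: "1 < \<eta>" using q by (simp add: \<eta>_def)
    define X where "X = max ((2 / q + 1) / (2 / q - \<eta>)) (real N * q + q + 1)"
    have d: "0 < 2 / q - \<eta>" using q by (simp add: \<eta>_def field_simps)
    show ?thesis
    proof (rule D_hat_of_moment_doubling[OF _ \<eta>, of b X])
      show "0 \<le> b" by (simp add: b_def)
      show "0 \<le> X" using q by (simp add: X_def le_max_iff_disj)
      fix x assume x: "X \<le> x"
      define n where "n = nat \<lfloor>(x - 1) / q\<rfloor>"
      have x1: "real N * q + q + 1 \<le> x" and x2: "(2 / q + 1) / (2 / q - \<eta>) \<le> x" using x by (auto simp: X_def)
      have "real N + 1 \<le> (x - 1) / q" using x1 q by (simp add: le_divide_eq distrib_right)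
      then have n: "N \<le> n" "real n \<le> (x - 1) / q" "(x - 1) / q - 1 \<le> real n"
        unfolding n_def by linarith+
      have nq: "real n * q + 1 \<le> x" using n(2) q by (simp add: le_divide_eq)
      have "2 * ((x - 1) / q - 1) + 1 \<le> 2 * real n + 1" by (intro add_right_mono mult_left_mono n(3)) simp
      moreover have "\<eta> * x \<le> 2 * ((x - 1) / q - 1) + 1"
      proof -
        have "2 / q + 1 \<le> x * (2 / q - \<eta>)" using x2 d by (simp add: pos_divide_le_eq)
        then show ?thesis using q by (simp add: right_diff_distrib diff_divide_distrib mult.commute)
      qed
      ultimately have n2: "\<eta> * x \<le> 2 * real n + 1" by simp
      have x0: "0 \<le> x" using nq q by (smt (verit) mult_nonneg_nonneg of_nat_0_le_iff)
      have pos: "0 < moment \<omega> (real n * q + 1)" "0 < moment \<omega> (2 * real n + 1)"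
        using q by (auto intro!: moment_pos)
      have "moment \<omega> x \<le> moment \<omega> (real n * q + 1)" using nq q by (intro moment_antimono) auto
      also have "\<dots> = exp (\<psi> (real n * q + 1))" using pos by (simp add: \<psi>_def)
      also have "\<dots> \<le> exp (b + \<psi> (2 * real n + 1))" using B[OF n(1)] by (simp add: b_def)
      also have "\<dots> = exp b * moment \<omega> (2 * real n + 1)" using pos by (simp add: \<psi>_def exp_add)
      also have "\<dots> \<le> exp b * moment \<omega> (\<eta> * x)"
        using n2 x0 \<eta> by (intro mult_left_mono moment_antimono) auto
      finally show "moment \<omega> x \<le> exp b * moment \<omega> (\<eta> * x)" .
    qed
  qed
  show ?thesis
  proof (cases "p < 2")
    case True
    show ?thesis by (rule concl[of p p']) (use p p' True hyp in \<open>auto simp: add.commute\<close>)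
  next
    case False
    then have "p' < 2" using p by (simp add: p'_def field_simps)
    then show ?thesis by (intro concl[of p' p]) (use p p' hyp in \<open>auto simp: add.commute\<close>)
  qed
qed

end

subsection \<open>Discrete symbols\<close>

definition fdiff :: "(nat \<Rightarrow> real) \<Rightarrow> nat \<Rightarrow> real" where
  "fdiff x n = x (Suc n) - x n"

text \<open>The discrete analogue of a symbol class, with the size \<open>s\<close> in the role of the order.\<close>

definition symbol :: "nat \<Rightarrow> (nat \<Rightarrow> real) \<Rightarrow> (nat \<Rightarrow> real) \<Rightarrow> bool" where
  "symbol j s x \<longleftrightarrow> (\<exists>C\<ge>0. \<forall>i\<le>j. \<forall>n\<ge>1. \<bar>(fdiff ^^ i) x n\<bar> * real n ^ i \<le> C * s n)"

lemma symbol_le: "symbol j s x \<Longrightarrow> i \<le> j \<Longrightarrow> symbol i s x"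
  unfolding symbol_def by (meson order_trans)

lemma symbol_0_iff: "symbol 0 s x \<longleftrightarrow> (\<exists>C\<ge>0. \<forall>n\<ge>1. \<bar>x n\<bar> \<le> C * s n)"
  by (simp add: symbol_def)

text \<open>One difference costs one factor \<open>n\<close> in the size. This recursion is what
  makes products and inverses accessible to induction on the order.\<close>

lemma symbol_Suc:
  assumes "\<And>n. 1 \<le> n \<Longrightarrow> 0 \<le> s n"
  shows "symbol (Suc j) s x \<longleftrightarrow> symbol 0 s x \<and> symbol j (\<lambda>n. s n / real n) (fdiff x)"
proof
  assume "symbol (Suc j) s x"
  then obtain C where C: "0 \<le> C" "\<And>i n. i \<le> Suc j \<Longrightarrow> 1 \<le> n \<Longrightarrow> \<bar>(fdiff ^^ i) x n\<bar> * real n ^ i \<le> C * s n"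
    unfolding symbol_def by blast
  have "\<bar>(fdiff ^^ i) (fdiff x) n\<bar> * real n ^ i \<le> C * (s n / real n)" if "i \<le> j" "1 \<le> n" for i n
    using C(2)[of "Suc i" n] that by (simp add: funpow_Suc_right le_divide_eq mult_ac del: funpow.simps)
  then have "symbol j (\<lambda>n. s n / real n) (fdiff x)" using C(1) unfolding symbol_def by blast
  then show "symbol 0 s x \<and> symbol j (\<lambda>n. s n / real n) (fdiff x)"
    using \<open>symbol (Suc j) s x\<close> by (auto intro: symbol_le)
next
  assume "symbol 0 s x \<and> symbol j (\<lambda>n. s n / real n) (fdiff x)"
  then obtain A B where A: "0 \<le> A" "\<And>n. 1 \<le> n \<Longrightarrow> \<bar>x n\<bar> \<le> A * s n"
    and B: "0 \<le> B" "\<And>i n. i \<le> j \<Longrightarrow> 1 \<le> n \<Longrightarrow> \<bar>(fdiff ^^ i) (fdiff x) n\<bar> * real n ^ i \<le> B * (s n / real n)"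
    unfolding symbol_0_iff unfolding symbol_def by blast
  have "\<bar>(fdiff ^^ i) x n\<bar> * real n ^ i \<le> max A B * s n" if i: "i \<le> Suc j" and n: "1 \<le> n" for i n
  proof (cases i)
    case 0
    then show ?thesis using A(2)[OF n] assms[OF n] mult_right_mono[of A "max A B" "s n"] by simp
  next
    case (Suc i')
    have "\<bar>(fdiff ^^ i') (fdiff x) n\<bar> * real n ^ i' * real n \<le> B * (s n / real n) * real n"
      using B(2)[of i' n] Suc i n by (intro mult_right_mono) auto
    also have "\<dots> \<le> max A B * s n" using n assms[OF n] by (simp add: mult_right_mono)
    finally show ?thesis using Suc by (simp add: funpow_Suc_right mult_ac del: funpow.simps)
  qed
  then show "symbol (Suc j) s x" unfolding symbol_def using A(1) by (intro exI[of _ "max A B"]) auto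
qed

lemma symbol_size_mono:
  assumes "symbol j s x" and B: "0 \<le> B" "\<And>n. 1 \<le> n \<Longrightarrow> s n \<le> B * t n"
  shows "symbol j t x"
proof -
  obtain C where C: "0 \<le> C" "\<And>i n. i \<le> j \<Longrightarrow> 1 \<le> n \<Longrightarrow> \<bar>(fdiff ^^ i) x n\<bar> * real n ^ i \<le> C * s n"
    using assms(1) unfolding symbol_def by blast
  have "\<bar>(fdiff ^^ i) x n\<bar> * real n ^ i \<le> (C * B) * t n" if "i \<le> j" "1 \<le> n" for i n
    using C(2)[OF that] mult_left_mono[OF B(2)[OF that(2)] C(1)] by (simp add: mult.assoc)
  then show ?thesis using C(1) B(1) unfolding symbol_def by (intro exI[of _ "C * B"]) auto
qed

lemma fdiff_funpow_add: "(fdiff ^^ i) (\<lambda>n. x n + y n) = (\<lambda>n. (fdiff ^^ i) x n + (fdiff ^^ i) y n)"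
  by (induction i) (auto simp: fdiff_def)

lemma fdiff_funpow_uminus: "(fdiff ^^ i) (\<lambda>n. - x n) = (\<lambda>n. - (fdiff ^^ i) x n)"
  by (induction i) (auto simp: fdiff_def)

lemma fdiff_funpow_shift: "(fdiff ^^ i) (\<lambda>n. x (Suc n)) = (\<lambda>n. (fdiff ^^ i) x (Suc n))"
  by (induction i) (auto simp: fdiff_def)

lemma fdiff_funpow_zero: "(fdiff ^^ i) (\<lambda>n. 0) = (\<lambda>n. 0)"
  by (induction i) (auto simp: fdiff_def)

lemma symbol_zero:
  assumes "\<And>n. 1 \<le> n \<Longrightarrow> 0 \<le> s n"
  shows "symbol j s (\<lambda>n. 0)"
  unfolding symbol_def fdiff_funpow_zero using assms by (intro exI[of _ 0]) auto

lemma symbol_add: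
  assumes "symbol j s x" "symbol j s y"
  shows "symbol j s (\<lambda>n. x n + y n)"
proof -
  obtain A B where A: "0 \<le> A" "\<And>i n. i \<le> j \<Longrightarrow> 1 \<le> n \<Longrightarrow> \<bar>(fdiff ^^ i) x n\<bar> * real n ^ i \<le> A * s n"
    and B: "0 \<le> B" "\<And>i n. i \<le> j \<Longrightarrow> 1 \<le> n \<Longrightarrow> \<bar>(fdiff ^^ i) y n\<bar> * real n ^ i \<le> B * s n"
    using assms unfolding symbol_def by blast
  have "\<bar>(fdiff ^^ i) (\<lambda>n. x n + y n) n\<bar> * real n ^ i \<le> (A + B) * s n" if "i \<le> j" "1 \<le> n" for i n
  proof -
    have "\<bar>(fdiff ^^ i) (\<lambda>n. x n + y n) n\<bar> * real n ^ i \<le> (\<bar>(fdiff ^^ i) x n\<bar> + \<bar>(fdiff ^^ i) y n\<bar>) * real n ^ i"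
      unfolding fdiff_funpow_add by (intro mult_right_mono) auto
    then show ?thesis using A(2)[OF that] B(2)[OF that] by (simp add: distrib_right)
  qed
  then show ?thesis using A(1) B(1) unfolding symbol_def by (intro exI[of _ "A + B"]) auto
qed

lemma symbol_uminus: "symbol j s x \<Longrightarrow> symbol j s (\<lambda>n. - x n)"
  unfolding symbol_def fdiff_funpow_uminus by simp

lemma symbol_shift:
  assumes "symbol j s x" and B: "0 \<le> B" "\<And>n. 1 \<le> n \<Longrightarrow> s (Suc n) \<le> B * s n"
  shows "symbol j s (\<lambda>n. x (Suc n))"
proof -
  obtain C where C: "0 \<le> C" "\<And>i n. i \<le> j \<Longrightarrow> 1 \<le> n \<Longrightarrow> \<bar>(fdiff ^^ i) x n\<bar> * real n ^ i \<le> C * s n"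
    using assms(1) unfolding symbol_def by blast
  have "\<bar>(fdiff ^^ i) (\<lambda>n. x (Suc n)) n\<bar> * real n ^ i \<le> (C * B) * s n" if "i \<le> j" "1 \<le> n" for i n
  proof -
    have "\<bar>(fdiff ^^ i) (\<lambda>n. x (Suc n)) n\<bar> * real n ^ i \<le> \<bar>(fdiff ^^ i) x (Suc n)\<bar> * real (Suc n) ^ i"
      unfolding fdiff_funpow_shift by (intro mult_left_mono power_mono) auto
    also have "\<dots> \<le> C * s (Suc n)" using C(2)[of i "Suc n"] that by simp
    also have "\<dots> \<le> C * (B * s n)" by (intro mult_left_mono B C) (use that in auto)
    finally show ?thesis by (simp add: mult.assoc)
  qed
  then show ?thesis using C(1) B(1) unfolding symbol_def by (intro exI[of _ "C * B"]) auto
qed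

text \<open>The Leibniz rule for differences,
  \<open>x (Suc n) * fdiff y n + fdiff x n * y n\<close>; the shifted factor is the reason for the
  growth condition on \<open>s\<close>.\<close>

lemma symbol_mult:
  assumes "symbol j s x" "symbol j t y"
    and "\<And>n. 1 \<le> n \<Longrightarrow> 0 \<le> s n" "\<And>n. 1 \<le> n \<Longrightarrow> 0 \<le> t n"
    and "0 \<le> B" "\<And>n. 1 \<le> n \<Longrightarrow> s (Suc n) \<le> B * s n"
  shows "symbol j (\<lambda>n. s n * t n) (\<lambda>n. x n * y n)"
  using assms
proof (induction j arbitrary: s t x y)
  case 0
  then obtain A B where A: "0 \<le> A" "\<And>n. 1 \<le> n \<Longrightarrow> \<bar>x n\<bar> \<le> A * s n"
    and B: "0 \<le> B" "\<And>n. 1 \<le> n \<Longrightarrow> \<bar>y n\<bar> \<le> B * t n"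
    unfolding symbol_0_iff by blast
  have "\<bar>x n * y n\<bar> \<le> (A * B) * (s n * t n)" if "1 \<le> n" for n
  proof -
    have "\<bar>x n\<bar> * \<bar>y n\<bar> \<le> (A * s n) * (B * t n)"
      using A B "0.prems"(3,4) that by (intro mult_mono) auto
    then show ?thesis by (simp add: abs_mult mult_ac)
  qed
  then show ?case using A(1) B(1) unfolding symbol_0_iff by (intro exI[of _ "A * B"]) auto
next
  case (Suc j)
  note nn = Suc.prems(3,4) and B = Suc.prems(5,6)
  have x: "symbol 0 s x" "symbol j (\<lambda>n. s n / real n) (fdiff x)" "symbol j s x"
    and y: "symbol 0 t y" "symbol j (\<lambda>n. t n / real n) (fdiff y)" "symbol j t y"
    using Suc.prems(1,2) symbol_Suc[of s j x, OF nn(1)] symbol_Suc[of t j y, OF nn(2)]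
      symbol_le[OF Suc.prems(1), of j] symbol_le[OF Suc.prems(2), of j] by auto
  have st: "0 \<le> s n * t n" if "1 \<le> n" for n using nn that by simp
  have 1: "symbol j (\<lambda>n. s n * (t n / real n)) (\<lambda>n. x (Suc n) * fdiff y n)"
    by (rule Suc.IH[OF symbol_shift[OF x(3) B] y(2) _ _ B]) (use nn in auto)
  have 2: "symbol j (\<lambda>n. (s n / real n) * t n) (\<lambda>n. fdiff x n * y n)"
  proof (rule Suc.IH[OF x(2) y(3) _ _ B(1)])
    fix n :: nat assume n: "1 \<le> n"
    have "s (Suc n) / real (Suc n) \<le> B * s n / real (Suc n)" using B(2)[OF n] by (intro divide_right_mono) auto
    also have "\<dots> \<le> B * s n / real n" using B(1) nn(1)[OF n] n by (intro divide_left_mono) auto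
    finally show "s (Suc n) / real (Suc n) \<le> B * (s n / real n)" by simp
  qed (use nn in auto)
  have "fdiff (\<lambda>n. x n * y n) = (\<lambda>n. x (Suc n) * fdiff y n + fdiff x n * y n)"
    by (auto simp: fdiff_def algebra_simps)
  moreover have "symbol j (\<lambda>n. s n * t n / real n) (\<lambda>n. x (Suc n) * fdiff y n + fdiff x n * y n)"
    by (rule symbol_add) (use 1 2 in \<open>simp_all add: times_divide_eq_left times_divide_eq_right\<close>)
  moreover have "symbol 0 (\<lambda>n. s n * t n) (\<lambda>n. x n * y n)"
  proof -
    obtain A B where A: "0 \<le> A" "\<And>n. 1 \<le> n \<Longrightarrow> \<bar>x n\<bar> \<le> A * s n"
      and B: "0 \<le> B" "\<And>n. 1 \<le> n \<Longrightarrow> \<bar>y n\<bar> \<le> B * t n"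
      using x(1) y(1) unfolding symbol_0_iff by blast
    have "\<bar>x n * y n\<bar> \<le> (A * B) * (s n * t n)" if "1 \<le> n" for n
    proof -
      have "\<bar>x n\<bar> * \<bar>y n\<bar> \<le> (A * s n) * (B * t n)"
        using A B nn that by (intro mult_mono) auto
      then show ?thesis by (simp add: abs_mult mult_ac)
    qed
    then show ?thesis using A(1) B(1) unfolding symbol_0_iff by (intro exI[of _ "A * B"]) auto
  qed
  ultimately show ?case using symbol_Suc[OF st] by simp
qed

text \<open>The difference of \<open>1 / u\<close> is
  \<open>- fdiff u n / (u n * u (Suc n))\<close>, so the product rule gives order
  \<open>Suc j\<close> for the inverse from its order \<open>j\<close>.\<close>

lemma symbol_inverse:
  assumes u: "\<And>j. symbol j u u" and pos: "\<And>n. 0 < u n"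
    and B: "1 \<le> B" "\<And>n. 1 \<le> n \<Longrightarrow> u (Suc n) \<le> u n" "\<And>n. 1 \<le> n \<Longrightarrow> u n \<le> B * u (Suc n)"
  shows "symbol j (\<lambda>n. 1 / u n) (\<lambda>n. 1 / u n)"
proof (induction j)
  case 0
  show ?case unfolding symbol_0_iff using pos by (intro exI[of _ 1]) (auto simp: less_imp_le)
next
  case (Suc j)
  have pos': "0 \<le> 1 / u n" for n using pos[of n] by simp
  have sh: "1 / u (Suc n) \<le> B * (1 / u n)" if "1 \<le> n" for n
    using B(3)[OF that] pos[of n] pos[of "Suc n"] by (simp add: field_simps)
  have B0: "0 \<le> B" using B by simp
  have du: "symbol j (\<lambda>n. u n / real n) (fdiff u)"
    using u[of "Suc j"] symbol_Suc[of u] pos by (simp add: less_imp_le)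
  have aa: "symbol j (\<lambda>n. 1 / u n * (1 / u n)) (\<lambda>n. 1 / u n * (1 / u (Suc n)))"
    by (rule symbol_mult[OF Suc symbol_shift[OF Suc B0 sh] _ _ B0 sh]) (use pos' in auto)
  have "symbol j (\<lambda>n. (1 / u n * (1 / u n)) * (u n / real n)) (\<lambda>n. (1 / u n * (1 / u (Suc n))) * fdiff u n)"
  proof (rule symbol_mult[OF aa du, where B = "B * B"])
    show "1 / u (Suc n) * (1 / u (Suc n)) \<le> B * B * (1 / u n * (1 / u n))" if "1 \<le> n" for n
      using mult_mono[OF sh[OF that] sh[OF that]] B0 pos' by (simp add: mult_ac)
  qed (use pos pos' B0 in \<open>auto simp: less_imp_le\<close>)
  then have "symbol j (\<lambda>n. 1 / u n / real n) (\<lambda>n. - ((1 / u n * (1 / u (Suc n))) * fdiff u n))"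
    using pos by (intro symbol_uminus) (simp add: less_imp_neq[symmetric])
  moreover have "(\<lambda>n. - ((1 / u n * (1 / u (Suc n))) * fdiff u n)) = fdiff (\<lambda>n. 1 / u n)"
  proof
    fix n show "- ((1 / u n * (1 / u (Suc n))) * fdiff u n) = fdiff (\<lambda>n. 1 / u n) n"
      using pos[of n] pos[of "Suc n"] by (simp add: fdiff_def field_simps)
  qed
  moreover have "symbol 0 (\<lambda>n. 1 / u n) (\<lambda>n. 1 / u n)" using Suc by (rule symbol_le) simp
  ultimately show ?case using symbol_Suc[of "\<lambda>n. 1 / u n" j] pos' by simp
qed

lemma symbol_of_nat_Suc: "symbol j real (\<lambda>n. real n + 1)"
proof -
  have 0: "symbol 0 real (\<lambda>n. real n + 1)" unfolding symbol_0_iff by (intro exI[of _ 2]) auto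
  have e1: "fdiff (\<lambda>n. real n + 1) = (\<lambda>n. 1)" and e2: "fdiff (\<lambda>n. 1) = (\<lambda>n. 0)" by (auto simp: fdiff_def)
  have 1: "symbol i (\<lambda>n. real n / real n) (\<lambda>n. 1)" for i
  proof -
    have "symbol 0 (\<lambda>n. real n / real n) (\<lambda>n. 1)" unfolding symbol_0_iff by (intro exI[of _ 1]) auto
    then show ?thesis using symbol_Suc[of "\<lambda>n. real n / real n"] e2 symbol_zero by (cases i) auto
  qed
  show ?thesis using 0 1 symbol_Suc[of real] e1 by (cases j) auto
qed

section \<open>Abel summation for tails of power series\<close>

lemma summable_fdiff:
  fixes c :: "nat \<Rightarrow> real"
  assumes "summable (\<lambda>n. \<bar>c n\<bar> * x ^ n)" "0 \<le> x"
  shows "summable (\<lambda>n. \<bar>fdiff c n\<bar> * x ^ n)"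
proof (cases "x = 0")
  case True
  have "summable (\<lambda>n. if n = 0 then \<bar>fdiff c n\<bar> else 0)" by simp
  moreover have "(\<lambda>n. if n = 0 then \<bar>fdiff c n\<bar> else 0) = (\<lambda>n. \<bar>fdiff c n\<bar> * x ^ n)" using True by auto
  ultimately show ?thesis by simp
next
  case False
  then have x: "0 < x" using assms by simp
  have "summable (\<lambda>n. \<bar>c (Suc n)\<bar> * x ^ Suc n)" using assms(1) by (subst summable_Suc_iff)
  then have "summable (\<lambda>n. \<bar>c (Suc n)\<bar> * x ^ Suc n / x)" by (rule summable_divide)
  then have "summable (\<lambda>n. \<bar>c (Suc n)\<bar> * x ^ n + \<bar>c n\<bar> * x ^ n)"
    using x assms(1) by (intro summable_add) simp_all
  then show ?thesis
    by (rule summable_comparison_test'[where N = 0])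
       (use x in \<open>auto simp: fdiff_def abs_mult distrib_right[symmetric] intro!: mult_right_mono\<close>)
qed

lemma summable_fdiff_funpow:
  fixes c :: "nat \<Rightarrow> real"
  assumes "summable (\<lambda>n. \<bar>c n\<bar> * x ^ n)" "0 \<le> x"
  shows "summable (\<lambda>n. \<bar>(fdiff ^^ j) c n\<bar> * x ^ n)"
  by (induction j) (use assms summable_fdiff in auto)

definition tail :: "complex \<Rightarrow> nat \<Rightarrow> (nat \<Rightarrow> real) \<Rightarrow> complex" where
  "tail w N c = (\<Sum>n. of_real (c (n + N)) * w ^ (n + N))"

lemma tail_summable:
  assumes "summable (\<lambda>n. \<bar>c n\<bar> * cmod w ^ n)"
  shows "summable (\<lambda>n. norm (of_real (c (n + N)) * w ^ (n + N)))"
  using summable_ignore_initial_segment[OF assms, of N] by (simp add: norm_mult norm_power)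

text \<open>Multiplication by \<open>1 - w\<close> turns the tail into the boundary term at
  \<open>N\<close> plus \<open>w\<close> times the tail of the differences.\<close>

lemma tail_fdiff:
  assumes s: "summable (\<lambda>n. \<bar>c n\<bar> * cmod w ^ n)" and w: "cmod w \<le> 1"
  shows "cmod (1 - w) * cmod (tail w N c) \<le> \<bar>c N\<bar> + cmod (tail w N (fdiff c))"
proof -
  define g where "g n = of_real (c (n + N)) * w ^ (n + N)" for n
  have g: "summable g" unfolding g_def by (rule summable_norm_cancel[OF tail_summable[OF s]])
  have d: "summable (\<lambda>n. of_real (fdiff c (n + N)) * w ^ (n + N))"
    by (rule summable_norm_cancel[OF tail_summable[OF summable_fdiff[OF s]]]) simp
  have "suminf g = g 0 + (\<Sum>n. g (Suc n))" using suminf_split_head[OF g] by simp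
  also have "(\<Sum>n. g (Suc n)) = (\<Sum>n. w * (of_real (fdiff c (n + N)) * w ^ (n + N)) + w * g n)"
    by (intro suminf_cong) (simp add: g_def fdiff_def algebra_simps)
  also have "\<dots> = w * tail w N (fdiff c) + w * suminf g"
    using g d by (simp add: suminf_add[symmetric] summable_mult suminf_mult tail_def)
  finally have E: "suminf g = g 0 + (w * tail w N (fdiff c) + w * suminf g)" .
  have "(1 - w) * suminf g = suminf g - w * suminf g" by (simp add: left_diff_distrib)
  also have "\<dots> = g 0 + w * tail w N (fdiff c)" by (subst E) simp
  finally have "(1 - w) * suminf g = g 0 + w * tail w N (fdiff c)" .
  moreover have "tail w N c = suminf g" by (simp add: tail_def g_def[abs_def])
  ultimately have "(1 - w) * tail w N c = of_real (c N) * w ^ N + w * tail w N (fdiff c)"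
    by (simp add: g_def)
  then have "cmod (1 - w) * cmod (tail w N c) \<le> cmod (of_real (c N) * w ^ N) + cmod (w * tail w N (fdiff c))"
    by (metis norm_mult norm_triangle_ineq)
  also have "\<dots> \<le> \<bar>c N\<bar> + cmod (tail w N (fdiff c))"
    using w by (intro add_mono) (auto simp: norm_mult norm_power mult_left_le mult_left_le_one_le power_le_one)
  finally show ?thesis .
qed

lemma tail_summation_by_parts:
  assumes s: "summable (\<lambda>n. \<bar>c n\<bar> * cmod w ^ n)" and w: "cmod w \<le> 1" and h: "0 < h" "h \<le> cmod (1 - w)"
  shows "cmod (tail w N c) \<le> (\<Sum>j<M. \<bar>(fdiff ^^ j) c N\<bar> / h ^ Suc j) + cmod (tail w N ((fdiff ^^ M) c)) / h ^ M"
proof (induction M)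
  case (Suc M)
  have "h * cmod (tail w N ((fdiff ^^ M) c)) \<le> cmod (1 - w) * cmod (tail w N ((fdiff ^^ M) c))"
    using h by (intro mult_right_mono) auto
  also have "\<dots> \<le> \<bar>(fdiff ^^ M) c N\<bar> + cmod (tail w N (fdiff ((fdiff ^^ M) c)))"
    by (rule tail_fdiff[OF summable_fdiff_funpow[OF s] w]) simp
  finally have "cmod (tail w N ((fdiff ^^ M) c)) \<le> \<bar>(fdiff ^^ M) c N\<bar> / h + cmod (tail w N ((fdiff ^^ Suc M) c)) / h"
    using h by (simp add: field_simps)
  then have "cmod (tail w N ((fdiff ^^ M) c)) / h ^ M \<le> (\<bar>(fdiff ^^ M) c N\<bar> / h + cmod (tail w N ((fdiff ^^ Suc M) c)) / h) / h ^ M"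
    using h by (intro divide_right_mono) auto
  also have "\<dots> = \<bar>(fdiff ^^ M) c N\<bar> / h ^ Suc M + cmod (tail w N ((fdiff ^^ Suc M) c)) / h ^ Suc M"
    by (simp add: add_divide_distrib)
  finally show ?case using Suc by simp
qed simp

text \<open>Telescoping: \<open>1 / m ^ 2\<close> is at most
  \<open>2 / m - 2 / (m + 1)\<close>.\<close>

lemma sum_inverse_squares_tail:
  assumes "1 \<le> N"
  shows "summable (\<lambda>n. 1 / (real (n + N))\<^sup>2)" "(\<Sum>n. 1 / (real (n + N))\<^sup>2) \<le> 2 / real N"
proof -
  define t where "t n = 2 / real (n + N) - 2 / real (Suc n + N)" for n
  have "(\<lambda>n. 2 / real (n + N)) \<longlonglongrightarrow> 0"
    by (rule LIMSEQ_ignore_initial_segment[of "\<lambda>n. 2 / real n"]) (rule lim_const_over_n)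
  from telescope_sums'[OF this] have t: "t sums (2 / real N)" by (simp add: t_def[abs_def])
  have le: "1 / (real (n + N))\<^sup>2 \<le> t n" for n
  proof -
    define m where "m = real (n + N)"
    have m: "1 \<le> m" using assms by (simp add: m_def)
    have "m * 1 \<le> m * m" using m by (intro mult_left_mono) auto
    then have "m * (m + 1) \<le> 2 * m\<^sup>2" by (simp add: power2_eq_square algebra_simps)
    then have "2 / (2 * m\<^sup>2) \<le> 2 / (m * (m + 1))" using m by (intro divide_left_mono) auto
    then have "1 / m\<^sup>2 \<le> 2 / (m * (m + 1))" by simp
    also have "\<dots> = 2 / m - 2 / (m + 1)" using m by (simp add: field_simps)
    also have "\<dots> = t n" by (simp add: t_def m_def add_ac)
    finally show ?thesis by (simp add: m_def)
  qed
  show s: "summable (\<lambda>n. 1 / (real (n + N))\<^sup>2)"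
    by (rule summable_comparison_test'[OF sums_summable[OF t], of 0]) (use le in auto)
  have "(\<Sum>n. 1 / (real (n + N))\<^sup>2) \<le> suminf t"
    by (rule suminf_le[OF le s sums_summable[OF t]])
  then show "(\<Sum>n. 1 / (real (n + N))\<^sup>2) \<le> 2 / real N" using sums_unique[OF t] by simp
qed

lemma power_le_fact_exp:
  assumes "0 \<le> (x::real)"
  shows "x ^ j \<le> fact j * exp x"
proof -
  have "(\<Sum>n\<in>{j}. x ^ n /\<^sub>R fact n) \<le> (\<Sum>n. x ^ n /\<^sub>R fact n)"
    by (rule sum_le_suminf[OF summable_exp_generic]) (use assms in auto)
  then have "x ^ j / fact j \<le> exp x" by (simp add: exp_def divide_inverse mult.commute)
  then show ?thesis by (simp add: divide_le_eq mult.commute)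
qed

section \<open>Moments and kernel coefficients under dyadic doubling\<close>

locale dyadic_doubling = radial +
  fixes D :: real
  assumes D1: "1 \<le> D" and W_doubling: "W k \<le> D * W (Suc k)"
begin

lemma W_le: "W k \<le> D ^ j * W (k + j)"
proof (induction j)
  case (Suc j)
  have "D ^ j * W (k + j) \<le> D ^ j * (D * W (Suc (k + j)))"
    using W_doubling D1 by (intro mult_left_mono) auto
  then show ?case using Suc by (simp add: mult_ac)
qed simp

lemma dyadic_index:
  assumes "1 \<le> (n::nat)"
  obtains k where "2 ^ k \<le> n" "n < 2 ^ Suc k"
proof -
  have "\<exists>k. n < 2 ^ Suc k"
    using less_exp[of "Suc n"] by (intro exI[of _ n]) simp
  define k where "k = (LEAST k. n < 2 ^ Suc k)"
  have 1: "n < 2 ^ Suc k" unfolding k_def by (rule LeastI_ex) fact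
  have 2: "2 ^ k \<le> n"
  proof (cases k)
    case (Suc i)
    have "\<not> n < 2 ^ Suc i" by (rule not_less_Least) (use Suc in \<open>simp add: k_def\<close>)
    then show ?thesis using Suc by simp
  qed (use assms in simp)
  show ?thesis using 1 2 that by blast
qed

lemma moment_ge_W:
  assumes "n < 2 ^ Suc k"
  shows "W k \<le> 4 * D ^ 2 * moment \<omega> (2 * real n + 1)"
proof -
  \<comment> \<open>Since \<open>2 * n + 1 \<le> 2 ^ (k + 2)\<close>, the power of this radius is at
    least \<open>1 / 4\<close>; two doublings lead back from level \<open>k + 2\<close> to level
    \<open>k\<close>.\<close>
  define s where "s = (1 - 1 / 2 ^ (k + 2) :: real)"
  have s: "0 < s" "s < 1"
    using one_less_power[of "2::real" "k + 2"] by (auto simp: s_def field_simps simp del: power_Suc power_add)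
  have "real n + 1 \<le> 2 ^ Suc k"
    using assms by (metis Suc_leI of_nat_Suc of_nat_le_iff of_nat_numeral of_nat_power add.commute)
  then have x: "2 * real n + 1 \<le> 2 ^ (k + 2)" by simp
  have "1 / 4 \<le> s ^ (2 ^ (k + 2))"
    unfolding s_def by (rule one_minus_half_power_ge) simp
  also have "\<dots> = s powr (2 ^ (k + 2))"
    using powr_realpow[OF s(1), of "2 ^ (k + 2)"] by simp
  also have "\<dots> \<le> s powr (2 * real n + 1)" using x s by (intro powr_mono') auto
  finally have "1 / 4 * W (k + 2) \<le> s powr (2 * real n + 1) * W (k + 2)"
    using W_pos[of "k + 2"] by (intro mult_right_mono) auto
  also have "\<dots> \<le> moment \<omega> (2 * real n + 1)"
    unfolding W_def s_def[symmetric] by (rule moment_ge) (use s in auto)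
  finally have "W (k + 2) \<le> 4 * moment \<omega> (2 * real n + 1)" by simp
  then have "D ^ 2 * W (k + 2) \<le> D ^ 2 * (4 * moment \<omega> (2 * real n + 1))" by (intro mult_left_mono) auto
  then show ?thesis using W_le[of k 2] by simp
qed

lemma coef_le_W:
  assumes "n < 2 ^ Suc k"
  shows "coef n \<le> 2 * D ^ 2 / W k"
  using moment_ge_W[OF assms] W_pos[of k] moment_pos[of "2 * real n + 1"]
  by (simp add: coef_def field_simps)

text \<open>Induction along the exponents \<open>2 ^ l * 2 ^ k\<close>. By
  \<open>moment_add_le\<close>, doubling the exponent leaves \<open>exp (- (2 ^ l))\<close> times
  the old moment plus \<open>W k\<close>. With \<open>l\<close> so large that
  \<open>D * exp (- (2 ^ l))\<close> is at most one half, this is at most \<open>2 * W k\<close>,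
  and one use of doubling closes the induction with the constant \<open>2 * D\<close>. The shift by
  \<open>l\<close> levels costs \<open>D ^ l\<close>.\<close>

lemma moment_le_W:
  obtains C where "1 \<le> C" "\<And>k x. 2 ^ k \<le> x \<Longrightarrow> moment \<omega> x \<le> C * W k"
proof -
  have m0: "moment \<omega> x \<le> W 0" if "0 \<le> x" for x
  proof -
    have "moment \<omega> x \<le> (LINT r|lborel. indicator {0..} r * wt r)"
      unfolding moment_eq by (rule weighted_integral_mono[where B = 1]) (use that in \<open>auto intro!: powr_le1\<close>)
    then show ?thesis by (simp add: W_def omega_hat_eq)
  qed
  obtain l :: nat where l: "D * exp (- (2 ^ l)) \<le> 1 / 2"
  proof -
    obtain l :: nat where "2 * D < 2 ^ l" using real_arch_pow[of 2 "2 * D"] by auto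
    also have "(2::real) ^ l \<le> exp (2 ^ l)" using exp_ge_add_one_self[of "2 ^ l :: real"] by linarith
    finally have "D * exp (- (2 ^ l)) \<le> 1 / 2" by (simp add: exp_minus field_simps)
    then show ?thesis using that by blast
  qed
  have step: "moment \<omega> (2 ^ l * 2 ^ k) \<le> 2 * D * W k" for k
  proof (induction k)
    case 0
    have "1 * W 0 \<le> 2 * D * W 0" using D1 W_pos[of 0] by (intro mult_right_mono) auto
    then show ?case using m0[of "2 ^ l"] by simp
  next
    case (Suc k)
    define s where "s = (1 - 1 / 2 ^ k :: real)"
    have s: "0 \<le> s" "s < 1" using dyadic_radius[of k] by (auto simp: s_def)
    have "moment \<omega> (2 ^ l * 2 ^ k + 2 ^ l * 2 ^ k) \<le> s powr (2 ^ l * 2 ^ k) * moment \<omega> (2 ^ l * 2 ^ k) + W k"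
      unfolding W_def s_def[symmetric] by (rule moment_add_le) (use s in auto)
    also have "s powr (2 ^ l * 2 ^ k) \<le> exp (- (2 ^ l))"
    proof -
      have "s \<le> exp (- 1 / 2 ^ k)"
        unfolding s_def using exp_ge_add_one_self[of "- 1 / 2 ^ k :: real"] by simp
      then have "s powr (2 ^ l * 2 ^ k) \<le> exp (- 1 / 2 ^ k) powr (2 ^ l * 2 ^ k)"
        using s by (intro powr_mono2) auto
      then show ?thesis by (simp add: exp_powr_real)
    qed
    finally have "moment \<omega> (2 ^ l * 2 ^ Suc k) \<le> exp (- (2 ^ l)) * moment \<omega> (2 ^ l * 2 ^ k) + W k"
      using moment_pos[of "2 ^ l * 2 ^ k"] by (simp add: mult_right_mono algebra_simps)
    also have "\<dots> \<le> exp (- (2 ^ l)) * (2 * D * W k) + W k"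
      using Suc by (intro add_right_mono mult_left_mono) auto
    also have "\<dots> = 2 * (D * exp (- (2 ^ l))) * W k + W k" by simp
    also have "\<dots> \<le> 2 * (1 / 2) * W k + W k"
      using l W_pos[of k] by (intro add_right_mono mult_right_mono mult_left_mono) auto
    also have "\<dots> \<le> 2 * D * W (Suc k)" using W_doubling[of k] by simp
    finally show ?case .
  qed
  have "moment \<omega> x \<le> (2 * D * D ^ l) * W k" if x: "2 ^ k \<le> x" for k x
  proof (cases "l \<le> k")
    case True
    have "moment \<omega> x \<le> moment \<omega> (2 ^ l * 2 ^ (k - l))"
      using x True by (intro moment_antimono) (auto simp: power_add[symmetric])
    also have "\<dots> \<le> 2 * D * W (k - l)" by (rule step)
    also have "\<dots> \<le> 2 * D * (D ^ l * W (k - l + l))" using W_le[of "k - l" l] D1 by (intro mult_left_mono) auto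
    finally show ?thesis using True by simp
  next
    case False
    have "0 \<le> x" using x by (rule order_trans[rotated]) simp
    then have "moment \<omega> x \<le> W 0" by (rule m0)
    also have "\<dots> \<le> D ^ k * W k" using W_le[of 0 k] by simp
    also have "\<dots> \<le> (2 * D * D ^ l) * W k"
    proof (rule mult_right_mono)
      have "D ^ k \<le> D ^ l" using False D1 by (intro power_increasing) auto
      also have "\<dots> \<le> 2 * D * D ^ l" using D1 mult_right_mono[of 1 "2 * D" "D ^ l"] by simp
      finally show "D ^ k \<le> 2 * D * D ^ l" .
    qed (use W_pos[of k] in simp)
    finally show ?thesis .
  qed
  moreover have "1 \<le> 2 * D * D ^ l"
    using D1 one_le_power[OF D1, of l] mult_mono[of 1 "2 * D" 1 "D ^ l"] by simp
  ultimately show ?thesis using that by blast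
qed

lemma moment_doubling:
  obtains C where "1 \<le> C" "\<And>n. 1 \<le> n \<Longrightarrow> moment \<omega> (real n + 1) \<le> C * moment \<omega> (2 * real n + 1)"
proof -
  obtain C where C: "1 \<le> C" "\<And>k x. 2 ^ k \<le> x \<Longrightarrow> moment \<omega> x \<le> C * W k" using moment_le_W by blast
  have "moment \<omega> (real n + 1) \<le> C * (4 * D ^ 2) * moment \<omega> (2 * real n + 1)" if n: "1 \<le> n" for n
  proof -
    obtain k where k: "2 ^ k \<le> n" "n < 2 ^ Suc k" by (rule dyadic_index[OF n])
    have "2 ^ k \<le> real n + 1" using k(1) by (metis add_increasing2 of_nat_le_iff of_nat_numeral of_nat_power zero_le_one)
    then have "moment \<omega> (real n + 1) \<le> C * W k" by (rule C(2))
    also have "\<dots> \<le> C * (4 * D ^ 2 * moment \<omega> (2 * real n + 1))"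
      using moment_ge_W[OF k(2)] C(1) by (intro mult_left_mono) auto
    finally show ?thesis by (simp add: mult.assoc)
  qed
  moreover have "1 \<le> C * (4 * D ^ 2)"
  proof -
    have "1 \<le> 4 * D ^ 2" using one_le_power[OF D1, of 2] by linarith
    then show ?thesis using C(1) mult_mono[of 1 C 1 "4 * D ^ 2"] by simp
  qed
  ultimately show ?thesis using that by blast
qed

text \<open>Raising the exponent \<open>2 * n + 1\<close> by 2 and subtracting multiplies the
  integrand by \<open>r ^ 2 - 1\<close>.\<close>

lemma fdiff_moment:
  "(fdiff ^^ j) (\<lambda>n. moment \<omega> (2 * real n + 1)) n = (LINT r|lborel. ((r\<^sup>2 - 1) ^ j * r ^ (2 * n + 1)) * wt r)"
proof (induction j arbitrary: n)
  case 0
  show ?case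
    unfolding moment_eq funpow_0
  proof (rule Bochner_Integration.integral_cong)
    fix r show "r powr (2 * real n + 1) * wt r = ((r\<^sup>2 - 1) ^ 0 * r ^ (2 * n + 1)) * wt r"
    proof (cases "0 < r")
      case True
      then show ?thesis using powr_realpow[OF True, of "2 * n + 1"] by (simp add: add.commute)
    next
      case False
      then show ?thesis by (cases "r = 0") (auto simp: wt_outside)
    qed
  qed simp
next
  case (Suc j)
  have i: "integrable lborel (\<lambda>r. ((r\<^sup>2 - 1) ^ j * r ^ (2 * m + 1)) * wt r)" for m
  proof (rule weighted_integrable[where B = 1])
    fix r :: real assume "0 \<le> r" "r < 1"
    then show "\<bar>(r\<^sup>2 - 1) ^ j * r ^ (2 * m + 1)\<bar> \<le> 1"
      by (auto simp: abs_mult power_abs abs_le_iff power_le_one intro!: mult_le_one power_le_one)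
  qed simp
  have "(fdiff ^^ Suc j) (\<lambda>n. moment \<omega> (2 * real n + 1)) n =
    (LINT r|lborel. ((r\<^sup>2 - 1) ^ j * r ^ (2 * Suc n + 1)) * wt r) - (LINT r|lborel. ((r\<^sup>2 - 1) ^ j * r ^ (2 * n + 1)) * wt r)"
    by (simp only: funpow.simps o_apply fdiff_def Suc.IH)
  also have "\<dots> = (LINT r|lborel. ((r\<^sup>2 - 1) ^ j * r ^ (2 * Suc n + 1)) * wt r - ((r\<^sup>2 - 1) ^ j * r ^ (2 * n + 1)) * wt r)"
    by (rule Bochner_Integration.integral_diff[symmetric]) (rule i)+
  also have "\<dots> = (LINT r|lborel. ((r\<^sup>2 - 1) ^ Suc j * r ^ (2 * n + 1)) * wt r)"
    by (rule Bochner_Integration.integral_cong) (auto simp: algebra_simps power2_eq_square)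
  finally show ?case .
qed

text \<open>Half of the power of \<open>r\<close> pays for the differences: with
  \<open>y = 1 - r ^ 2\<close> one has \<open>r \<le> exp (- y / 2)\<close>, so
  \<open>(n * y) ^ i * r ^ n\<close> is bounded. The other half leaves the moment at
  \<open>n + 1\<close>, which \<open>moment_doubling\<close> compares with the one at
  \<open>2 * n + 1\<close>.\<close>

lemma symbol_moment: "symbol j (\<lambda>n. moment \<omega> (2 * real n + 1)) (\<lambda>n. moment \<omega> (2 * real n + 1))"
proof -
  obtain C where C: "1 \<le> C" "\<And>n. 1 \<le> n \<Longrightarrow> moment \<omega> (real n + 1) \<le> C * moment \<omega> (2 * real n + 1)"
    using moment_doubling by blast
  define A where "A = 2 ^ j * fact j * C"
  have "\<bar>(fdiff ^^ i) (\<lambda>n. moment \<omega> (2 * real n + 1)) n\<bar> * real n ^ i \<le> A * moment \<omega> (2 * real n + 1)"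
    if i: "i \<le> j" and n: "1 \<le> n" for i n
  proof -
    define F where "F r = (r\<^sup>2 - 1) ^ i * r ^ (2 * n + 1)" for r :: real
    have Fm [measurable]: "F \<in> borel_measurable borel" unfolding F_def by measurable
    have Fb: "\<bar>F r\<bar> * real n ^ i \<le> 2 ^ i * fact i * r ^ (n + 1)" "\<bar>F r\<bar> \<le> 1" if r: "0 \<le> r" "r < 1" for r
    proof -
      define y where "y = 1 - r\<^sup>2"
      have y: "0 \<le> y" "y \<le> 1" using r by (auto simp: y_def power_le_one)
      have aF: "\<bar>F r\<bar> = y ^ i * r ^ (2 * n + 1)"
        using r y by (simp add: F_def abs_mult power_abs y_def abs_minus_commute)
      show "\<bar>F r\<bar> \<le> 1" unfolding aF using r y by (intro mult_le_one power_le_one) auto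
      have "r\<^sup>2 \<le> (exp (- y / 2))\<^sup>2"
        using exp_ge_add_one_self[of "- y"] by (simp add: power2_eq_square exp_add[symmetric] y_def)
      then have "r \<le> exp (- y / 2)" by (rule power2_le_imp_le) simp
      then have "r ^ n \<le> exp (- y / 2) ^ n" using r by (intro power_mono)
      also have "\<dots> = exp (- (real n * y / 2))" by (simp add: exp_of_nat_mult[symmetric])
      finally have rn: "r ^ n \<le> exp (- (real n * y / 2))" .
      have "(real n * y / 2) ^ i * r ^ n \<le> (fact i * exp (real n * y / 2)) * exp (- (real n * y / 2))"
        using rn r y by (intro mult_mono power_le_fact_exp) auto
      also have "\<dots> = fact i" by (simp add: exp_minus)
      finally have "2 ^ i * ((real n * y / 2) ^ i * r ^ n) \<le> 2 ^ i * fact i" by simp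
      then have e: "(real n * y) ^ i * r ^ n \<le> 2 ^ i * fact i" by (simp add: power_divide)
      have "r ^ (2 * n + 1) = r ^ n * r ^ (n + 1)" by (simp add: power_add[symmetric] mult_2)
      then have "\<bar>F r\<bar> * real n ^ i = ((real n * y) ^ i * r ^ n) * r ^ (n + 1)"
        by (simp only: aF power_mult_distrib mult_ac)
      also have "\<dots> \<le> (2 ^ i * fact i) * r ^ (n + 1)" using e r by (intro mult_right_mono) auto
      finally show "\<bar>F r\<bar> * real n ^ i \<le> 2 ^ i * fact i * r ^ (n + 1)" .
    qed
    have "\<bar>(fdiff ^^ i) (\<lambda>n. moment \<omega> (2 * real n + 1)) n\<bar> * real n ^ i = \<bar>LINT r|lborel. F r * wt r\<bar> * real n ^ i"
      by (simp add: fdiff_moment F_def)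
    also have "\<dots> \<le> (LINT r|lborel. \<bar>F r\<bar> * wt r) * real n ^ i"
    proof (rule mult_right_mono)
      have "\<bar>LINT r|lborel. F r * wt r\<bar> \<le> (LINT r|lborel. \<bar>F r * wt r\<bar>)" by (rule integral_abs_bound)
      then show "\<bar>LINT r|lborel. F r * wt r\<bar> \<le> (LINT r|lborel. \<bar>F r\<bar> * wt r)"
        by (simp add: abs_mult wt_nonneg)
    qed simp
    also have "\<dots> = (LINT r|lborel. (\<bar>F r\<bar> * real n ^ i) * wt r)"
      by (simp flip: integral_mult_left_zero) (simp add: mult_ac)
    also have "\<dots> \<le> (LINT r|lborel. (2 ^ i * fact i * r powr (real n + 1)) * wt r)"
    proof (rule weighted_integral_mono[where B = "2 ^ i * fact i"])
      fix r :: real assume r: "0 \<le> r" "r < 1"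
      have "r ^ (n + 1) = r powr (real n + 1)"
        using powr_realpow[of r "n + 1"] r by (cases "r = 0") (auto simp: add.commute)
      moreover have "r powr (real n + 1) \<le> 1" using r by (intro powr_le1) auto
      ultimately show "0 \<le> \<bar>F r\<bar> * real n ^ i \<and> \<bar>F r\<bar> * real n ^ i \<le> 2 ^ i * fact i * r powr (real n + 1)
        \<and> 2 ^ i * fact i * r powr (real n + 1) \<le> 2 ^ i * fact i"
        using Fb(1)[OF r] by (simp add: mult_left_le)
    qed auto
    also have "\<dots> = 2 ^ i * fact i * moment \<omega> (real n + 1)"
      by (simp add: moment_eq mult.assoc)
    also have "\<dots> \<le> 2 ^ j * fact j * (C * moment \<omega> (2 * real n + 1))"
      using i C(2)[OF n] moment_pos[of "real n + 1"]
      by (intro mult_mono power_increasing fact_mono) (auto intro: less_imp_le)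
    finally show ?thesis by (simp add: A_def mult.assoc)
  qed
  moreover have "0 \<le> A" using C(1) by (simp add: A_def)
  ultimately show ?thesis unfolding symbol_def by blast
qed

lemma symbol_coef: "symbol j coef coef"
proof -
  obtain C where C: "1 \<le> C" "\<And>n. 1 \<le> n \<Longrightarrow> moment \<omega> (real n + 1) \<le> C * moment \<omega> (2 * real n + 1)"
    using moment_doubling by blast
  define u where "u n = 2 * moment \<omega> (2 * real n + 1)" for n
  have eq: "coef = (\<lambda>n. 1 / u n)" by (auto simp: coef_def u_def)
  have su: "symbol i u u" for i
  proof -
    obtain A where A: "0 \<le> A" "\<And>i' n. i' \<le> i \<Longrightarrow> 1 \<le> n \<Longrightarrow> \<bar>(fdiff ^^ i') (\<lambda>n. moment \<omega> (2 * real n + 1)) n\<bar> * real n ^ i' \<le> A * moment \<omega> (2 * real n + 1)"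
      using symbol_moment[of i] unfolding symbol_def by blast
    have ue: "u = (\<lambda>n. moment \<omega> (2 * real n + 1) + moment \<omega> (2 * real n + 1))" by (auto simp: u_def)
    have "symbol i (\<lambda>n. moment \<omega> (2 * real n + 1)) u" unfolding ue by (intro symbol_add symbol_moment)
    then show ?thesis by (rule symbol_size_mono[where B = 1]) (auto simp: u_def intro!: less_imp_le moment_pos)
  qed
  have upos: "0 < u n" for n by (auto simp: u_def intro!: moment_pos)
  show ?thesis
    unfolding eq
  proof (rule symbol_inverse[OF su upos C(1)])
    fix n :: nat assume n: "1 \<le> n"
    show "u (Suc n) \<le> u n" by (auto simp: u_def intro!: moment_antimono)
    have "moment \<omega> (2 * real n + 1) \<le> moment \<omega> (real (Suc n) + 1)" using n by (intro moment_antimono) auto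
    also have "\<dots> \<le> C * moment \<omega> (2 * real (Suc n) + 1)" by (rule C(2)) simp
    finally show "u n \<le> C * u (Suc n)" by (simp add: u_def)
  qed
qed

lemma coef_Suc_le:
  obtains C where "1 \<le> C" "\<And>n. 1 \<le> n \<Longrightarrow> coef (Suc n) \<le> C * coef n"
proof -
  obtain C where C: "1 \<le> C" "\<And>n. 1 \<le> n \<Longrightarrow> moment \<omega> (real n + 1) \<le> C * moment \<omega> (2 * real n + 1)"
    using moment_doubling by blast
  have "coef (Suc n) \<le> C * coef n" if n: "1 \<le> n" for n
  proof -
    have "moment \<omega> (2 * real n + 1) \<le> moment \<omega> (real (Suc n) + 1)" using n by (intro moment_antimono) auto
    also have "\<dots> \<le> C * moment \<omega> (2 * real (Suc n) + 1)" by (rule C(2)) simp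
    finally show ?thesis
      using moment_pos[of "2 * real n + 1"] moment_pos[of "2 * real (Suc n) + 1"]
      by (simp add: coef_def divide_le_eq le_divide_eq field_simps)
  qed
  then show ?thesis using C(1) that by blast
qed

end

subsection \<open>Kernel estimates\<close>

context dyadic_doubling begin

text \<open>A dyadic step divides the tail by at most \<open>D \<le> 2 ^ \<gamma>\<close>, so the
  coefficients grow at most like a polynomial of degree \<open>\<gamma>\<close>.\<close>

lemma coef_growth:
  assumes D: "D \<le> 2 ^ \<gamma>" and m: "2 ^ k \<le> m"
  shows "coef m \<le> 2 * D ^ 2 / W k * (real m / 2 ^ k) ^ \<gamma>"
proof -
  have "1 \<le> m" using m by (metis le_trans one_le_numeral one_le_power)
  then obtain i where i: "2 ^ i \<le> m" "m < 2 ^ Suc i" by (rule dyadic_index)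
  have "(2::nat) ^ k < 2 ^ Suc i" using m i(2) by simp
  then have ki: "k \<le> i" by (simp del: power_Suc)
  have "W k \<le> D ^ (i - k) * W i" using W_le[of k "i - k"] ki by simp
  also have "D ^ (i - k) \<le> (2 ^ \<gamma>) ^ (i - k)" using D D1 by (intro power_mono) auto
  also have "\<dots> = (2 ^ i / 2 ^ k) ^ \<gamma>"
  proof -
    have "2 ^ i / 2 ^ k = (2::real) ^ (i - k)" using ki by (simp add: power_diff)
    then show ?thesis by (simp add: power_mult[symmetric] mult.commute)
  qed
  also have "\<dots> \<le> (real m / 2 ^ k) ^ \<gamma>"
  proof (intro power_mono divide_right_mono)
    show "(2::real) ^ i \<le> real m" using i(1) by (metis of_nat_le_iff of_nat_numeral of_nat_power)
  qed auto
  finally have "W k \<le> (real m / 2 ^ k) ^ \<gamma> * W i" using W_pos[of i] by (simp add: mult_right_mono)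
  then have "1 / W i \<le> (real m / 2 ^ k) ^ \<gamma> / W k"
    using W_pos[of i] W_pos[of k] by (simp add: field_simps)
  then have "2 * D ^ 2 * (1 / W i) \<le> 2 * D ^ 2 * ((real m / 2 ^ k) ^ \<gamma> / W k)" by (intro mult_left_mono) auto
  then show ?thesis using coef_le_W[OF i(2)] by simp
qed

text \<open>The head \<open>n < 2 ^ k\<close> is estimated trivially; the tail by enough summations by parts
  to beat the polynomial growth of the coefficients.\<close>

lemma symbol_series_bound:
  fixes c :: "nat \<Rightarrow> real" and e :: nat
  assumes sym: "\<And>j. symbol j (\<lambda>n. real n ^ e * coef n) c"
    and A0: "0 \<le> A0" "\<bar>c 0\<bar> \<le> A0 * coef 1"
    and summ: "\<And>x. 0 \<le> x \<Longrightarrow> x < 1 \<Longrightarrow> summable (\<lambda>n. \<bar>c n\<bar> * x ^ n)"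
  obtains C where "0 \<le> C" "\<And>k w. cmod w < 1 \<Longrightarrow> 1 / 2 ^ k \<le> cmod (1 - w) \<Longrightarrow>
    cmod (\<Sum>n. of_real (c n) * w ^ n) \<le> C * (2 ^ k) ^ (e + 1) / W k"
proof -
  obtain \<gamma> :: nat where "D < 2 ^ \<gamma>" using real_arch_pow[of 2 D] by auto
  then have \<gamma>: "D \<le> 2 ^ \<gamma>" by simp
  \<comment> \<open>The \<open>M\<close>-th differences are of size
    \<open>n ^ (e + \<gamma>) / n ^ M\<close>, that is \<open>1 / n ^ 2\<close>, the first exponent
    that is comfortably summable.\<close>
  define M where "M = e + \<gamma> + 2"
  obtain B where B: "0 \<le> B" "\<And>i n. i \<le> M \<Longrightarrow> 1 \<le> n \<Longrightarrow> \<bar>(fdiff ^^ i) c n\<bar> * real n ^ i \<le> B * (real n ^ e * coef n)"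
    using sym[of M] unfolding symbol_def by blast
  define C where "C = (A0 + (real M + 3) * B) * (2 * D ^ 2)"
  have "cmod (\<Sum>n. of_real (c n) * w ^ n) \<le> C * (2 ^ k) ^ (e + 1) / W k"
    if w: "cmod w < 1" and h: "1 / 2 ^ k \<le> cmod (1 - w)" for k w
  proof -
    define N :: nat where "N = 2 ^ k"
    have N1: "1 \<le> N" by (simp add: N_def)
    have Nr: "real N = 2 ^ k" by (simp add: N_def)
    define Q where "Q = 2 * D ^ 2 / W k"
    have Q0: "0 \<le> Q" using W_pos[of k] by (simp add: Q_def)
    have coefQ: "coef n \<le> Q" if "n \<le> N" for n
      unfolding Q_def by (rule coef_le_W, rule le_less_trans[OF that]) (simp add: N_def)
    have sw: "summable (\<lambda>n. \<bar>c n\<bar> * cmod w ^ n)" using w by (intro summ) auto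
    have sc: "summable (\<lambda>n. of_real (c n) * w ^ n)"
      by (rule summable_norm_cancel) (use sw in \<open>simp add: norm_mult norm_power\<close>)
    have split: "(\<Sum>n. of_real (c n) * w ^ n) = tail w N c + (\<Sum>n<N. of_real (c n) * w ^ n)"
      unfolding tail_def by (rule suminf_split_initial_segment[OF sc])
    have cb: "\<bar>c n\<bar> \<le> (A0 + B) * (real N ^ e * Q)" if n: "n < N" for n
    proof (cases "n = 0")
      case True
      have "\<bar>c 0\<bar> \<le> A0 * Q" using A0 coefQ[OF N1] mult_left_mono[of "coef 1" Q A0] by simp
      also have "\<dots> \<le> A0 * (real N ^ e * Q)"
        using N1 A0 Q0 by (intro mult_left_mono) (auto simp: mult_le_cancel_right1 one_le_power)
      also have "\<dots> \<le> (A0 + B) * (real N ^ e * Q)" using B(1) Q0 by (intro mult_right_mono) auto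
      finally show ?thesis using True by simp
    next
      case False
      have "\<bar>c n\<bar> \<le> B * (real n ^ e * coef n)" using B(2)[of 0 n] False by simp
      also have "\<dots> \<le> B * (real N ^ e * Q)"
        using n coefQ[of n] B(1) by (intro mult_left_mono mult_mono power_mono) auto
      also have "\<dots> \<le> (A0 + B) * (real N ^ e * Q)" using A0(1) Q0 by (intro mult_right_mono) auto
      finally show ?thesis .
    qed
    have "cmod (\<Sum>n<N. of_real (c n) * w ^ n) \<le> (\<Sum>n<N. (A0 + B) * (real N ^ e * Q))"
    proof (rule sum_norm_le)
      fix n assume "n \<in> {..<N}"
      then have "\<bar>c n\<bar> * cmod w ^ n \<le> (A0 + B) * (real N ^ e * Q) * 1"
        using cb[of n] w by (intro mult_mono power_le_one) auto
      then show "norm (of_real (c n) * w ^ n) \<le> (A0 + B) * (real N ^ e * Q)"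
        by (simp add: norm_mult norm_power)
    qed
    then have head: "cmod (\<Sum>n<N. of_real (c n) * w ^ n) \<le> (A0 + B) * (Q * real N ^ (e + 1))"
      by (simp add: mult_ac)
    have "cmod (tail w N c) \<le> (\<Sum>j<M. \<bar>(fdiff ^^ j) c N\<bar> / (1 / 2 ^ k) ^ Suc j) + cmod (tail w N ((fdiff ^^ M) c)) / (1 / 2 ^ k) ^ M"
      by (rule tail_summation_by_parts[OF sw _ _ h]) (use w in auto)
    \<comment> \<open>At \<open>N = 2 ^ k\<close> each boundary term has the size of the head: the
      factor \<open>N ^ j\<close> in the symbol estimate cancels all but one of the
      \<open>j + 1\<close> factors \<open>2 ^ k\<close>.\<close>
    also have "(\<Sum>j<M. \<bar>(fdiff ^^ j) c N\<bar> / (1 / 2 ^ k) ^ Suc j) \<le> (\<Sum>j<M. B * (Q * real N ^ (e + 1)))"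
    proof (rule sum_mono)
      fix j assume j: "j \<in> {..<M}"
      have "\<bar>(fdiff ^^ j) c N\<bar> / (1 / 2 ^ k) ^ Suc j = (\<bar>(fdiff ^^ j) c N\<bar> * real N ^ j) * real N"
        by (simp add: power_one_over Nr)
      also have "\<dots> \<le> (B * (real N ^ e * coef N)) * real N"
        using B(2)[of j N] j N1 by (intro mult_right_mono) auto
      also have "\<dots> \<le> (B * (real N ^ e * Q)) * real N"
        using coefQ[of N] B(1) by (intro mult_right_mono mult_left_mono) auto
      finally show "\<bar>(fdiff ^^ j) c N\<bar> / (1 / 2 ^ k) ^ Suc j \<le> B * (Q * real N ^ (e + 1))" by (simp add: mult_ac)
    qed
    also have "(\<Sum>j<M. B * (Q * real N ^ (e + 1))) = real M * B * (Q * real N ^ (e + 1))" by simp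
    also have "cmod (tail w N ((fdiff ^^ M) c)) / (1 / 2 ^ k) ^ M \<le> 2 * B * (Q * real N ^ (e + 1))"
    proof -
      have term_le: "norm (of_real ((fdiff ^^ M) c (n + N)) * w ^ (n + N)) \<le> (B * Q / real N ^ \<gamma>) * (1 / (real (n + N))\<^sup>2)" for n
      proof -
        define m where "m = n + N"
        have m: "1 \<le> m" using N1 by (simp add: m_def)
        have m2: "2 ^ k \<le> m" by (simp add: m_def N_def)
        have m0: "0 < real m" using m by simp
        have "\<bar>(fdiff ^^ M) c m\<bar> * real m ^ M \<le> B * (real m ^ e * coef m)" by (rule B(2)) (use m in auto)
        also have "\<dots> \<le> B * (real m ^ e * (Q * (real m / real N) ^ \<gamma>))"
          using coef_growth[OF \<gamma> m2] B(1) unfolding Q_def[symmetric] Nr[symmetric] by (intro mult_left_mono) auto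
        also have "\<dots> = (B * Q / real N ^ \<gamma>) * (1 / (real m)\<^sup>2) * real m ^ M"
          using m0 by (simp add: M_def power_add power_divide power2_eq_square)
        finally have "\<bar>(fdiff ^^ M) c m\<bar> \<le> (B * Q / real N ^ \<gamma>) * (1 / (real m)\<^sup>2)"
          by (rule mult_right_le_imp_le) (use m0 in simp)
        moreover have "\<bar>(fdiff ^^ M) c m\<bar> * cmod w ^ m \<le> \<bar>(fdiff ^^ M) c m\<bar>"
          using w by (intro mult_left_le power_le_one) auto
        ultimately show ?thesis unfolding m_def[symmetric] by (simp add: norm_mult norm_power)
      qed
      note sq = sum_inverse_squares_tail[OF N1]
      have "cmod (tail w N ((fdiff ^^ M) c)) \<le> (\<Sum>n. norm (of_real ((fdiff ^^ M) c (n + N)) * w ^ (n + N)))"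
        unfolding tail_def by (rule summable_norm[OF tail_summable[OF summable_fdiff_funpow[OF sw]]]) simp
      also have "\<dots> \<le> (\<Sum>n. (B * Q / real N ^ \<gamma>) * (1 / (real (n + N))\<^sup>2))"
        by (rule suminf_le[OF term_le tail_summable[OF summable_fdiff_funpow[OF sw]] summable_mult[OF sq(1)]]) simp
      also have "\<dots> = (B * Q / real N ^ \<gamma>) * (\<Sum>n. 1 / (real (n + N))\<^sup>2)"
        by (rule suminf_mult[OF sq(1)])
      also have "\<dots> \<le> (B * Q / real N ^ \<gamma>) * (2 / real N)"
        using sq(2) B(1) Q0 by (intro mult_left_mono) auto
      finally have "cmod (tail w N ((fdiff ^^ M) c)) * real N ^ M \<le> (B * Q / real N ^ \<gamma>) * (2 / real N) * real N ^ M"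
        by (intro mult_right_mono) auto
      also have "\<dots> = 2 * B * (Q * real N ^ (e + 1))"
        using N1 by (simp add: M_def power_add power2_eq_square)
      finally show ?thesis by (simp add: power_one_over Nr)
    qed
    finally have tl: "cmod (tail w N c) \<le> real M * B * (Q * real N ^ (e + 1)) + 2 * B * (Q * real N ^ (e + 1))" by simp
    have "cmod (\<Sum>n. of_real (c n) * w ^ n) \<le> cmod (tail w N c) + cmod (\<Sum>n<N. of_real (c n) * w ^ n)"
      unfolding split by (rule norm_triangle_ineq)
    also have "\<dots> \<le> (A0 + (real M + 3) * B) * (Q * real N ^ (e + 1))"
      using tl head by (simp add: algebra_simps)
    also have "\<dots> = C * (2 ^ k) ^ (e + 1) / W k" unfolding C_def Q_def Nr by simp
    finally show ?thesis .
  qed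
  moreover have "0 \<le> C" using A0(1) B(1) by (simp add: C_def)
  ultimately show ?thesis using that by blast
qed

text \<open>The series bound with \<open>e = 0\<close> on the positive axis, where
  \<open>1 - w\<close> is exactly \<open>1 / 2 ^ k\<close>.\<close>

lemma Kr_bound:
  obtains C where "0 \<le> C" "\<And>k. Kr (1 - 1 / 2 ^ k) \<le> C * 2 ^ k / W k"
proof -
  have sym: "symbol j (\<lambda>n. real n ^ 0 * coef n) coef" for j using symbol_coef by simp
  have c0: "\<bar>coef 0\<bar> \<le> 1 * coef 1" using coef_mono[of 0 1] by simp
  obtain C where C: "0 \<le> C" "\<And>k w. cmod w < 1 \<Longrightarrow> 1 / 2 ^ k \<le> cmod (1 - w) \<Longrightarrow>
    cmod (\<Sum>n. of_real (coef n) * w ^ n) \<le> C * (2 ^ k) ^ (0 + 1) / W k"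
    by (rule symbol_series_bound[OF sym _ c0]) (use summable_coef in auto)
  have "Kr (1 - 1 / 2 ^ k) \<le> C * 2 ^ k / W k" for k
  proof -
    define \<rho> where "\<rho> = (1 - 1 / 2 ^ k :: real)"
    have \<rho>: "0 \<le> \<rho>" "\<rho> < 1" "1 - \<rho> = 1 / 2 ^ k" using dyadic_radius[of k] by (auto simp: \<rho>_def)
    have "(\<Sum>n. of_real (coef n) * of_real \<rho> ^ n) = complex_of_real (Kr \<rho>)"
      unfolding Kr_def using suminf_of_real[OF summable_coef[OF \<rho>(1,2)], where 'a = complex] by simp
    moreover have "cmod (\<Sum>n. of_real (coef n) * of_real \<rho> ^ n) \<le> C * (2 ^ k) ^ (0 + 1) / W k"
    proof (rule C(2))
      have "cmod (1 - of_real \<rho>) = \<bar>1 - \<rho>\<bar>" by (metis norm_of_real of_real_1 of_real_diff)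
      then show "1 / 2 ^ k \<le> cmod (1 - of_real \<rho>)" using \<rho> by simp
    qed (use \<rho> in simp)
    ultimately show ?thesis using Kr_nonneg[OF \<rho>(1,2)] by (simp add: \<rho>_def)
  qed
  then show ?thesis using C(1) that by blast
qed

definition K' :: "complex \<Rightarrow> complex" where
  "K' w = (\<Sum>n. of_real ((real n + 1) * coef (Suc n)) * w ^ n)"

lemma K_has_field_derivative:
  assumes "cmod w < 1"
  shows "(K has_field_derivative K' w) (at w)"
proof -
  define r where "r = complex_of_real ((1 + cmod w) / 2)"
  have r: "cmod r = (1 + cmod w) / 2" unfolding r_def norm_of_real by simp
  have s: "summable (\<lambda>n. of_real (coef n) * r ^ n)"
    by (rule summable_norm_cancel[OF K_summable]) (use r assms in simp)
  have "DERIV (\<lambda>w. \<Sum>n. of_real (coef n) * w ^ n) w :> (\<Sum>n. diffs (\<lambda>n. of_real (coef n)) n * w ^ n)"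
    by (rule termdiffs_strong[OF s]) (use r assms in simp)
  moreover have "(\<Sum>n. diffs (\<lambda>n. of_real (coef n)) n * w ^ n) = K' w"
    unfolding K'_def diffs_def by (intro suminf_cong) (simp add: add.commute)
  ultimately show ?thesis unfolding K_def[abs_def] by simp
qed

text \<open>The coefficients of the derivative are symbols of size \<open>n * coef n\<close>, so the
  series bound applies with \<open>e = 1\<close>; \<open>4 ^ k\<close> is the square of
  \<open>2 ^ k\<close>.\<close>

lemma K'_bound:
  obtains C where "0 \<le> C" "\<And>k w. cmod w < 1 \<Longrightarrow> 1 / 2 ^ k \<le> cmod (1 - w) \<Longrightarrow> cmod (K' w) \<le> C * 4 ^ k / W k"
proof -
  define c where "c n = (real n + 1) * coef (Suc n)" for n
  obtain B where B: "1 \<le> B" "\<And>n. 1 \<le> n \<Longrightarrow> coef (Suc n) \<le> B * coef n"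
    using coef_Suc_le by blast
  have B0: "0 \<le> B" using B by simp
  have sym: "symbol j (\<lambda>n. real n ^ 1 * coef n) c" for j
  proof -
    have "symbol j (\<lambda>n. real n * coef n) (\<lambda>n. (real n + 1) * coef (Suc n))"
      by (rule symbol_mult[OF symbol_of_nat_Suc symbol_shift[OF symbol_coef B0 B(2)], where B = 2]) auto
    then show ?thesis by (simp add: c_def[abs_def])
  qed
  have summ: "summable (\<lambda>n. \<bar>c n\<bar> * x ^ n)" if x: "0 \<le> x" "x < 1" for x
  proof -
    have "summable (\<lambda>n. diffs coef n * x ^ n)"
    proof (rule termdiff_converges[where K = 1])
      fix y :: real assume "norm y < 1"
      then show "summable (\<lambda>n. coef n * y ^ n)"
        using summable_coef[of "\<bar>y\<bar>"]
        by (intro summable_norm_cancel[of "\<lambda>n. coef n * y ^ n"]) (simp add: abs_mult power_abs)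
    qed (use x in simp)
    moreover have "diffs coef n = \<bar>c n\<bar>" for n
      by (simp add: diffs_def c_def abs_mult add.commute)
    ultimately show ?thesis by simp
  qed
  have c0: "\<bar>c 0\<bar> \<le> 1 * coef 1" by (simp add: c_def)
  obtain C where C: "0 \<le> C" "\<And>k w. cmod w < 1 \<Longrightarrow> 1 / 2 ^ k \<le> cmod (1 - w) \<Longrightarrow>
    cmod (\<Sum>n. of_real (c n) * w ^ n) \<le> C * (2 ^ k) ^ (1 + 1) / W k"
    by (rule symbol_series_bound[OF sym _ c0 summ]) auto
  have "cmod (K' w) \<le> C * 4 ^ k / W k" if "cmod w < 1" "1 / 2 ^ k \<le> cmod (1 - w)" for k w
  proof -
    have "(2 ^ k) ^ (1 + 1) = (4 :: real) ^ k" by (simp add: power_mult_distrib[symmetric])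
    then show ?thesis using C(2)[OF that] by (simp add: K'_def c_def)
  qed
  then show ?thesis using C(1) that by blast
qed

end

subsection \<open>Dyadic tents\<close>

text \<open>The discontinuities lie on the closed nonnegative axis, where the value is 0.\<close>

lemma Arg2pi_measurable [measurable]: "Arg2pi \<in> borel_measurable borel"
proof -
  have "(\<lambda>z. if z \<in> \<real>\<^sub>\<ge>\<^sub>0 then 0 else Arg2pi z) \<in> borel_measurable borel"
  proof (rule borel_measurable_continuous_on_if)
    show "continuous_on (- \<real>\<^sub>\<ge>\<^sub>0) Arg2pi"
      by (rule continuous_at_imp_continuous_on) (auto intro: continuous_at_Arg2pi)
  qed (auto intro: borel_closed closed_nonneg_Reals_complex)
  moreover have "(\<lambda>z. if z \<in> \<real>\<^sub>\<ge>\<^sub>0 then 0 else Arg2pi z) = Arg2pi"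
    by (auto simp: fun_eq_iff Arg2pi_eq_0 complex_nonneg_Reals_iff complex_is_Real_iff)
  ultimately show ?thesis by simp
qed

text \<open>The argument is measured in full turns, so that dyadic arcs become dyadic intervals of
  \<open>[0, 1)\<close>.\<close>

definition angle :: "complex \<Rightarrow> real" where
  "angle z = Arg2pi z / (2 * pi)"

lemma angle_ge_0: "0 \<le> angle z" and angle_lt_1: "angle z < 1"
  using Arg2pi[of z] by (auto simp: angle_def)

lemma angle_eq: "z = of_real (cmod z) * cis (2 * pi * angle z)"
  using Arg2pi_eq[of z] by (simp add: angle_def cis_conv_exp)

lemma angle_unique: "z = of_real (cmod z) * cis (2 * pi * \<theta>) \<Longrightarrow> z \<noteq> 0 \<Longrightarrow> 0 \<le> \<theta> \<Longrightarrow> \<theta> < 1 \<Longrightarrow> angle z = \<theta>"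
  using Arg2pi_unique[of "cmod z" "2 * pi * \<theta>" z] by (simp add: angle_def cis_conv_exp)

definition idx :: "nat \<Rightarrow> complex \<Rightarrow> nat" where
  "idx k z = nat \<lfloor>2 ^ k * angle z\<rfloor>"

lemma idx_less: "idx k z < 2 ^ k"
proof -
  have "2 ^ k * angle z < 2 ^ k" using angle_lt_1[of z] by simp
  then have "\<lfloor>2 ^ k * angle z\<rfloor> < 2 ^ k" by (simp add: floor_less_iff)
  then show ?thesis unfolding idx_def by (simp add: nat_less_iff)
qed

lemma idx_eq_iff: "idx k z = i \<longleftrightarrow> real i \<le> 2 ^ k * angle z \<and> 2 ^ k * angle z < real i + 1"
proof -
  have "0 \<le> 2 ^ k * angle z" using angle_ge_0[of z] by simp
  then show ?thesis unfolding idx_def by (simp add: nat_eq_iff floor_eq_iff)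
qed

lemma idx_div:
  assumes "l \<le> k"
  shows "idx l z = idx k z div 2 ^ (k - l)"
proof -
  have "2 ^ l * angle z = 2 ^ k * angle z / real_of_int (2 ^ (k - l))"
    using assms by (simp add: power_diff[of "2::real"])
  then have "\<lfloor>2 ^ l * angle z\<rfloor> = \<lfloor>2 ^ k * angle z\<rfloor> div 2 ^ (k - l)"
    by (simp only: floor_divide_real_eq_div zero_le_power zero_le_numeral)
  then show ?thesis
    unfolding idx_def using angle_ge_0[of z] by (simp add: nat_div_distrib nat_power_eq)
qed

lemma idx_measurable [measurable]: "idx k \<in> measurable borel (count_space UNIV)"
  unfolding idx_def[abs_def] angle_def[abs_def] by measurable

text \<open>The bound on \<open>i\<close> ensures that rotating the arc of index 0 does not wrap
  around past a full turn.\<close>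

lemma idx_rotate:
  assumes z: "z \<noteq> 0" and i: "i < 2 ^ k"
  shows "idx k (cis (2 * pi * (real i / 2 ^ k)) * z) = i \<longleftrightarrow> idx k z = 0"
proof
  define c where "c = cis (2 * pi * (real i / 2 ^ k))"
  have c: "cmod c = 1" by (simp add: c_def)
  assume "idx k z = 0"
  then have a: "2 ^ k * angle z < 1" by (simp add: idx_eq_iff)
  have "angle (c * z) = angle z + real i / 2 ^ k"
  proof (rule angle_unique)
    have "c * z = c * (of_real (cmod z) * cis (2 * pi * angle z))" using angle_eq[of z] by simp
    also have "\<dots> = of_real (cmod (c * z)) * cis (2 * pi * (angle z + real i / 2 ^ k))"
      by (simp add: c_def norm_mult cis_mult[symmetric] distrib_left)
    finally show "c * z = of_real (cmod (c * z)) * cis (2 * pi * (angle z + real i / 2 ^ k))" .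
    have "real i + 1 \<le> 2 ^ k" using i by (metis Suc_leI of_nat_Suc of_nat_le_iff of_nat_numeral of_nat_power add.commute)
    then show "angle z + real i / 2 ^ k < 1" using a by (simp add: field_simps)
  qed (use z angle_ge_0[of z] in \<open>auto simp: c_def\<close>)
  then show "idx k (c * z) = i" using a angle_ge_0[of z] by (simp add: idx_eq_iff distrib_left)
next
  define c where "c = cis (2 * pi * (real i / 2 ^ k))"
  assume "idx k (c * z) = i"
  then have a: "real i \<le> 2 ^ k * angle (c * z)" "2 ^ k * angle (c * z) < real i + 1" by (auto simp: idx_eq_iff)
  have "angle z = angle (c * z) - real i / 2 ^ k"
  proof (rule angle_unique)
    have "c * z = of_real (cmod z) * cis (2 * pi * angle (c * z))"
      using angle_eq[of "c * z"] by (simp add: norm_mult c_def)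
    then have "cnj c * (c * z) = cnj c * (of_real (cmod z) * cis (2 * pi * angle (c * z)))" by simp
    moreover have "cnj c * (c * z) = z"
      by (simp add: c_def cis_cnj cis_mult mult.assoc[symmetric])
    moreover have "cnj c * (of_real (cmod z) * cis (2 * pi * angle (c * z))) = of_real (cmod z) * cis (2 * pi * (angle (c * z) - real i / 2 ^ k))"
      by (simp add: c_def cis_cnj cis_mult right_diff_distrib)
    ultimately show "z = of_real (cmod z) * cis (2 * pi * (angle (c * z) - real i / 2 ^ k))" by simp
    show "0 \<le> angle (c * z) - real i / 2 ^ k" using a by (simp add: field_simps)
    have "0 \<le> real i / 2 ^ k" by simp
    then show "angle (c * z) - real i / 2 ^ k < 1" using angle_lt_1[of "c * z"] by linarith
  qed (rule z)
  then show "idx k z = 0" using a by (simp add: idx_eq_iff right_diff_distrib)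
qed

lemma dist_cis_le: "cmod (cis x - cis y) \<le> \<bar>x - y\<bar>"
proof -
  have "cis x - cis y = cis y * (cis (x - y) - 1)" by (simp add: right_diff_distrib cis_mult)
  then have "cmod (cis x - cis y) = cmod (exp (\<i> * of_real (x - y)) - 1)" by (simp add: norm_mult cis_conv_exp)
  also have "\<dots> = 2 * \<bar>sin ((x - y) / 2)\<bar>" by (rule dist_exp_i_1)
  also have "\<dots> \<le> 2 * \<bar>(x - y) / 2\<bar>" by (intro mult_left_mono abs_sin_x_le_abs_x) simp
  finally show ?thesis by simp
qed

text \<open>An even \<open>m\<close> belongs to the previous level. For odd \<open>m\<close> the
  root \<open>b\<close> satisfies \<open>b ^ (2 ^ k) = - 1\<close>, and
  \<open>2 = cmod (b ^ (2 ^ k) - 1)\<close> is at most \<open>2 ^ k * cmod (b - 1)\<close>.\<close>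

lemma root_of_unity_chord:
  assumes "1 \<le> m" "m < 2 ^ k"
  shows "4 / 2 ^ k \<le> cmod (cis (2 * pi * (real m / 2 ^ k)) - 1)"
  using assms
proof (induction k arbitrary: m)
  case (Suc k)
  show ?case
  proof (cases "even m")
    case True
    then obtain m' where m': "m = 2 * m'" by blast
    have "4 / 2 ^ k \<le> cmod (cis (2 * pi * (real m' / 2 ^ k)) - 1)" by (rule Suc.IH) (use Suc.prems m' in auto)
    moreover have "real m' / 2 ^ k = real m / 2 ^ Suc k" by (simp add: m')
    moreover have "(4::real) / 2 ^ Suc k \<le> 4 / 2 ^ k" by (intro divide_left_mono) auto
    ultimately show ?thesis by simp
  next
    case False
    define b where "b = cis (2 * pi * (real m / 2 ^ Suc k))"
    have "b ^ (2 ^ k) = cis (real (2 ^ k) * (2 * pi * (real m / 2 ^ Suc k)))"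
      unfolding b_def by (rule Complex.DeMoivre)
    also have "real (2 ^ k) * (2 * pi * (real m / 2 ^ Suc k)) = real m * pi" by simp
    also have "cis (real m * pi) = cis pi ^ m" by (rule Complex.DeMoivre[symmetric])
    also have "\<dots> = - 1" using False by simp
    finally have "2 = cmod (b ^ (2 ^ k) - 1 ^ (2 ^ k))" by simp
    also have "\<dots> \<le> real (2 ^ k) * cmod (b - 1)" by (rule norm_power_diff) (auto simp: b_def)
    finally show ?thesis unfolding b_def by (simp add: field_simps)
  qed
qed simp

section \<open>Dyadic Carleson boxes and their measures\<close>

context radial begin

text \<open>The Carleson box over a dyadic arc, reaching the boundary, with height and angular
  fraction both \<open>1 / 2 ^ k\<close>. At level 0 it is the whole disk.\<close>

definition tent :: "nat \<Rightarrow> nat \<Rightarrow> complex set" where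
  "tent k i = {z \<in> unit_disk. 1 - 1 / 2 ^ k \<le> cmod z \<and> idx k z = i}"

lemma tent_subset: "tent k i \<subseteq> unit_disk" by (auto simp: tent_def)

lemma tent_borel [measurable]: "tent k i \<in> sets borel"
proof -
  have "{z \<in> space borel. cmod z < 1 \<and> 1 - 1 / 2 ^ k \<le> cmod z \<and> idx k z = i} \<in> sets borel" by measurable
  then show ?thesis by (simp add: tent_def)
qed

lemma borel_disk_sets_mu: "A \<in> sets borel \<Longrightarrow> A \<subseteq> unit_disk \<Longrightarrow> A \<in> sets \<mu>"
  using measurable_sets[OF id_measurable_mu, of A] by (simp add: Int_absorb2)

lemma tent_sets [measurable]: "tent k i \<in> sets \<mu>"
  by (rule borel_disk_sets_mu[OF tent_borel tent_subset])

text \<open>The tents of one level are rotations of each other and partition an annulus.\<close>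

lemma measure_tent_eq:
  assumes i: "i < 2 ^ k"
  shows "measure \<mu> (tent k i) = measure \<mu> {z \<in> unit_disk. 1 - 1 / 2 ^ k \<le> cmod z} / 2 ^ k"
proof -
  have rot: "measure \<mu> (tent k i) = measure \<mu> (tent k 0)" if i: "i < 2 ^ k" for i
  \<comment> \<open>The origin, which \<open>idx_rotate\<close> excludes, belongs to the tent of
    level 0 only.\<close>
  proof (cases "k = 0")
    case False
    define c where "c = cis (2 * pi * (real i / 2 ^ k))"
    have c: "cmod c = 1" by (simp add: c_def)
    have "{z. c * z \<in> tent k i} = tent k 0"
    proof (intro set_eqI)
      fix z show "z \<in> {z. c * z \<in> tent k i} \<longleftrightarrow> z \<in> tent k 0"
      proof (cases "z = 0")
        case True
        have "1 / 2 ^ k < (1::real)" using \<open>k \<noteq> 0\<close> by (simp add: divide_less_eq)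
        then have "\<not> (1 - 1 / 2 ^ k \<le> (0::real))" by linarith
        then show ?thesis using True by (auto simp: tent_def)
      next
        case False
        then show ?thesis using idx_rotate[OF False i] c by (simp add: tent_def norm_mult c_def)
      qed
    qed
    then show ?thesis using measure_mu_rotate[OF tent_borel c tent_subset, of k i] by simp
  qed (use i in simp)
  have dj: "disjoint_family_on (tent k) {..<2 ^ k}"
    by (auto simp: disjoint_family_on_def tent_def)
  have "{z \<in> unit_disk. 1 - 1 / 2 ^ k \<le> cmod z} = (\<Union>i\<in>{..<2 ^ k}. tent k i)" (is "_ = ?U")
    using idx_less by (auto simp: tent_def)
  then have U: "measure \<mu> {z \<in> unit_disk. 1 - 1 / 2 ^ k \<le> cmod z} = measure \<mu> ?U" by (simp only:)
  have "measure \<mu> {z \<in> unit_disk. 1 - 1 / 2 ^ k \<le> cmod z} = (\<Sum>i\<in>{..<2 ^ k}. measure \<mu> (tent k i))"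
  proof -
    have "tent k ` {..<2 ^ k} \<subseteq> sets \<mu>" by (rule image_subsetI) (rule tent_sets)
    from mu.finite_measure_finite_Union[OF _ this dj] U show ?thesis by simp
  qed
  also have "\<dots> = (\<Sum>i\<in>{..<(2::nat) ^ k}. measure \<mu> (tent k 0))"
    by (rule sum.cong[OF refl]) (rule rot, simp only: lessThan_iff)
  finally show ?thesis using rot[OF i] by simp
qed

lemma measure_tent_le: "i < 2 ^ k \<Longrightarrow> measure \<mu> (tent k i) \<le> 2 * W k / 2 ^ k"
  using measure_annulus_le[OF dyadic_radius(1)[of k]]
  by (simp add: measure_tent_eq W_def divide_right_mono)

lemma measure_disk_le: "measure \<mu> unit_disk \<le> 2 * W 0"
proof -
  have "unit_disk = {z. cmod z < 1}" by auto
  then show ?thesis using measure_tent_eq[of 0 0] measure_tent_le[of 0 0] by simp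
qed

text \<open>The \<open>2 ^ (k + 1)\<close> rotated copies of the neighbourhood are disjoint subsets of an annulus.\<close>

lemma measure_near_boundary:
  assumes a: "cmod a = 1"
  shows "measure \<mu> {z \<in> unit_disk. cmod (z - a) < 1 / 2 ^ k} \<le> W k / 2 ^ k"
proof -
  define S where "S b = {z \<in> unit_disk. cmod (z - b) < 1 / 2 ^ k}" for b
  have Sb: "S b \<in> sets borel" "S b \<subseteq> unit_disk" for b
  proof -
    have "{z \<in> space borel. cmod z < 1 \<and> cmod (z - b) < 1 / 2 ^ k} \<in> sets borel" by measurable
    then show "S b \<in> sets borel" by (simp add: S_def)
  qed (auto simp: S_def)
  define c where "c d = cis (2 * pi * (real d / 2 ^ Suc k))" for d :: nat
  have c1: "cmod (c d) = 1" for d by (simp add: c_def)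
  have eq: "measure \<mu> (S (c d * a)) = measure \<mu> (S a)" for d
  proof -
    have "{z. c d * z \<in> S (c d * a)} = S a"
    proof (intro set_eqI)
      fix z
      have "cmod (c d * z - c d * a) = cmod (z - a)"
        by (simp add: right_diff_distrib[symmetric] norm_mult c1)
      then show "z \<in> {z. c d * z \<in> S (c d * a)} \<longleftrightarrow> z \<in> S a" by (simp add: S_def norm_mult c1)
    qed
    then show ?thesis using measure_mu_rotate[OF Sb(1) c1 Sb(2), of d "c d * a"] by simp
  qed
  have disj: "S (c d * a) \<inter> S (c e * a) = {}" if de: "d < e" "e < 2 ^ Suc k" for d e
  proof (rule ccontr)
    assume "S (c d * a) \<inter> S (c e * a) \<noteq> {}"
    then obtain z where z: "cmod (z - c d * a) < 1 / 2 ^ k" "cmod (z - c e * a) < 1 / 2 ^ k" by (auto simp: S_def)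
    have "c e = c d * c (e - d)"
      using de by (simp add: c_def cis_mult of_nat_diff diff_divide_distrib right_diff_distrib)
    then have "c e * a - c d * a = (c d * a) * (c (e - d) - 1)" by (simp add: algebra_simps)
    then have "cmod (c e * a - c d * a) = cmod (c (e - d) - 1)" by (simp add: norm_mult c1 a)
    also have "4 / 2 ^ Suc k \<le> \<dots>" unfolding c_def by (rule root_of_unity_chord) (use de in auto)
    finally have "2 / 2 ^ k \<le> cmod (c e * a - c d * a)" by simp
    also have "\<dots> \<le> cmod (z - c d * a) + cmod (z - c e * a)"
      using norm_triangle_ineq4[of "z - c d * a" "z - c e * a"] by simp
    also have "\<dots> < 1 / 2 ^ k + 1 / 2 ^ k" using z by (rule add_strict_mono)
    finally show False by simp
  qed
  have dj: "disjoint_family_on (\<lambda>d. S (c d * a)) {..<2 ^ Suc k}"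
    unfolding disjoint_family_on_def
  proof (intro ballI impI)
    fix d e :: nat assume "d \<in> {..<2 ^ Suc k}" "e \<in> {..<2 ^ Suc k}" "d \<noteq> e"
    then show "S (c d * a) \<inter> S (c e * a) = {}"
      using disj[of d e] disj[of e d] by (cases "d < e") (auto simp: Int_commute)
  qed
  have sets: "S b \<in> sets \<mu>" for b by (rule borel_disk_sets_mu[OF Sb])
  have "2 ^ Suc k * measure \<mu> (S a) = (\<Sum>d\<in>{..<(2::nat) ^ Suc k}. measure \<mu> (S (c d * a)))"
    by (simp add: eq)
  also have "\<dots> = measure \<mu> (\<Union>d\<in>{..<2 ^ Suc k}. S (c d * a))"
    by (rule mu.finite_measure_finite_Union[symmetric]) (use sets dj in auto)
  also have "\<dots> \<le> measure \<mu> {z \<in> unit_disk. 1 - 1 / 2 ^ k \<le> cmod z}"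
  proof (rule mu.finite_measure_mono)
    show "(\<Union>d\<in>{..<2 ^ Suc k}. S (c d * a)) \<subseteq> {z \<in> unit_disk. 1 - 1 / 2 ^ k \<le> cmod z}"
    proof safe
      fix z d assume "z \<in> S (c d * a)"
      then have z: "z \<in> unit_disk" "cmod (z - c d * a) < 1 / 2 ^ k" by (auto simp: S_def)
      show "z \<in> unit_disk" by fact
      have "1 = cmod (c d * a)" by (simp add: norm_mult c1 a)
      also have "\<dots> \<le> cmod z + cmod (z - c d * a)" by (metis norm_minus_commute norm_triangle_sub)
      finally show "1 - 1 / 2 ^ k \<le> cmod z" using z(2) by simp
    qed
    have "{z \<in> space borel. cmod z < 1 \<and> 1 - 1 / 2 ^ k \<le> cmod z} \<in> sets borel" by measurable
    then show "{z \<in> unit_disk. 1 - 1 / 2 ^ k \<le> cmod z} \<in> sets \<mu>"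
      by (intro borel_disk_sets_mu) auto
  qed
  also have "\<dots> \<le> 2 * W k" unfolding W_def by (rule measure_annulus_le[OF dyadic_radius(1)])
  finally show ?thesis by (simp add: S_def field_simps)
qed

text \<open>An endpoint of the arc below the tent; the kernel is frozen there. For \<open>a\<close>
  on the circle, \<open>cmod (1 - cnj z * a) = cmod (z - a)\<close>, so the pseudo-distance becomes
  Euclidean.\<close>

definition vertex :: "nat \<Rightarrow> nat \<Rightarrow> complex" where
  "vertex k i = cis (2 * pi * (real i / 2 ^ k))"

lemma norm_vertex [simp]: "cmod (vertex k i) = 1" by (simp add: vertex_def)

lemma dist_vertex_le:
  assumes "z \<in> tent k i"
  shows "cmod (z - vertex k i) \<le> 8 / 2 ^ k"
proof -
  have z: "cmod z < 1" "1 - cmod z \<le> 1 / 2 ^ k" "real i \<le> 2 ^ k * angle z" "2 ^ k * angle z < real i + 1"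
    using assms by (auto simp: tent_def idx_eq_iff)
  have "z - vertex k i = (of_real (cmod z) - 1) * cis (2 * pi * angle z) + (cis (2 * pi * angle z) - vertex k i)"
    using angle_eq[of z] by (simp add: algebra_simps)
  then have "cmod (z - vertex k i) \<le> cmod ((of_real (cmod z) - 1) * cis (2 * pi * angle z)) + cmod (cis (2 * pi * angle z) - vertex k i)"
    by (metis norm_triangle_ineq)
  also have "cmod ((of_real (cmod z) - 1) * cis (2 * pi * angle z)) = 1 - cmod z"
  proof -
    have "cmod (complex_of_real (cmod z) - 1) = \<bar>cmod z - 1\<bar>" by (metis norm_of_real of_real_1 of_real_diff)
    then show ?thesis using z(1) by (simp add: norm_mult)
  qed
  also have "1 - cmod z \<le> 1 / 2 ^ k" by (rule z(2))
  also have "cmod (cis (2 * pi * angle z) - vertex k i) \<le> \<bar>2 * pi * angle z - 2 * pi * (real i / 2 ^ k)\<bar>"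
    unfolding vertex_def by (rule dist_cis_le)
  also have "\<dots> = 2 * pi * \<bar>angle z - real i / 2 ^ k\<bar>"
    by (subst right_diff_distrib[symmetric]) (simp add: abs_mult)
  also have "\<dots> \<le> 2 * pi * (1 / 2 ^ k)"
  proof (rule mult_left_mono)
    have "real i / 2 ^ k \<le> angle z" using z(3) by (simp add: divide_le_eq mult.commute)
    moreover have "angle z \<le> (real i + 1) / 2 ^ k" using z(4) by (simp add: le_divide_eq mult.commute)
    ultimately show "\<bar>angle z - real i / 2 ^ k\<bar> \<le> 1 / 2 ^ k" by (simp add: add_divide_distrib)
  qed simp
  \<comment> \<open>As \<open>2 * pi \<le> 7\<close>, the angular part and the radial part of size 1
    add up to the constant 8.\<close>
  also have "\<dots> \<le> 7 * (1 / 2 ^ k)"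
    using pi_less_4 pi_approx by (intro mult_right_mono) auto
  finally show ?thesis by simp
qed

end

context dyadic_doubling begin

lemma measure_tent_ge:
  assumes i: "i < 2 ^ k"
  shows "W k / 2 ^ k \<le> D * measure \<mu> (tent k i)"
proof -
  have ge: "W k \<le> measure \<mu> {z \<in> unit_disk. 1 - 1 / 2 ^ k \<le> cmod z}" if "1 \<le> k" for k
  proof -
    have "1 / 2 ^ k \<le> (1 / 2 :: real)" using power_decreasing[of 1 k "1 / 2 :: real"] that by (simp add: power_one_over)
    then have "1 * W k \<le> (2 * (1 - 1 / 2 ^ k)) * W k" using W_pos[of k] by (intro mult_right_mono) auto
    also have "\<dots> \<le> measure \<mu> {z \<in> unit_disk. 1 - 1 / 2 ^ k \<le> cmod z}"
      unfolding W_def by (rule measure_annulus_ge[OF dyadic_radius(1)])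
    finally show ?thesis by simp
  qed
  have "W k \<le> D * measure \<mu> {z \<in> unit_disk. 1 - 1 / 2 ^ k \<le> cmod z}"
  \<comment> \<open>The lower bound for the annulus carries the factor \<open>1 - 1 / 2 ^ k\<close>,
    which vanishes at level 0; there level 1 and one doubling are used.\<close>
  proof (cases "k = 0")
    case True
    have "W 0 \<le> D * W 1" using W_doubling[of 0] by simp
    also have "W 1 \<le> measure \<mu> {z \<in> unit_disk. 1 - 1 / 2 ^ 1 \<le> cmod z}" by (rule ge) simp
    also have "\<dots> \<le> measure \<mu> {z \<in> unit_disk. 1 - 1 / 2 ^ 0 \<le> cmod z}"
    proof (rule mu.finite_measure_mono)
      have "{z \<in> space \<mu>. 1 - 1 / 2 ^ 0 \<le> cmod z} \<in> sets \<mu>" by measurable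
      then show "{z \<in> unit_disk. 1 - 1 / 2 ^ 0 \<le> cmod z} \<in> sets \<mu>" by simp
    qed auto
    finally show ?thesis using D1 True by simp
  next
    case False
    have "1 * measure \<mu> {z \<in> unit_disk. 1 - 1 / 2 ^ k \<le> cmod z} \<le> D * measure \<mu> {z \<in> unit_disk. 1 - 1 / 2 ^ k \<le> cmod z}"
      using D1 by (intro mult_right_mono) auto
    then show ?thesis using ge[of k] False by simp
  qed
  then show ?thesis by (simp add: measure_tent_eq[OF i] divide_right_mono)
qed

lemma measure_tent_pos: "i < 2 ^ k \<Longrightarrow> 0 < measure \<mu> (tent k i)"
  using measure_tent_ge[of i k] W_pos[of k] D1
  by (smt (verit, ccfv_SIG) divide_pos_pos mult_nonneg_nonpos zero_less_power)

text \<open>For \<open>m \<le> k\<close> this is the estimate at level \<open>k - m\<close> followed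
  by \<open>m\<close> doublings; for larger \<open>m\<close> the whole disk is taken.\<close>

lemma measure_near_boundary_dilate:
  assumes a: "cmod a = 1"
  shows "measure \<mu> {z \<in> unit_disk. cmod (z - a) < 2 ^ m / 2 ^ k} \<le> 2 * 2 ^ m * D ^ m * W k / 2 ^ k"
proof (cases "m \<le> k")
  case True
  have "(2::real) ^ m / 2 ^ k = 1 / 2 ^ (k - m)" using True by (simp add: power_diff)
  then have "measure \<mu> {z \<in> unit_disk. cmod (z - a) < 2 ^ m / 2 ^ k} \<le> W (k - m) / 2 ^ (k - m)"
    using measure_near_boundary[OF a, of "k - m"] by simp
  also have "\<dots> = 2 ^ m * W (k - m) / 2 ^ k" using True by (simp add: power_diff)
  also have "\<dots> \<le> 2 ^ m * (D ^ m * W k) / 2 ^ k"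
    using W_le[of "k - m" m] True by (intro divide_right_mono mult_left_mono) auto
  also have "\<dots> \<le> 2 * (2 ^ m * (D ^ m * W k) / 2 ^ k)"
  proof -
    have "0 \<le> 2 ^ m * (D ^ m * W k) / 2 ^ k" using W_pos[of k] D1 by simp
    then show ?thesis by linarith
  qed
  finally show ?thesis by (simp add: mult.assoc)
next
  case False
  have "measure \<mu> {z \<in> unit_disk. cmod (z - a) < 2 ^ m / 2 ^ k} \<le> measure \<mu> unit_disk"
    by (rule mu.finite_measure_mono) (use sets.top[of \<mu>] in auto)
  also have "\<dots> \<le> 2 * W 0" by (rule measure_disk_le)
  also have "\<dots> \<le> 2 * (D ^ k * W k)" using W_le[of 0 k] by simp
  also have "\<dots> \<le> 2 * ((2 ^ m / 2 ^ k) * (D ^ m * W k))"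
  proof (intro mult_left_mono)
    have "1 * D ^ k \<le> (2 ^ m / 2 ^ k) * D ^ m"
      using False D1 by (intro mult_mono power_increasing) (auto simp: field_simps)
    then show "D ^ k * W k \<le> (2 ^ m / 2 ^ k) * (D ^ m * W k)"
      using W_pos[of k] mult_right_mono[of "D ^ k" "(2 ^ m / 2 ^ k) * D ^ m" "W k"] by (simp add: mult.assoc)
  qed simp
  finally show ?thesis by (simp add: mult_ac)
qed

text \<open>The mean value inequality along the segment from \<open>cnj z * vertex k i\<close> to
  \<open>cnj z * \<zeta>\<close>. Its length is at most \<open>8 / 2 ^ k\<close>, half of
  \<open>2 ^ 4 / 2 ^ k\<close>, so for \<open>4 \<le> m\<close> every point of it keeps distance
  \<open>2 ^ (m - 1) / 2 ^ k\<close> from 1, and \<open>K'_bound\<close> applies at level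
  \<open>k + 1 - m\<close>.\<close>

lemma kernel_smoothness:
  obtains C where "0 \<le> C" "\<And>k i m \<zeta> z. i < 2 ^ k \<Longrightarrow> 4 \<le> m \<Longrightarrow> m \<le> k \<Longrightarrow> \<zeta> \<in> tent k i \<Longrightarrow> z \<in> unit_disk \<Longrightarrow>
    2 ^ m / 2 ^ k \<le> cmod (z - vertex k i) \<Longrightarrow>
    cmod (K (cnj z * \<zeta>) - K (cnj z * vertex k i)) \<le> C * 4 ^ (k + 1 - m) / W (k + 1 - m) * (8 / 2 ^ k)"
proof -
  obtain C where C: "0 \<le> C" "\<And>k w. cmod w < 1 \<Longrightarrow> 1 / 2 ^ k \<le> cmod (1 - w) \<Longrightarrow> cmod (K' w) \<le> C * 4 ^ k / W k"
    using K'_bound by blast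
  have "cmod (K (cnj z * \<zeta>) - K (cnj z * vertex k i)) \<le> C * 4 ^ (k + 1 - m) / W (k + 1 - m) * (8 / 2 ^ k)"
    if i: "i < 2 ^ k" and m: "4 \<le> m" "m \<le> k" and \<zeta>: "\<zeta> \<in> tent k i" and z: "z \<in> unit_disk"
      and far: "2 ^ m / 2 ^ k \<le> cmod (z - vertex k i)" for k i m \<zeta> z
  proof -
    define a where "a = vertex k i"
    define S where "S = closed_segment (cnj z * a) (cnj z * \<zeta>)"
    have z1: "cmod z < 1" using z by simp
    have \<zeta>1: "cmod \<zeta> \<le> 1" using \<zeta> by (auto simp: tent_def)
    have a1: "cmod a = 1" by (simp add: a_def)
    have d: "cmod (cnj z * \<zeta> - cnj z * a) \<le> 8 / 2 ^ k"
    proof -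
      have "cmod (cnj z * \<zeta> - cnj z * a) = cmod z * cmod (\<zeta> - a)"
        by (simp add: right_diff_distrib[symmetric] norm_mult)
      also have "\<dots> \<le> 1 * (8 / 2 ^ k)"
        using z1 dist_vertex_le[OF \<zeta>] by (intro mult_mono) (auto simp: a_def)
      finally show ?thesis by simp
    qed
    have "1 - cnj z * a = a * cnj (a - z)"
    proof -
      have "a * cnj a = 1" using a1 by (simp add: complex_norm_square[symmetric])
      then show ?thesis by (simp add: algebra_simps)
    qed
    then have far': "cmod (1 - cnj z * a) = cmod (z - a)"
      by (simp add: norm_mult a1 norm_minus_commute del: complex_cnj_diff)
    have SD: "cmod v < 1" "1 / 2 ^ (k + 1 - m) \<le> cmod (1 - v)" if v: "v \<in> S" for v
    proof -
      have "S \<subseteq> ball 0 1" unfolding S_def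
        by (rule closed_segment_subset) (use norm_mult_lt_1[OF z1, of a] norm_mult_lt_1[OF z1 \<zeta>1] a1 in auto)
      then show "cmod v < 1" using v by auto
      have "cmod (v - cnj z * a) \<le> 8 / 2 ^ k"
        using segment_bound(1)[OF v[unfolded S_def]] d by simp
      moreover have "cmod (1 - cnj z * a) \<le> cmod (1 - v) + cmod (v - cnj z * a)"
        using norm_triangle_ineq[of "1 - v" "v - cnj z * a"] by simp
      ultimately have "2 ^ m / 2 ^ k - 8 / 2 ^ k \<le> cmod (1 - v)"
        using far far' by (simp add: a_def)
      moreover have "1 / 2 ^ (k + 1 - m) \<le> (2 ^ m / 2 ^ k - 8 / 2 ^ k :: real)"
      proof -
        have "(2::real) ^ 4 \<le> 2 ^ m" using m by (intro power_increasing) auto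
        then have "(2::real) ^ m / 2 \<le> 2 ^ m - 8" by simp
        then have "(2 ^ m / 2) / 2 ^ k \<le> (2 ^ m - 8) / (2::real) ^ k" by (intro divide_right_mono) auto
        moreover have "(2 ^ m / 2) / 2 ^ k = 1 / (2::real) ^ (k + 1 - m)" using m by (simp add: power_diff)
        ultimately show ?thesis by (simp add: diff_divide_distrib)
      qed
      ultimately show "1 / 2 ^ (k + 1 - m) \<le> cmod (1 - v)" by simp
    qed
    have "cmod (K (cnj z * \<zeta>) - K (cnj z * a)) \<le> C * 4 ^ (k + 1 - m) / W (k + 1 - m) * cmod (cnj z * \<zeta> - cnj z * a)"
    proof (rule field_differentiable_bound[of S])
      show "(K has_field_derivative K' v) (at v within S)" if "v \<in> S" for v
        using K_has_field_derivative[OF SD(1)[OF that]] by (rule has_field_derivative_at_within)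
      show "cmod (K' v) \<le> C * 4 ^ (k + 1 - m) / W (k + 1 - m)" if "v \<in> S" for v
        by (rule C(2)[OF SD[OF that]])
    qed (auto simp: S_def)
    also have "\<dots> \<le> C * 4 ^ (k + 1 - m) / W (k + 1 - m) * (8 / 2 ^ k)"
      using d C(1) W_pos[of "k + 1 - m"] by (intro mult_left_mono) auto
    finally show ?thesis by (simp add: a_def)
  qed
  then show ?thesis using C(1) that by blast
qed

text \<open>Hoermander's condition with one majorant for all \<open>\<zeta>\<close> in the tent. On
  the annulus of index \<open>m\<close>, with \<open>k' = k + 1 - m\<close>, the smoothness bound
  times the measure is of order \<open>4 ^ k' / W k' / 2 ^ k * (W k' / 2 ^ k')\<close>, that is
  \<open>1 / 2 ^ m\<close>: the unknown tails cancel and a geometric series remains.\<close>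

lemma kernel_majorant:
  obtains C where "0 \<le> C" "\<And>k i. i < 2 ^ k \<Longrightarrow> \<exists>\<Phi>. integrable \<mu> \<Phi> \<and> (\<forall>z. 0 \<le> \<Phi> z) \<and> (LINT z|\<mu>. \<Phi> z) \<le> C \<and>
     (\<forall>\<zeta>\<in>tent k i. \<forall>z\<in>unit_disk. 2 ^ 4 / 2 ^ k \<le> cmod (z - vertex k i) \<longrightarrow> cmod (K (cnj z * \<zeta>) - K (cnj z * vertex k i)) \<le> \<Phi> z)"
proof -
  obtain C where C: "0 \<le> C" "\<And>k i m \<zeta> z. i < 2 ^ k \<Longrightarrow> 4 \<le> m \<Longrightarrow> m \<le> k \<Longrightarrow> \<zeta> \<in> tent k i \<Longrightarrow> z \<in> unit_disk \<Longrightarrow>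
    2 ^ m / 2 ^ k \<le> cmod (z - vertex k i) \<Longrightarrow>
    cmod (K (cnj z * \<zeta>) - K (cnj z * vertex k i)) \<le> C * 4 ^ (k + 1 - m) / W (k + 1 - m) * (8 / 2 ^ k)"
    using kernel_smoothness by blast
  have "\<exists>\<Phi>. integrable \<mu> \<Phi> \<and> (\<forall>z. 0 \<le> \<Phi> z) \<and> (LINT z|\<mu>. \<Phi> z) \<le> 256 * C * D ^ 2 \<and>
     (\<forall>\<zeta>\<in>tent k i. \<forall>z\<in>unit_disk. 2 ^ 4 / 2 ^ k \<le> cmod (z - vertex k i) \<longrightarrow> cmod (K (cnj z * \<zeta>) - K (cnj z * vertex k i)) \<le> \<Phi> z)"
    if i: "i < 2 ^ k" for k i
  proof -
    define a where "a = vertex k i"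
    define t where "t m = C * 4 ^ (k + 1 - m) / W (k + 1 - m) * (8 / 2 ^ k)" for m
    have t0: "0 \<le> t m" for m using C(1) W_pos[of "k + 1 - m"] by (simp add: t_def)
    define E where "E m = {z \<in> unit_disk. cmod (z - a) < 2 ^ Suc m / 2 ^ k}" for m
    have E: "E m \<in> sets \<mu>" for m
    proof -
      have "{z \<in> space \<mu>. cmod (z - a) < 2 ^ Suc m / 2 ^ k} \<in> sets \<mu>" by measurable
      then show ?thesis by (simp add: E_def)
    qed
    have EI: "E m \<inter> unit_disk = E m" for m by (auto simp: E_def)
    define \<Phi> where "\<Phi> z = (\<Sum>m\<in>{4..k}. t m * indicator (E m) z)" for z
    have \<Phi>i: "integrable \<mu> \<Phi>"
      unfolding \<Phi>_def using E by (intro Bochner_Integration.integrable_sum integrable_mult_right integrable_real_indicator) (auto simp: mu.emeasure_eq_measure)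
    have "(LINT z|\<mu>. \<Phi> z) = (\<Sum>m\<in>{4..k}. t m * measure \<mu> (E m))"
      unfolding \<Phi>_def using E by (subst Bochner_Integration.integral_sum) (auto simp: EI mu.emeasure_eq_measure intro!: integrable_mult_right integrable_real_indicator)
    also have "\<dots> \<le> (\<Sum>m\<in>{4..k}. 128 * C * D ^ 2 * (1 / 2) ^ m)"
    proof (rule sum_mono)
      fix m assume m: "m \<in> {4..k}"
      define k' where "k' = k + 1 - m"
      have k2: "(2::real) ^ k = 2 ^ k' * 2 ^ m / 2"
      proof -
        have "k' + m = Suc k" using m by (simp add: k'_def)
        then have "(2::real) ^ k' * 2 ^ m = 2 ^ Suc k" by (simp only: power_add[symmetric])
        then show ?thesis by simp
      qed
      have "2 ^ Suc m / 2 ^ k = (2 ^ 2 / 2 ^ k' :: real)" unfolding k2 by (simp add: power2_eq_square)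
      then have "measure \<mu> (E m) \<le> 2 * 2 ^ 2 * D ^ 2 * W k' / 2 ^ k'"
        using measure_near_boundary_dilate[of a 2 k'] by (simp add: E_def a_def)
      then have "t m * measure \<mu> (E m) \<le> t m * (2 * 2 ^ 2 * D ^ 2 * W k' / 2 ^ k')"
        by (rule mult_left_mono) (rule t0)
      also have "\<dots> = 128 * C * D ^ 2 * (1 / 2) ^ m"
      proof -
        have "(4::real) ^ k' = 2 ^ k' * 2 ^ k'" by (simp add: power_mult_distrib[symmetric])
        then show ?thesis unfolding t_def k'_def[symmetric] k2 using W_pos[of k'] by (simp add: power_one_over)
      qed
      finally show "t m * measure \<mu> (E m) \<le> 128 * C * D ^ 2 * (1 / 2) ^ m" .
    qed
    also have "\<dots> = 128 * C * D ^ 2 * (\<Sum>m\<in>{4..k}. (1 / 2) ^ m)" by (simp add: sum_distrib_left)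
    also have "\<dots> \<le> 128 * C * D ^ 2 * 2"
    proof (rule mult_left_mono)
      have "(\<Sum>m\<in>{4..k}. (1 / 2 :: real) ^ m) \<le> (\<Sum>m. (1 / 2) ^ m)"
        by (rule sum_le_suminf) (auto intro: summable_geometric)
      also have "\<dots> = 2" by (simp add: suminf_geometric)
      finally show "(\<Sum>m\<in>{4..k}. (1 / 2 :: real) ^ m) \<le> 2" .
    qed (use C(1) in simp)
    finally have int: "(LINT z|\<mu>. \<Phi> z) \<le> 256 * C * D ^ 2" by simp
    have "cmod (K (cnj z * \<zeta>) - K (cnj z * a)) \<le> \<Phi> z"
      if \<zeta>: "\<zeta> \<in> tent k i" and z: "z \<in> unit_disk" and far: "2 ^ 4 / 2 ^ k \<le> cmod (z - a)" for \<zeta> z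
    proof -
      \<comment> \<open>The maximum of \<open>M\<close> is the index of the annulus containing
        \<open>z\<close>; it is at most \<open>k\<close> because points of the disk are within 2 of
        the vertex.\<close>
      define M where "M = {m. 2 ^ m / 2 ^ k \<le> cmod (z - a)}"
      have za: "cmod (z - a) < 2" using norm_triangle_ineq4[of z a] z by (simp add: a_def)
      have Mk: "m \<le> k" if "m \<in> M" for m
      proof -
        have "2 ^ m / 2 ^ k < (2::real)" using that za by (simp add: M_def)
        then have "(2::real) ^ m < 2 ^ Suc k" by (simp add: field_simps)
        then show ?thesis by (simp del: power_Suc)
      qed
      then have fin: "finite M" by (meson finite_nat_set_iff_bounded_le)
      have M4: "4 \<in> M" using far by (simp add: M_def)
      define m where "m = Max M"
      have mM: "m \<in> M" unfolding m_def by (rule Max_in) (use fin M4 in auto)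
      have m4: "4 \<le> m" unfolding m_def using fin M4 by simp
      have "Suc m \<notin> M" using Max_ge[OF fin, of "Suc m"] by (auto simp: m_def)
      then have zE: "z \<in> E m" using z by (simp add: M_def E_def)
      have "cmod (K (cnj z * \<zeta>) - K (cnj z * a)) \<le> t m"
        unfolding t_def a_def by (rule C(2)[OF i m4 Mk[OF mM] \<zeta> z]) (use mM in \<open>simp add: M_def a_def\<close>)
      also have "\<dots> = t m * indicator (E m) z" using zE by simp
      also have "\<dots> \<le> \<Phi> z" unfolding \<Phi>_def
        by (rule member_le_sum) (use m4 Mk[OF mM] t0 in auto)
      finally show ?thesis .
    qed
    moreover have "\<forall>z. 0 \<le> \<Phi> z" unfolding \<Phi>_def using t0 by (auto intro!: sum_nonneg)
    ultimately show ?thesis using \<Phi>i int unfolding a_def by blast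
  qed
  moreover have "0 \<le> 256 * C * D ^ 2" using C(1) by simp
  ultimately show ?thesis using that by blast
qed

end

subsection \<open>Nested tents and localized functions\<close>

context radial begin

lemma tent_nested: "l \<le> k \<Longrightarrow> tent k i \<subseteq> tent l (i div 2 ^ (k - l))"
proof
  fix z assume l: "l \<le> k" and z: "z \<in> tent k i"
  have "(1::real) / 2 ^ k \<le> 1 / 2 ^ l" using l by (intro divide_left_mono power_increasing) auto
  moreover have "1 - 1 / 2 ^ k \<le> cmod z" using z by (simp add: tent_def)
  ultimately have "1 - 1 / 2 ^ l \<le> cmod z" by linarith
  then show "z \<in> tent l (i div 2 ^ (k - l))" using z idx_div[OF l, of z] by (simp add: tent_def)
qed

lemma tent_Int_tent:
  assumes "l \<le> k" "z \<in> tent k i" "z \<in> tent l j"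
  shows "j = i div 2 ^ (k - l)"
  using assms idx_div[of l k z] by (simp add: tent_def)

definition mass :: "(complex \<Rightarrow> complex) \<Rightarrow> complex set \<Rightarrow> real" where
  "mass f E = (LINT z|\<mu>. indicator E z * cmod (f z))"

lemma mass_integrable:
  assumes "integrable \<mu> f" "E \<in> sets \<mu>"
  shows "integrable \<mu> (\<lambda>z. indicator E z * cmod (f z))"
  using integrable_mult_indicator[OF assms(2), of "\<lambda>z. cmod (f z)"] assms(1) by simp

lemma mass_nonneg: "0 \<le> mass f E"
  unfolding mass_def by (rule integral_nonneg_AE) auto

lemma mass_mono:
  assumes "integrable \<mu> f" "E \<in> sets \<mu>" "E' \<in> sets \<mu>" "E \<subseteq> E'"
  shows "mass f E \<le> mass f E'"
  unfolding mass_def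
  by (rule integral_mono[OF mass_integrable[OF assms(1,2)] mass_integrable[OF assms(1,3)]])
     (use assms(4) in \<open>auto simp: indicator_def\<close>)

lemma mass_le_norm:
  assumes "integrable \<mu> f" "E \<in> sets \<mu>"
  shows "mass f E \<le> (LINT z|\<mu>. cmod (f z))"
  unfolding mass_def
  by (rule integral_mono[OF mass_integrable[OF assms]]) (use assms(1) in \<open>auto simp: indicator_def\<close>)

lemma sum_mass_le:
  assumes f: "integrable \<mu> f" and A: "finite A" and R: "\<And>Q. Q \<in> A \<Longrightarrow> R Q \<in> sets \<mu>" "\<And>Q. Q \<in> A \<Longrightarrow> R Q \<subseteq> E"
    and dj: "disjoint_family_on R A" and E: "E \<in> sets \<mu>"
  shows "(\<Sum>Q\<in>A. mass f (R Q)) \<le> mass f E"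
proof -
  have "(\<Sum>Q\<in>A. mass f (R Q)) = (LINT z|\<mu>. (\<Sum>Q\<in>A. indicator (R Q) z * cmod (f z)))"
    unfolding mass_def
    by (rule Bochner_Integration.integral_sum[symmetric]) (intro mass_integrable f R)
  also have "\<dots> \<le> mass f E"
    unfolding mass_def
  proof (rule integral_mono)
    show "integrable \<mu> (\<lambda>z. \<Sum>Q\<in>A. indicator (R Q) z * cmod (f z))"
      by (intro Bochner_Integration.integrable_sum mass_integrable f R)
    show "integrable \<mu> (\<lambda>z. indicator E z * cmod (f z))" by (rule mass_integrable[OF f E])
    fix z
    have "(\<Sum>Q\<in>A. indicator (R Q) z * cmod (f z)) = indicator (\<Union>Q\<in>A. R Q) z * cmod (f z)"
      by (simp add: sum_distrib_right[symmetric] indicator_UN_disjoint[OF A dj])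
    also have "\<dots> \<le> indicator E z * cmod (f z)"
      using R(2) by (intro mult_right_mono) (auto simp: indicator_def)
    finally show "(\<Sum>Q\<in>A. indicator (R Q) z * cmod (f z)) \<le> indicator E z * cmod (f z)" .
  qed
  finally show ?thesis .
qed

text \<open>Two tents are disjoint or nested, so expanding the square leaves only the nested pairs.\<close>

lemma nested_tents_L2:
  fixes A :: "(nat \<times> nat) set" and c F :: "nat \<times> nat \<Rightarrow> real"
  assumes A: "finite A" and c: "\<And>Q. Q \<in> A \<Longrightarrow> 0 \<le> c Q"
    and cF: "\<And>Q. Q \<in> A \<Longrightarrow> c Q * measure \<mu> (case_prod tent Q) \<le> F Q"
    and packing: "\<And>Q. Q \<in> A \<Longrightarrow> (\<Sum>Q'\<in>{Q'\<in>A. case_prod tent Q' \<subseteq> case_prod tent Q}. F Q') \<le> L * measure \<mu> (case_prod tent Q)"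
    and L: "0 \<le> L"
  shows "(LINT z|\<mu>. (\<Sum>Q\<in>A. c Q * indicator (case_prod tent Q) z)\<^sup>2) \<le> 2 * L * (\<Sum>Q\<in>A. F Q)"
proof -
  define T where "T Q = case_prod tent Q" for Q
  have T [measurable]: "T Q \<in> sets \<mu>" for Q by (auto simp: T_def split_beta)
  have TI: "T Q \<inter> unit_disk = T Q" for Q using tent_subset by (auto simp: T_def split_beta)
  have F0: "0 \<le> F Q" if "Q \<in> A" for Q using cF[OF that] c[OF that] by (meson measure_nonneg mult_nonneg_nonneg order_trans)
  \<comment> \<open>Each nested pair is charged to its larger tent, so that summing over the smaller
    ones is exactly the packing hypothesis.\<close>
  define X where "X Q Q' = (if Q' \<in> {Q'\<in>A. T Q' \<subseteq> T Q} then c Q * F Q' else 0)" for Q Q'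
  have X0: "0 \<le> X Q Q'" if "Q \<in> A" for Q Q' using c[OF that] F0 by (auto simp: X_def)
  have pair: "c Q * c Q' * measure \<mu> (T Q \<inter> T Q') \<le> X Q Q' + X Q' Q" if Q: "Q \<in> A" "Q' \<in> A" for Q Q'
  proof -
    have sub: "c Q * c Q' * measure \<mu> (T Q \<inter> T Q') \<le> X Q Q'" if Q: "Q \<in> A" "Q' \<in> A" and le: "fst Q \<le> fst Q'" for Q Q'
    proof (cases "T Q \<inter> T Q' = {}")
      case True
      then show ?thesis using X0[OF Q(1)] by simp
    next
      case False
      then obtain z where "z \<in> T Q" "z \<in> T Q'" by auto
      then have "snd Q = snd Q' div 2 ^ (fst Q' - fst Q)"
        using tent_Int_tent[OF le, of z] by (auto simp: T_def split_beta)
      then have s: "T Q' \<subseteq> T Q"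
        using tent_nested[OF le, of "snd Q'"] by (simp add: T_def split_beta)
      have "c Q * (c Q' * measure \<mu> (T Q')) \<le> c Q * F Q'"
        using cF[OF Q(2)] c[OF Q(1)] by (intro mult_left_mono) (auto simp: T_def)
      then show ?thesis using s Q by (simp add: X_def Int_absorb1 mult.assoc)
    qed
    show ?thesis
    proof (cases "fst Q \<le> fst Q'")
      case True
      then show ?thesis using sub[OF Q] X0[OF Q(2)] by (simp add: add_increasing2)
    next
      case False
      then have "c Q' * c Q * measure \<mu> (T Q' \<inter> T Q) \<le> X Q' Q" using Q by (intro sub) auto
      then show ?thesis using X0[OF Q(1), of Q'] by (simp add: Int_commute mult_ac)
    qed
  qed
  have i: "integrable \<mu> (\<lambda>z. c Q * c Q' * indicator (T Q \<inter> T Q') z)" for Q Q'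
    by (intro integrable_mult_right integrable_real_indicator) (auto simp: mu.emeasure_eq_measure)
  have "(LINT z|\<mu>. (\<Sum>Q\<in>A. c Q * indicator (T Q) z)\<^sup>2) = (LINT z|\<mu>. (\<Sum>Q\<in>A. \<Sum>Q'\<in>A. c Q * c Q' * indicator (T Q \<inter> T Q') z))"
    by (rule Bochner_Integration.integral_cong)
       (auto simp: power2_eq_square sum_product indicator_inter_arith mult_ac)
  also have "\<dots> = (\<Sum>Q\<in>A. \<Sum>Q'\<in>A. c Q * c Q' * measure \<mu> (T Q \<inter> T Q'))"
    using i by (simp add: Bochner_Integration.integral_sum integrable_sum Int_assoc TI)
  also have "\<dots> \<le> (\<Sum>Q\<in>A. \<Sum>Q'\<in>A. X Q Q' + X Q' Q)"
    by (intro sum_mono pair)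
  also have "\<dots> = 2 * (\<Sum>Q\<in>A. \<Sum>Q'\<in>A. X Q Q')"
    using sum.swap[of "\<lambda>Q Q'. X Q' Q" A A] by (simp add: sum.distrib)
  also have "(\<Sum>Q\<in>A. \<Sum>Q'\<in>A. X Q Q') \<le> (\<Sum>Q\<in>A. L * F Q)"
  proof (rule sum_mono)
    fix Q assume Q: "Q \<in> A"
    have "(\<Sum>Q'\<in>A. X Q Q') = (\<Sum>Q'\<in>{Q'\<in>A. T Q' \<subseteq> T Q}. c Q * F Q')"
      unfolding X_def using A by (subst sum.mono_neutral_right[where T = A and S = "{Q'\<in>A. T Q' \<subseteq> T Q}"]) auto
    also have "\<dots> = c Q * (\<Sum>Q'\<in>{Q'\<in>A. T Q' \<subseteq> T Q}. F Q')" by (rule sum_distrib_left[symmetric])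
    also have "\<dots> \<le> c Q * (L * measure \<mu> (T Q))"
      using packing[OF Q] c[OF Q] by (intro mult_left_mono) (auto simp: T_def)
    also have "\<dots> \<le> L * F Q"
      using mult_left_mono[OF cF[OF Q] L] by (simp add: T_def mult_ac)
    finally show "(\<Sum>Q'\<in>A. X Q Q') \<le> L * F Q" .
  qed
  finally show ?thesis by (simp add: T_def sum_distrib_left mult.assoc)
qed

end

context dyadic_doubling begin

lemma measure_tent_parent:
  assumes i: "i < 2 ^ Suc k"
  shows "measure \<mu> (tent k (i div 2)) \<le> 4 * D ^ 2 * measure \<mu> (tent (Suc k) i)"
proof -
  have "measure \<mu> (tent k (i div 2)) \<le> 2 * W k / 2 ^ k"
    by (rule measure_tent_le) (use i in simp)
  also have "\<dots> \<le> 2 * (D * W (Suc k)) / 2 ^ k"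
    using W_doubling[of k] by (intro divide_right_mono mult_left_mono) auto
  also have "\<dots> = 4 * D * (W (Suc k) / 2 ^ Suc k)" by simp
  also have "\<dots> \<le> 4 * D * (D * measure \<mu> (tent (Suc k) i))"
    using measure_tent_ge[OF i] D1 by (intro mult_left_mono) auto
  finally show ?thesis by (simp add: power2_eq_square mult_ac)
qed

text \<open>The threshold is the least index \<open>m = 4\<close> in
  \<open>kernel_smoothness\<close>, twice the bound \<open>8 / 2 ^ k\<close> of
  \<open>dist_vertex_le\<close>.\<close>

definition far :: "nat \<Rightarrow> nat \<Rightarrow> complex \<Rightarrow> bool" where
  "far k i z \<longleftrightarrow> 2 ^ 4 / 2 ^ k \<le> cmod (z - vertex k i)"

text \<open>A bad piece: the subtracted multiple of \<open>indicator (tent k i)\<close> has the same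
  integral as \<open>f\<close> on \<open>R\<close>, even when \<open>R\<close> is much smaller than
  the tent.\<close>

definition localized :: "(complex \<Rightarrow> complex) \<Rightarrow> nat \<Rightarrow> nat \<Rightarrow> complex set \<Rightarrow> complex \<Rightarrow> complex" where
  "localized f k i R z = indicator R z * f z -
     (LINT \<zeta>|\<mu>. indicator R \<zeta> * f \<zeta>) / of_real (measure \<mu> (tent k i)) * indicator (tent k i) z"

lemma near_measure:
  "measure \<mu> {z \<in> unit_disk. \<not> far k i z} \<le> 32 * D ^ 4 * W k / 2 ^ k"
  using measure_near_boundary_dilate[of "vertex k i" 4 k] by (simp add: far_def not_le)

lemma near_sets: "{z \<in> unit_disk. \<not> far k i z} \<in> sets \<mu>"
proof -
  have "{z \<in> space \<mu>. cmod (z - vertex k i) < 2 ^ 4 / 2 ^ k} \<in> sets \<mu>" by measurable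
  then show ?thesis by (simp add: far_def not_le)
qed

text \<open>Far from the tent, the vanishing integral and the majorant \<open>\<Phi>\<close> apply.
  Near it, if \<open>R\<close> avoids the lower half, the kernel is at most \<open>G\<close>, of
  order \<open>2 ^ k / W k\<close>, and the near set has measure of order
  \<open>W k / 2 ^ k\<close>. The remaining multiple of \<open>P u\<close>, with \<open>u\<close>
  the indicator of the tent, is controlled in the square mean.\<close>

lemma localized_bound:
  obtains C where "0 \<le> C" "\<And>f k i R. integrable \<mu> f \<Longrightarrow> i < 2 ^ k \<Longrightarrow> R \<in> sets \<mu> \<Longrightarrow> R \<subseteq> tent k i \<Longrightarrow>
    \<exists>\<Psi>. integrable \<mu> \<Psi> \<and> (\<forall>z. 0 \<le> \<Psi> z) \<and> (LINT z|\<mu>. \<Psi> z) \<le> C * mass f R \<and>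
      (\<forall>z\<in>unit_disk. far k i z \<or> (\<forall>\<zeta>\<in>R. cmod \<zeta> < 1 - 1 / 2 ^ Suc k) \<longrightarrow> cmod (P (localized f k i R) z) \<le> \<Psi> z)"
proof -
  obtain C4 where C4: "0 \<le> C4" "\<And>k i. i < 2 ^ k \<Longrightarrow> \<exists>\<Phi>. integrable \<mu> \<Phi> \<and> (\<forall>z. 0 \<le> \<Phi> z) \<and> (LINT z|\<mu>. \<Phi> z) \<le> C4 \<and>
     (\<forall>\<zeta>\<in>tent k i. \<forall>z\<in>unit_disk. 2 ^ 4 / 2 ^ k \<le> cmod (z - vertex k i) \<longrightarrow> cmod (K (cnj z * \<zeta>) - K (cnj z * vertex k i)) \<le> \<Phi> z)"
    using kernel_majorant by blast
  obtain Ck where Ck: "0 \<le> Ck" "\<And>k. Kr (1 - 1 / 2 ^ k) \<le> Ck * 2 ^ k / W k" using Kr_bound by blast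
  define C where "C = 2 * C4 + 64 * Ck * D ^ 5 + 32 * D ^ 5 + 1"
  have D0: "0 \<le> D ^ n" for n using D1 by simp
  have main: "\<exists>\<Psi>. integrable \<mu> \<Psi> \<and> (\<forall>z. 0 \<le> \<Psi> z) \<and> (LINT z|\<mu>. \<Psi> z) \<le> C * mass f R \<and>
      (\<forall>z\<in>unit_disk. far k i z \<or> (\<forall>\<zeta>\<in>R. cmod \<zeta> < 1 - 1 / 2 ^ Suc k) \<longrightarrow> cmod (P (localized f k i R) z) \<le> \<Psi> z)"
    if f: "integrable \<mu> f" and i: "i < 2 ^ k" and R [measurable]: "R \<in> sets \<mu>" and RT: "R \<subseteq> tent k i" for f k i R
  proof -
    obtain \<Phi> where \<Phi>: "integrable \<mu> \<Phi>" "\<And>z. 0 \<le> \<Phi> z" "(LINT z|\<mu>. \<Phi> z) \<le> C4"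
      "\<And>\<zeta> z. \<zeta> \<in> tent k i \<Longrightarrow> z \<in> unit_disk \<Longrightarrow> far k i z \<Longrightarrow> cmod (K (cnj z * \<zeta>) - K (cnj z * vertex k i)) \<le> \<Phi> z"
      using C4(2)[OF i] unfolding far_def by blast
    have [measurable]: "f \<in> borel_measurable \<mu>" using f by auto
    define T where "T = tent k i"
    have T [measurable]: "T \<in> sets \<mu>" by (simp add: T_def)
    have TI: "T \<inter> unit_disk = T" using tent_subset by (auto simp: T_def)
    define mT where "mT = measure \<mu> T"
    have mT: "0 < mT" unfolding mT_def T_def by (rule measure_tent_pos[OF i])
    define F where "F = mass f R"
    have F0: "0 \<le> F" unfolding F_def by (rule mass_nonneg)
    define c where "c = (LINT \<zeta>|\<mu>. indicator R \<zeta> * f \<zeta>) / of_real mT"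
    define fR where "fR z = indicator R z * f z" for z
    define u where "u z = complex_of_real (indicator T z)" for z
    define b where "b z = fR z - c * u z" for z
    have [measurable]: "fR \<in> borel_measurable \<mu>" "u \<in> borel_measurable \<mu>"
      unfolding fR_def[abs_def] u_def[abs_def] by measurable
    have b_eq: "localized f k i R = b"
      by (auto simp: localized_def b_def fR_def u_def c_def mT_def T_def fun_eq_iff indicator_def)
    have fRi: "integrable \<mu> fR"
      by (rule Bochner_Integration.integrable_bound[OF f]) (auto simp: fR_def indicator_def)
    have ui: "integrable \<mu> u"
      by (rule integrable_bounded[where B = 1]) (auto simp: u_def indicator_def)
    have bi: "integrable \<mu> b" unfolding b_def[abs_def] using fRi ui by auto
    have fRF: "(LINT z|\<mu>. cmod (fR z)) = F"
      unfolding F_def mass_def by (rule Bochner_Integration.integral_cong) (auto simp: fR_def indicator_def)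
    have uI: "(LINT z|\<mu>. u z) = of_real mT"
    proof -
      have "(LINT z|\<mu>. u z) = of_real (LINT z|\<mu>. indicator T z)" unfolding u_def by (rule integral_complex_of_real)
      then show ?thesis by (simp add: mT_def TI)
    qed
    have cF: "cmod c * mT \<le> F"
    proof -
      have "cmod c * mT = cmod (LINT z|\<mu>. fR z)"
        using mT by (simp add: c_def norm_divide fR_def)
      also have "\<dots> \<le> F" unfolding fRF[symmetric] by (rule integral_norm_bound)
      finally show ?thesis .
    qed
    have b0: "(LINT z|\<mu>. b z) = 0"
    proof -
      have "(LINT z|\<mu>. b z) = (LINT z|\<mu>. fR z) - c * of_real mT"
        unfolding b_def using fRi ui by (simp add: uI)
      then show ?thesis using mT by (simp add: c_def fR_def)
    qed
    have bF: "(LINT z|\<mu>. cmod (b z)) \<le> 2 * F"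
    proof -
      have "(LINT z|\<mu>. cmod (b z)) \<le> (LINT z|\<mu>. cmod (fR z) + cmod c * indicator T z)"
      proof (rule integral_mono)
        show "cmod (b z) \<le> cmod (fR z) + cmod c * indicator T z" for z
          using norm_triangle_ineq4[of "fR z" "c * u z"] by (simp add: b_def norm_mult u_def)
      qed (use fRi bi in \<open>auto intro!: integrable_real_indicator simp: mu.emeasure_eq_measure\<close>)
      also have "\<dots> = F + cmod c * mT"
        using fRi fRF by (simp add: mT_def TI mu.emeasure_eq_measure)
      finally show ?thesis using cF by simp
    qed
    define Q where "Q = {z \<in> unit_disk. \<not> far k i z}"
    have Q [measurable]: "Q \<in> sets \<mu>" unfolding Q_def by (rule near_sets)
    have QI: "Q \<inter> unit_disk = Q" by (auto simp: Q_def)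
    define G where "G = Kr (1 - 1 / 2 ^ Suc k)"
    have G0: "0 \<le> G" unfolding G_def by (rule Kr_nonneg[OF dyadic_radius])
    have u2: "integrable \<mu> (\<lambda>z. (cmod (u z))\<^sup>2)"
      by (rule integrable_bounded[where B = 1]) (auto simp: u_def indicator_def)
    have Pum [measurable]: "P u \<in> borel_measurable \<mu>" by (rule P_measurable[OF ui])
    have Pu2: "(\<integral>\<^sup>+z. ennreal ((cmod (P u z))\<^sup>2) \<partial>\<mu>) \<le> ennreal mT"
    proof -
      have "(LINT z|\<mu>. (cmod (u z))\<^sup>2) = (LINT z|\<mu>. indicator T z)"
        by (rule Bochner_Integration.integral_cong) (auto simp: u_def indicator_def)
      then show ?thesis using P_L2[OF ui u2] by (simp add: mT_def TI)
    qed
    have Pu2i: "integrable \<mu> (\<lambda>z. (cmod (P u z))\<^sup>2)"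
      by (rule integrableI_bounded) (use Pu2 in \<open>auto intro: le_less_trans\<close>)
    have Pu2I: "(LINT z|\<mu>. (cmod (P u z))\<^sup>2) \<le> mT"
      using Pu2 Pu2i mT by (simp add: nn_integral_eq_integral)
    \<comment> \<open>The first term serves far points. The others serve near points:
      \<open>F * G\<close> bounds the image of \<open>fR\<close>, and the terms with
      \<open>c\<close> bound the image of the subtracted constant. All have integral of order
      \<open>F\<close> because \<open>cmod c * mT \<le> F\<close>.\<close>
    define \<Psi> where "\<Psi> z = 2 * F * \<Phi> z + (indicator Q z * (F * G + cmod c) + cmod c * (cmod (P u z))\<^sup>2)" for z
    have Qi: "integrable \<mu> (\<lambda>z. indicator Q z * (F * G + cmod c))"
      by (rule integrable_bounded[where B = "F * G + cmod c"]) (use F0 G0 in \<open>auto simp: indicator_def\<close>)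
    have \<Psi>i: "integrable \<mu> \<Psi>" unfolding \<Psi>_def using \<Phi>(1) Qi Pu2i by auto
    have \<Psi>0: "0 \<le> \<Psi> z" for z unfolding \<Psi>_def using F0 G0 \<Phi>(2)[of z] by (auto simp: indicator_def)
    have mQ: "measure \<mu> Q \<le> 32 * D ^ 5 * mT"
    proof -
      have "measure \<mu> Q \<le> 32 * D ^ 4 * (W k / 2 ^ k)" using near_measure[of k i] by (simp add: Q_def)
      also have "\<dots> \<le> 32 * D ^ 4 * (D * mT)"
        using measure_tent_ge[OF i] D0 by (intro mult_left_mono) (auto simp: mT_def T_def)
      also have "\<dots> = 32 * (D ^ 4 * D) * mT" by simp
      also have "D ^ 4 * D = D ^ 5" by (simp add: power_Suc2[symmetric] del: power_Suc)
      finally show ?thesis .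
    qed
    have GQ: "G * measure \<mu> Q \<le> 64 * Ck * D ^ 5"
    proof -
      have "G * measure \<mu> Q \<le> (Ck * 2 ^ Suc k / W (Suc k)) * (32 * D ^ 4 * (D * W (Suc k)) / 2 ^ k)"
      proof (rule mult_mono)
        show "G \<le> Ck * 2 ^ Suc k / W (Suc k)" unfolding G_def by (rule Ck(2))
        have "measure \<mu> Q \<le> 32 * D ^ 4 * W k / 2 ^ k" using near_measure[of k i] by (simp add: Q_def)
        also have "\<dots> \<le> 32 * D ^ 4 * (D * W (Suc k)) / 2 ^ k"
          using W_doubling[of k] D0 by (intro divide_right_mono mult_left_mono) auto
        finally show "measure \<mu> Q \<le> 32 * D ^ 4 * (D * W (Suc k)) / 2 ^ k" .
      qed (use Ck(1) W_pos[of "Suc k"] in auto)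
      also have "\<dots> = 64 * Ck * (D ^ 4 * D)" using W_pos[of "Suc k"] by simp
      also have "D ^ 4 * D = D ^ 5" by (simp add: power_Suc2[symmetric] del: power_Suc)
      finally show ?thesis .
    qed
    have \<Psi>I: "(LINT z|\<mu>. \<Psi> z) \<le> C * F"
    proof -
      have "(LINT z|\<mu>. \<Psi> z) = 2 * F * (LINT z|\<mu>. \<Phi> z) + ((F * G + cmod c) * measure \<mu> Q + cmod c * (LINT z|\<mu>. (cmod (P u z))\<^sup>2))"
        unfolding \<Psi>_def using \<Phi>(1) Qi Pu2i by (simp add: QI)
      also have "\<dots> \<le> 2 * F * C4 + ((F * G + cmod c) * measure \<mu> Q + cmod c * mT)"
        using \<Phi>(3) Pu2I F0 G0 by (intro add_mono mult_left_mono) (auto intro!: add_nonneg_nonneg)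
      also have "\<dots> = 2 * F * C4 + F * (G * measure \<mu> Q) + cmod c * measure \<mu> Q + cmod c * mT"
        by (simp add: algebra_simps)
      also have "\<dots> \<le> 2 * F * C4 + F * (64 * Ck * D ^ 5) + 32 * D ^ 5 * F + F"
      proof (intro add_mono mult_left_mono GQ F0 cF order_refl)
        have "cmod c * measure \<mu> Q \<le> cmod c * (32 * D ^ 5 * mT)" by (rule mult_left_mono[OF mQ]) simp
        also have "\<dots> = 32 * D ^ 5 * (cmod c * mT)" by simp
        also have "\<dots> \<le> 32 * D ^ 5 * F" using D1 by (intro mult_left_mono cF) auto
        finally show "cmod c * measure \<mu> Q \<le> 32 * D ^ 5 * F" .
      qed (use F0 in auto)
      also have "\<dots> = C * F" by (simp add: C_def algebra_simps)
      finally show ?thesis .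
    qed
    have "cmod (P b z) \<le> \<Psi> z" if z: "z \<in> unit_disk" and disj: "far k i z \<or> (\<forall>\<zeta>\<in>R. cmod \<zeta> < 1 - 1 / 2 ^ Suc k)" for z
    proof (cases "far k i z")
      case True
      have z1: "cmod z < 1" using z by simp
      define Ka where "Ka = K (cnj z * vertex k i)"
      have "P b z = (LINT \<zeta>|\<mu>. b \<zeta> * cnj (K (cnj z * \<zeta>)))" using bi by (intro P_eq) auto
      also have "\<dots> = (LINT \<zeta>|\<mu>. b \<zeta> * cnj (K (cnj z * \<zeta>))) - (LINT \<zeta>|\<mu>. b \<zeta> * cnj Ka)" using b0 by simp
      also have "\<dots> = (LINT \<zeta>|\<mu>. b \<zeta> * cnj (K (cnj z * \<zeta>)) - b \<zeta> * cnj Ka)"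
        by (rule Bochner_Integration.integral_diff[symmetric]) (use integrable_mult_K[OF bi z1] bi in auto)
      finally have "cmod (P b z) = cmod (LINT \<zeta>|\<mu>. b \<zeta> * cnj (K (cnj z * \<zeta>)) - b \<zeta> * cnj Ka)" by simp
      also have "\<dots> \<le> (LINT \<zeta>|\<mu>. cmod (b \<zeta> * cnj (K (cnj z * \<zeta>)) - b \<zeta> * cnj Ka))" by (rule integral_norm_bound)
      also have "\<dots> \<le> (LINT \<zeta>|\<mu>. cmod (b \<zeta>) * \<Phi> z)"
      proof (rule integral_mono)
        show "integrable \<mu> (\<lambda>\<zeta>. cmod (b \<zeta> * cnj (K (cnj z * \<zeta>)) - b \<zeta> * cnj Ka))"
          using integrable_mult_K[OF bi z1] bi by (intro integrable_norm) auto
        show "integrable \<mu> (\<lambda>\<zeta>. cmod (b \<zeta>) * \<Phi> z)" using bi by auto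
        fix \<zeta>
        have e: "cmod (b \<zeta> * cnj (K (cnj z * \<zeta>)) - b \<zeta> * cnj Ka) = cmod (b \<zeta>) * cmod (K (cnj z * \<zeta>) - Ka)"
          by (simp only: right_diff_distrib[symmetric] complex_cnj_diff[symmetric] norm_mult complex_mod_cnj)
        show "cmod (b \<zeta> * cnj (K (cnj z * \<zeta>)) - b \<zeta> * cnj Ka) \<le> cmod (b \<zeta>) * \<Phi> z"
        proof (cases "\<zeta> \<in> T")
          case True
          then show ?thesis unfolding e using \<Phi>(4)[OF _ z \<open>far k i z\<close>, of \<zeta>]
            by (intro mult_left_mono) (auto simp: T_def Ka_def)
        next
          case False
          then have "b \<zeta> = 0" using RT by (auto simp: b_def fR_def u_def T_def indicator_def)
          then show ?thesis by simp
        qed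
      qed
      also have "\<dots> = (LINT \<zeta>|\<mu>. cmod (b \<zeta>)) * \<Phi> z" by simp
      also have "\<dots> \<le> 2 * F * \<Phi> z" by (rule mult_right_mono[OF bF \<Phi>(2)])
      also have "\<dots> \<le> \<Psi> z" unfolding \<Psi>_def using F0 G0 by (simp add: indicator_def)
      finally show ?thesis .
    next
      case False
      then have shallow: "cmod \<zeta> < 1 - 1 / 2 ^ Suc k" if "\<zeta> \<in> R" for \<zeta> using disj that by blast
      have z1: "cmod z < 1" using z by simp
      have zQ: "z \<in> Q" using z False by (simp add: Q_def)
      have "cmod (P fR z) \<le> (LINT \<zeta>|\<mu>. cmod (fR \<zeta> * cnj (K (cnj z * \<zeta>))))"
        using fRi by (subst P_eq) (auto intro: integral_norm_bound)
      also have "\<dots> \<le> (LINT \<zeta>|\<mu>. cmod (fR \<zeta>) * G)"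
      proof (rule integral_mono)
        show "integrable \<mu> (\<lambda>\<zeta>. cmod (fR \<zeta> * cnj (K (cnj z * \<zeta>))))"
          by (rule integrable_norm[OF integrable_mult_K[OF fRi z1]])
        show "integrable \<mu> (\<lambda>\<zeta>. cmod (fR \<zeta>) * G)" using fRi by auto
        fix \<zeta>
        show "cmod (fR \<zeta> * cnj (K (cnj z * \<zeta>))) \<le> cmod (fR \<zeta>) * G"
        proof (cases "\<zeta> \<in> R")
          case True
          have n1: "cmod (cnj z * \<zeta>) \<le> cmod \<zeta>" using z1 by (simp add: norm_mult mult_left_le_one_le)
          have n2: "cmod (cnj z * \<zeta>) < 1" using n1 shallow[OF True] dyadic_radius(2)[of "Suc k"] by linarith
          have "cmod (K (cnj z * \<zeta>)) \<le> Kr (cmod (cnj z * \<zeta>))" by (rule norm_K_le[OF n2])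
          also have "\<dots> \<le> G" unfolding G_def
            by (rule Kr_mono[OF norm_ge_zero _ dyadic_radius(2)]) (use n1 shallow[OF True] in linarith)
          finally show ?thesis by (simp add: norm_mult mult_left_mono)
        qed (simp add: fR_def)
      qed
      also have "\<dots> = F * G" by (simp add: fRF)
      finally have 1: "cmod (P fR z) \<le> F * G" .
      have "P b z = P (\<lambda>\<zeta>. fR \<zeta> + (- c) * u \<zeta>) z" by (simp add: b_def[abs_def])
      also have "\<dots> = P fR z + P (\<lambda>\<zeta>. (- c) * u \<zeta>) z" using fRi ui z1 by (intro P_add) auto
      also have "P (\<lambda>\<zeta>. (- c) * u \<zeta>) z = (- c) * P u z" by (rule P_cmult[OF ui])
      finally have "cmod (P b z) \<le> cmod (P fR z) + cmod ((- c) * P u z)" by (metis norm_triangle_ineq)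
      also have "\<dots> \<le> F * G + cmod c * cmod (P u z)" using 1 by (simp add: norm_mult)
      \<comment> \<open>Passing to the square makes the contraction usable; the additional 1 is
        harmless, as the near set has measure of order \<open>mT\<close>.\<close>
      also have "\<dots> \<le> F * G + cmod c * (1 + (cmod (P u z))\<^sup>2)"
      proof (intro add_left_mono mult_left_mono)
        show "cmod (P u z) \<le> 1 + (cmod (P u z))\<^sup>2"
        proof -
          have "0 \<le> (cmod (P u z))\<^sup>2 + 1 - 2 * cmod (P u z)"
            using zero_le_power2[of "cmod (P u z) - 1"] by (simp add: power2_diff)
          then show ?thesis using norm_ge_zero[of "P u z"] by linarith
        qed
      qed simp
      also have "\<dots> \<le> \<Psi> z" unfolding \<Psi>_def using zQ F0 \<Phi>(2)[of z] by (simp add: distrib_left)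
      finally show ?thesis .
    qed
    then show ?thesis using \<Psi>i \<Psi>0 \<Psi>I unfolding b_eq F_def[symmetric] by blast
  qed
  have C0: "0 \<le> C" using C4(1) Ck(1) D1 unfolding C_def by (intro add_nonneg_nonneg mult_nonneg_nonneg) auto
  show ?thesis by (rule that[OF C0 main])
qed

end

subsection \<open>Calderon-Zygmund decomposition\<close>

context dyadic_doubling begin

text \<open>Calderon-Zygmund decomposition along the tree of tents, stopped at the maximal heavy tents. The
  integral of \<open>f\<close> over the top half of an unstopped tent is also spread over the tent: for weights in
  \<open>D_hat\<close> the top half may carry much less mass than the tent, so the average of \<open>f\<close> over
  the top half is not controlled by the stopping level.\<close>

lemma weak_type_truncated:
  obtains C where "0 \<le> C" "\<And>f N t. integrable \<mu> f \<Longrightarrow>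
    (\<And>z. z \<in> unit_disk \<Longrightarrow> 1 - 1 / 2 ^ Suc N \<le> cmod z \<Longrightarrow> f z = 0) \<Longrightarrow> 0 < t \<Longrightarrow>
    t * measure \<mu> {z \<in> unit_disk. t < cmod (P f z)} \<le> C * (LINT z|\<mu>. cmod (f z))"
proof -
  obtain Cl where Cl: "0 \<le> Cl" "\<And>f k i R. integrable \<mu> f \<Longrightarrow> i < 2 ^ k \<Longrightarrow> R \<in> sets \<mu> \<Longrightarrow> R \<subseteq> tent k i \<Longrightarrow>
    \<exists>\<Psi>. integrable \<mu> \<Psi> \<and> (\<forall>z. 0 \<le> \<Psi> z) \<and> (LINT z|\<mu>. \<Psi> z) \<le> Cl * mass f R \<and>
      (\<forall>z\<in>unit_disk. far k i z \<or> (\<forall>\<zeta>\<in>R. cmod \<zeta> < 1 - 1 / 2 ^ Suc k) \<longrightarrow> cmod (P (localized f k i R) z) \<le> \<Psi> z)"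
    using localized_bound by blast
  define L where "L = 4 * D ^ 2"
  have L1: "1 \<le> L" using one_le_power[OF D1, of 2] by (simp add: L_def)
  define C where "C = 1 + 32 * D ^ 5 + 2 * Cl + 8 * L"
  have D5: "0 \<le> D ^ 5" using D1 by simp
  have C1: "1 \<le> C" using D5 Cl(1) L1 by (simp add: C_def)
  have main: "t * measure \<mu> {z \<in> unit_disk. t < cmod (P f z)} \<le> C * (LINT z|\<mu>. cmod (f z))"
    if f: "integrable \<mu> f" and supp: "\<And>z. z \<in> unit_disk \<Longrightarrow> 1 - 1 / 2 ^ Suc N \<le> cmod z \<Longrightarrow> f z = 0" and t: "0 < t" for f N t
  proof -
    have fm [measurable]: "f \<in> borel_measurable \<mu>" using f by auto
    define nf where "nf = (LINT z|\<mu>. cmod (f z))"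
    have nf0: "0 \<le> nf" by (simp add: nf_def)
    have disk_sets: "unit_disk \<in> sets \<mu>" using sets.top[of \<mu>] by simp
    show ?thesis
    \<comment> \<open>In the first case the measure of the whole disk is a sufficient bound;
      otherwise the root is not heavy, so every stopped tent has a light parent.\<close>
    proof (cases "t * measure \<mu> unit_disk \<le> nf")
      case True
      have "measure \<mu> {z \<in> unit_disk. t < cmod (P f z)} \<le> measure \<mu> unit_disk"
        by (rule mu.finite_measure_mono[OF _ disk_sets]) auto
      then have "t * measure \<mu> {z \<in> unit_disk. t < cmod (P f z)} \<le> t * measure \<mu> unit_disk"
        using t by (intro mult_left_mono) auto
      also have "\<dots> \<le> nf" by (rule True)
      also have "\<dots> \<le> C * nf" using mult_right_mono[OF C1 nf0] by simp
      finally show ?thesis by (simp add: nf_def)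
    next
      case small: False
      define heavy where "heavy k i \<longleftrightarrow> t * measure \<mu> (tent k i) < mass f (tent k i)" for k i
      \<comment> \<open>The tents visited before stopping: all their proper ancestors are light. The
        depth \<open>N\<close> suffices because \<open>f\<close> vanishes below the top halves of
        that level, and it keeps \<open>A\<close> finite.\<close>
      define A where "A = {(k, i). k \<le> N \<and> i < 2 ^ k \<and> (\<forall>l<k. \<not> heavy l (i div 2 ^ (k - l)))}"
      define T where "T Q = case_prod tent Q" for Q
      \<comment> \<open>A heavy tent keeps everything in it; a light one keeps its top half and
        leaves the rest to its children. Hence the sets \<open>R Q\<close> are disjoint and cover
        the region where \<open>f\<close> may be nonzero.\<close>
      define R where "R Q = (if case_prod heavy Q then T Q else {z \<in> T Q. cmod z < 1 - 1 / 2 ^ Suc (fst Q)})" for Q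
      have T [measurable]: "T Q \<in> sets \<mu>" for Q by (auto simp: T_def split_beta)
      have TI: "T Q \<inter> unit_disk = T Q" for Q using tent_subset by (auto simp: T_def split_beta)
      have R [measurable]: "R Q \<in> sets \<mu>" for Q
      proof -
        have "T Q \<inter> {z \<in> space \<mu>. cmod z < 1 - 1 / 2 ^ Suc (fst Q)} \<in> sets \<mu>" by measurable
        moreover have "T Q \<inter> {z \<in> space \<mu>. cmod z < 1 - 1 / 2 ^ Suc (fst Q)} = {z \<in> T Q. cmod z < 1 - 1 / 2 ^ Suc (fst Q)}"
          using TI[of Q] by auto
        ultimately show ?thesis by (simp add: R_def)
      qed
      have RT: "R Q \<subseteq> T Q" for Q by (auto simp: R_def)
      have finA: "finite A"
      proof (rule finite_subset)
        have "i < 2 ^ N" if "k \<le> N" "i < 2 ^ k" for k i :: nat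
          using that power_increasing[of k N "2::nat"] by (meson less_le_trans one_le_numeral)
        then show "A \<subseteq> {..N} \<times> {..<2 ^ N}" by (auto simp: A_def)
      qed simp
      have T0: "tent 0 0 = unit_disk" using idx_less[of 0] by (auto simp: tent_def)
      have root: "\<not> heavy 0 0"
        using mass_le_norm[OF f tent_sets, of 0 0] small by (simp add: heavy_def T0 nf_def)
      have snd_lt: "snd Q < 2 ^ fst Q" if "Q \<in> A" for Q using that by (auto simp: A_def)
      have posT: "0 < measure \<mu> (T Q)" if "Q \<in> A" for Q
        using measure_tent_pos[OF snd_lt[OF that]] by (simp add: T_def split_beta)
      \<comment> \<open>The parent of a visited tent is light, and its measure is at most
        \<open>L\<close> times that of the child.\<close>
      have massT: "mass f (T Q) \<le> L * t * measure \<mu> (T Q)" if Q: "Q \<in> A" for Q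
      proof -
        obtain k i where Qki: "Q = (k, i)" by (cases Q)
        have ki: "i < 2 ^ k" "\<forall>l<k. \<not> heavy l (i div 2 ^ (k - l))" using Q by (auto simp: A_def Qki)
        show ?thesis
        proof (cases k)
          case 0
          then have "mass f (tent k i) \<le> t * measure \<mu> (tent k i)" using root ki(1) by (simp add: heavy_def)
          also have "\<dots> \<le> L * (t * measure \<mu> (tent k i))"
            using mult_right_mono[OF L1, of "t * measure \<mu> (tent k i)"] t by simp
          finally show ?thesis by (simp add: T_def Qki mult.assoc)
        next
          case (Suc k')
          have nh: "\<not> heavy k' (i div 2)" using ki(2)[rule_format, of k'] Suc by simp
          have "mass f (tent k i) \<le> mass f (tent k' (i div 2))"
            using tent_nested[of k' k i] Suc by (intro mass_mono[OF f]) auto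
          also have "\<dots> \<le> t * measure \<mu> (tent k' (i div 2))" using nh by (simp add: heavy_def)
          also have "\<dots> \<le> t * (L * measure \<mu> (tent k i))"
            using measure_tent_parent[of i k'] ki(1) t Suc by (intro mult_left_mono) (auto simp: L_def)
          finally show ?thesis by (simp add: T_def Qki mult_ac)
        qed
      qed
      have dj: "disjoint_family_on R A"
        unfolding disjoint_family_on_def
      proof (intro ballI impI)
        have aux: "R Q \<inter> R Q' = {}" if Q: "Q \<in> A" "Q' \<in> A" "Q \<noteq> Q'" and le: "fst Q \<le> fst Q'" for Q Q'
        proof (rule ccontr)
          assume "R Q \<inter> R Q' \<noteq> {}"
          then obtain z where z: "z \<in> R Q" "z \<in> R Q'" by auto
          obtain k i k' i' where e: "Q = (k, i)" "Q' = (k', i')" by (cases Q; cases Q')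
          have zT: "z \<in> tent k i" "z \<in> tent k' i'" using z RT e by (force simp: T_def)+
          have ii: "i = i' div 2 ^ (k' - k)" using tent_Int_tent[OF _ zT(2,1)] le e by simp
          have "k \<noteq> k'" using Q(3) ii e by auto
          then have lt: "k < k'" using le e by simp
          have "\<not> heavy k i" using Q(2) lt ii by (auto simp: A_def e)
          then have "cmod z < 1 - 1 / 2 ^ Suc k" using z(1) by (simp add: R_def e)
          moreover have "1 - 1 / 2 ^ k' \<le> cmod z" using zT(2) by (simp add: tent_def)
          moreover have "1 / 2 ^ k' \<le> (1::real) / 2 ^ Suc k" using lt by (intro divide_left_mono power_increasing) auto
          ultimately show False by linarith
        qed
        fix Q Q' assume "Q \<in> A" "Q' \<in> A" "Q \<noteq> Q'"
        then show "R Q \<inter> R Q' = {}"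
          using aux[of Q Q'] aux[of Q' Q] by (cases "fst Q \<le> fst Q'") (auto simp: Int_commute)
      qed
      have cover: "\<exists>Q\<in>A. z \<in> R Q" if z: "z \<in> unit_disk" "cmod z < 1 - 1 / 2 ^ Suc N" for z
      proof -
        define d where "d = (LEAST d. cmod z < 1 - 1 / 2 ^ Suc d)"
        have d1: "cmod z < 1 - 1 / 2 ^ Suc d" unfolding d_def by (rule LeastI[of _ N]) (rule z(2))
        have dN: "d \<le> N" unfolding d_def by (rule Least_le) (rule z(2))
        have d2: "1 - 1 / 2 ^ d \<le> cmod z"
        proof (cases d)
          case (Suc j)
          have "\<not> cmod z < 1 - 1 / 2 ^ Suc j" by (rule not_less_Least) (use Suc in \<open>simp add: d_def\<close>)
          then show ?thesis using Suc by simp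
        qed simp
        have in_tent: "z \<in> tent l (idx l z)" if "l \<le> d" for l
          using tent_nested[OF that, of "idx d z"] idx_div[OF that, of z] d2 z(1) by (auto simp: tent_def)
        show ?thesis
        proof (cases "\<exists>l\<le>d. heavy l (idx l z)")
          case True
          define k where "k = (LEAST l. l \<le> d \<and> heavy l (idx l z))"
          have k: "k \<le> d" "heavy k (idx k z)" using LeastI_ex[OF True] unfolding k_def by auto
          have nh: "\<not> heavy l (idx l z)" if "l < k" for l
            using not_less_Least[of l "\<lambda>l. l \<le> d \<and> heavy l (idx l z)"] that k(1) unfolding k_def by auto
          have "\<not> heavy l (idx k z div 2 ^ (k - l))" if "l < k" for l
            using nh[OF that] idx_div[of l k z] that by simp
          then have "(k, idx k z) \<in> A" using k(1) dN by (simp add: A_def idx_less)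
          moreover have "z \<in> R (k, idx k z)" using k in_tent[OF k(1)] by (simp add: R_def T_def)
          ultimately show ?thesis by blast
        next
          case False
          then have nh: "\<not> heavy l (idx l z)" if "l \<le> d" for l using that by blast
          have "\<not> heavy l (idx d z div 2 ^ (d - l))" if "l < d" for l
            using nh[of l] idx_div[of l d z] that by simp
          then have "(d, idx d z) \<in> A" using dN by (simp add: A_def idx_less)
          moreover have "z \<in> R (d, idx d z)" using nh[of d] in_tent[of d] d1 by (simp add: R_def T_def)
          ultimately show ?thesis by blast
        qed
      qed
      have sumR: "(\<Sum>Q\<in>A. mass f (R Q)) \<le> nf"
        using sum_mass_le[OF f finA _ _ dj disk_sets] R RT TI mass_le_norm[OF f disk_sets]
        unfolding nf_def by (smt (verit, best) Int_iff subset_iff)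
      define c where "c Q = (LINT \<zeta>|\<mu>. indicator (R Q) \<zeta> * f \<zeta>) / of_real (measure \<mu> (T Q))" for Q
      have cF: "cmod (c Q) * measure \<mu> (T Q) \<le> mass f (R Q)" if Q: "Q \<in> A" for Q
      proof -
        have "cmod (c Q) * measure \<mu> (T Q) = cmod (LINT \<zeta>|\<mu>. indicator (R Q) \<zeta> * f \<zeta>)"
          using posT[OF Q] by (simp add: c_def norm_divide)
        also have "\<dots> \<le> (LINT \<zeta>|\<mu>. cmod (indicator (R Q) \<zeta> * f \<zeta>))" by (rule integral_norm_bound)
        also have "\<dots> = mass f (R Q)"
          unfolding mass_def by (rule Bochner_Integration.integral_cong) (auto simp: indicator_def)
        finally show ?thesis .
      qed
      define g where "g z = (\<Sum>Q\<in>A. c Q * indicator (T Q) z)" for z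
      define G where "G z = (\<Sum>Q\<in>A. cmod (c Q) * indicator (T Q) z)" for z
      have gm [measurable]: "g \<in> borel_measurable \<mu>" unfolding g_def[abs_def] by measurable
      have Gm [measurable]: "G \<in> borel_measurable \<mu>" unfolding G_def[abs_def] by measurable
      have gG: "cmod (g z) \<le> G z" for z
        unfolding g_def G_def by (rule sum_norm_le) (auto simp: norm_mult indicator_def)
      have G0: "0 \<le> G z" for z unfolding G_def by (intro sum_nonneg) (auto simp: indicator_def)
      have GB: "G z \<le> (\<Sum>Q\<in>A. cmod (c Q))" for z
        unfolding G_def by (rule sum_mono) (auto simp: indicator_def)
      have gB: "cmod (g z) \<le> (\<Sum>Q\<in>A. cmod (c Q))" for z using gG[of z] GB[of z] by linarith
      have gi: "integrable \<mu> g" by (rule integrable_bounded[OF gm gB])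
      have g2i: "integrable \<mu> (\<lambda>z. (cmod (g z))\<^sup>2)"
        by (rule integrable_bounded[where B = "(\<Sum>Q\<in>A. cmod (c Q))\<^sup>2"]) (use gB in \<open>auto intro!: power_mono\<close>)
      have G2i: "integrable \<mu> (\<lambda>z. (G z)\<^sup>2)"
        by (rule integrable_bounded[where B = "(\<Sum>Q\<in>A. cmod (c Q))\<^sup>2"]) (use G0 GB in \<open>auto intro!: power_mono\<close>)
      \<comment> \<open>The packing hypothesis holds because the disjoint sets \<open>R Q'\<close>
        with \<open>T Q'\<close> inside \<open>T Q\<close> carry at most the mass of
        \<open>T Q\<close>, which \<open>massT\<close> bounds.\<close>
      have g2: "(LINT z|\<mu>. (cmod (g z))\<^sup>2) \<le> 2 * (L * t) * nf"
      proof -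
        have "(LINT z|\<mu>. (cmod (g z))\<^sup>2) \<le> (LINT z|\<mu>. (G z)\<^sup>2)"
          by (rule integral_mono[OF g2i G2i]) (use gG in \<open>auto intro!: power_mono\<close>)
        also have "\<dots> \<le> 2 * (L * t) * (\<Sum>Q\<in>A. mass f (R Q))"
          unfolding G_def T_def
        proof (rule nested_tents_L2[OF finA])
          fix Q assume Q: "Q \<in> A"
          show "cmod (c Q) * measure \<mu> (case_prod tent Q) \<le> mass f (R Q)" using cF[OF Q] by (simp add: T_def)
          have "(\<Sum>Q'\<in>{Q'\<in>A. T Q' \<subseteq> T Q}. mass f (R Q')) \<le> mass f (T Q)"
          proof (rule sum_mass_le[OF f _ _ _ _ T])
            show "disjoint_family_on R {Q' \<in> A. T Q' \<subseteq> T Q}"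
              by (rule disjoint_family_on_mono[OF _ dj]) auto
            show "finite {Q' \<in> A. T Q' \<subseteq> T Q}" using finA by simp
            show "R Q' \<in> sets \<mu>" for Q' by (rule R)
            show "R Q' \<subseteq> T Q" if "Q' \<in> {Q' \<in> A. T Q' \<subseteq> T Q}" for Q' using that RT[of Q'] by blast
          qed
          also have "\<dots> \<le> L * t * measure \<mu> (T Q)" by (rule massT[OF Q])
          finally show "(\<Sum>Q'\<in>{Q'\<in>A. case_prod tent Q' \<subseteq> case_prod tent Q}. mass f (R Q')) \<le> L * t * measure \<mu> (case_prod tent Q)"
            by (simp add: T_def)
        qed (use L1 t in auto)
        also have "\<dots> \<le> 2 * (L * t) * nf" using sumR L1 t by (intro mult_left_mono) auto
        finally show ?thesis .
      qed
      define b where "b Q = localized f (fst Q) (snd Q) (R Q)" for Q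
      have b_eq: "b Q z = indicator (R Q) z * f z - c Q * indicator (T Q) z" for Q z
        by (simp add: b_def localized_def c_def T_def split_beta)
      have bi: "integrable \<mu> (b Q)" for Q
      proof -
        have "integrable \<mu> (\<lambda>z. indicator (R Q) z * f z)"
          by (rule Bochner_Integration.integrable_bound[OF f]) (auto simp: indicator_def)
        moreover have "integrable \<mu> (\<lambda>z. c Q * indicator (T Q) z)"
          by (rule integrable_bounded[where B = "cmod (c Q)"]) (auto simp: norm_mult indicator_def)
        ultimately show ?thesis unfolding b_eq[abs_def] by (rule Bochner_Integration.integrable_diff)
      qed
      have f_eq: "f z = g z + (\<Sum>Q\<in>A. b Q z)" if z: "z \<in> unit_disk" for z
      proof -
        have "(\<Sum>Q\<in>A. indicator (R Q) z * f z) = indicator (\<Union>Q\<in>A. R Q) z * f z"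
          by (simp add: sum_distrib_right[symmetric] indicator_UN_disjoint[OF finA dj])
        also have "\<dots> = f z"
          using cover[OF z] supp[OF z] by (cases "cmod z < 1 - 1 / 2 ^ Suc N") (auto simp: indicator_def)
        finally show ?thesis by (simp add: b_eq g_def sum_subtractf)
      qed
      have Pf_eq: "P f z = P g z + (\<Sum>Q\<in>A. P (b Q) z)" if z: "z \<in> unit_disk" for z
      proof -
        have "P f z = P (\<lambda>z. g z + (\<Sum>Q\<in>A. b Q z)) z" by (rule P_cong) (rule f_eq)
        also have "\<dots> = P g z + P (\<lambda>z. \<Sum>Q\<in>A. b Q z) z"
          using z bi by (intro P_add gi Bochner_Integration.integrable_sum) auto
        also have "P (\<lambda>z. \<Sum>Q\<in>A. b Q z) z = (\<Sum>Q\<in>A. P (b Q) z)"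
          using z bi by (intro P_sum finA) auto
        finally show ?thesis .
      qed
      have "\<forall>Q\<in>A. \<exists>\<Psi>. integrable \<mu> \<Psi> \<and> (\<forall>z. 0 \<le> \<Psi> z) \<and> (LINT z|\<mu>. \<Psi> z) \<le> Cl * mass f (R Q) \<and>
        (\<forall>z\<in>unit_disk. far (fst Q) (snd Q) z \<or> \<not> case_prod heavy Q \<longrightarrow> cmod (P (b Q) z) \<le> \<Psi> z)"
      proof
        fix Q assume Q: "Q \<in> A"
        have RT': "R Q \<subseteq> tent (fst Q) (snd Q)" using RT[of Q] by (simp add: T_def split_beta)
        have sh: "\<forall>\<zeta>\<in>R Q. cmod \<zeta> < 1 - 1 / 2 ^ Suc (fst Q)" if "\<not> case_prod heavy Q" using that by (simp add: R_def)
        show "\<exists>\<Psi>. integrable \<mu> \<Psi> \<and> (\<forall>z. 0 \<le> \<Psi> z) \<and> (LINT z|\<mu>. \<Psi> z) \<le> Cl * mass f (R Q) \<and>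
          (\<forall>z\<in>unit_disk. far (fst Q) (snd Q) z \<or> \<not> case_prod heavy Q \<longrightarrow> cmod (P (b Q) z) \<le> \<Psi> z)"
          using Cl(2)[OF f snd_lt[OF Q] R[of Q] RT'] sh unfolding b_def by blast
      qed
      from bchoice[OF this] obtain \<Psi> where \<Psi>: "\<And>Q. Q \<in> A \<Longrightarrow> integrable \<mu> (\<Psi> Q)" "\<And>Q z. Q \<in> A \<Longrightarrow> 0 \<le> \<Psi> Q z"
        "\<And>Q. Q \<in> A \<Longrightarrow> (LINT z|\<mu>. \<Psi> Q z) \<le> Cl * mass f (R Q)"
        "\<And>Q z. Q \<in> A \<Longrightarrow> z \<in> unit_disk \<Longrightarrow> far (fst Q) (snd Q) z \<or> \<not> case_prod heavy Q \<Longrightarrow> cmod (P (b Q) z) \<le> \<Psi> Q z"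
        by blast
      define S where "S z = (\<Sum>Q\<in>A. \<Psi> Q z)" for z
      have Si: "integrable \<mu> S" unfolding S_def by (intro Bochner_Integration.integrable_sum \<Psi>(1))
      have S0: "0 \<le> S z" for z unfolding S_def by (intro sum_nonneg \<Psi>(2))
      have SI: "(LINT z|\<mu>. S z) \<le> Cl * nf"
      proof -
        have "(LINT z|\<mu>. S z) = (\<Sum>Q\<in>A. LINT z|\<mu>. \<Psi> Q z)"
          unfolding S_def by (rule Bochner_Integration.integral_sum) (rule \<Psi>(1))
        also have "\<dots> \<le> (\<Sum>Q\<in>A. Cl * mass f (R Q))" by (intro sum_mono \<Psi>(3))
        also have "\<dots> \<le> Cl * nf" using sumR Cl(1) by (simp add: sum_distrib_left[symmetric] mult_left_mono)
        finally show ?thesis .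
      qed
      \<comment> \<open>Only heavy tents contribute to the exceptional set, since
        \<open>localized_bound\<close> estimates the shallow pieces of light tents everywhere. The
        neighbourhood of a heavy tent is charged to \<open>mass f (R Q) / t\<close>.\<close>
      define H where "H = {Q\<in>A. case_prod heavy Q}"
      define E where "E = (\<Union>Q\<in>H. {z \<in> unit_disk. \<not> far (fst Q) (snd Q) z})"
      have finH: "finite H" using finA by (simp add: H_def)
      have Es: "E \<in> sets \<mu>" unfolding E_def using finH near_sets by (intro sets.finite_UN) auto
      have mE: "t * measure \<mu> E \<le> 32 * D ^ 5 * nf"
      proof -
        have "measure \<mu> E \<le> (\<Sum>Q\<in>H. measure \<mu> {z \<in> unit_disk. \<not> far (fst Q) (snd Q) z})"
          unfolding E_def by (rule mu.finite_measure_subadditive_finite[OF finH]) (use near_sets in blast)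
        also have "\<dots> \<le> (\<Sum>Q\<in>H. 32 * D ^ 5 * (mass f (R Q) / t))"
        proof (rule sum_mono)
          fix Q assume Q: "Q \<in> H"
          then have QA: "Q \<in> A" and hv: "case_prod heavy Q" by (auto simp: H_def)
          have "measure \<mu> {z \<in> unit_disk. \<not> far (fst Q) (snd Q) z} \<le> 32 * D ^ 4 * (W (fst Q) / 2 ^ fst Q)"
            using near_measure[of "fst Q" "snd Q"] by simp
          also have "\<dots> \<le> 32 * D ^ 4 * (D * measure \<mu> (T Q))"
            using measure_tent_ge[OF snd_lt[OF QA]] D1 by (intro mult_left_mono) (auto simp: T_def split_beta)
          also have "\<dots> = 32 * (D ^ 4 * D) * measure \<mu> (T Q)" by simp
          also have "D ^ 4 * D = D ^ 5" by (simp add: power_Suc2[symmetric] del: power_Suc)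
          also have "32 * D ^ 5 * measure \<mu> (T Q) \<le> 32 * D ^ 5 * (mass f (R Q) / t)"
          proof (rule mult_left_mono)
            have "t * measure \<mu> (T Q) < mass f (T Q)" using hv by (simp add: heavy_def T_def split_beta)
            then show "measure \<mu> (T Q) \<le> mass f (R Q) / t" using hv t by (simp add: R_def field_simps)
          qed (use D5 in simp)
          finally show "measure \<mu> {z \<in> unit_disk. \<not> far (fst Q) (snd Q) z} \<le> 32 * D ^ 5 * (mass f (R Q) / t)" .
        qed
        also have "\<dots> \<le> (\<Sum>Q\<in>A. 32 * D ^ 5 * (mass f (R Q) / t))"
          by (rule sum_mono2[OF finA]) (use t D5 mass_nonneg in \<open>auto simp: H_def\<close>)
        also have "\<dots> = 32 * D ^ 5 * ((\<Sum>Q\<in>A. mass f (R Q)) / t)"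
          by (simp add: sum_distrib_left sum_divide_distrib)
        also have "\<dots> \<le> 32 * D ^ 5 * (nf / t)" using sumR t D5 by (intro mult_left_mono divide_right_mono) auto
        finally show ?thesis using t by (simp add: field_simps)
      qed
      have Pgm [measurable]: "P g \<in> borel_measurable \<mu>" by (rule P_measurable[OF gi])
      have Pg2: "(\<integral>\<^sup>+z. ennreal ((cmod (P g z))\<^sup>2) \<partial>\<mu>) \<le> ennreal (2 * (L * t) * nf)"
        using P_L2[OF gi g2i] g2 by (meson ennreal_leI order_trans)
      have Pg2i: "integrable \<mu> (\<lambda>z. (cmod (P g z))\<^sup>2)"
        by (rule integrableI_bounded) (use Pg2 in \<open>auto intro: le_less_trans\<close>)
      have Pg2I: "(LINT z|\<mu>. (cmod (P g z))\<^sup>2) \<le> 2 * (L * t) * nf"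
        using Pg2 Pg2i L1 t nf0 by (simp add: nn_integral_eq_integral)
      define B1 where "B1 = {z \<in> space \<mu>. (t / 2)\<^sup>2 \<le> (cmod (P g z))\<^sup>2}"
      define B2 where "B2 = {z \<in> space \<mu>. t / 2 \<le> S z}"
      have [measurable]: "S \<in> borel_measurable \<mu>" using Si by auto
      have B12: "B1 \<in> sets \<mu>" "B2 \<in> sets \<mu>" unfolding B1_def B2_def by measurable
      \<comment> \<open>The bound \<open>g2\<close> contains a factor \<open>t\<close>, so
        Chebyshev's inequality for the square leaves only \<open>1 / t\<close>.\<close>
      have mB1: "t * measure \<mu> B1 \<le> 8 * L * nf"
      proof -
        have "measure \<mu> B1 \<le> (LINT z|\<mu>. (cmod (P g z))\<^sup>2) / (t / 2)\<^sup>2"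
          unfolding B1_def by (rule integral_Markov_inequality_measure[OF Pg2i disk_sets]) (use t in auto)
        also have "\<dots> \<le> (2 * (L * t) * nf) / (t / 2)\<^sup>2" by (rule divide_right_mono[OF Pg2I]) simp
        also have "\<dots> = 8 * L * nf / t" using t by (simp add: field_simps power2_eq_square)
        finally show ?thesis using t by (simp add: field_simps)
      qed
      have mB2: "t * measure \<mu> B2 \<le> 2 * Cl * nf"
      proof -
        have "measure \<mu> B2 \<le> (LINT z|\<mu>. S z) / (t / 2)"
          unfolding B2_def by (rule integral_Markov_inequality_measure[OF Si disk_sets]) (use t S0 in auto)
        also have "\<dots> \<le> (Cl * nf) / (t / 2)" using SI t by (intro divide_right_mono) auto
        finally show ?thesis using t by (simp add: field_simps)
      qed
      have sub: "{z \<in> unit_disk. t < cmod (P f z)} \<subseteq> E \<union> (B1 \<union> B2)"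
      proof
        fix z assume z: "z \<in> {z \<in> unit_disk. t < cmod (P f z)}"
        then have zD: "z \<in> unit_disk" by simp
        show "z \<in> E \<union> (B1 \<union> B2)"
        proof (cases "z \<in> E")
          case False
          have "cmod (P (b Q) z) \<le> \<Psi> Q z" if Q: "Q \<in> A" for Q
            by (rule \<Psi>(4)[OF Q zD]) (use False Q zD in \<open>auto simp: E_def H_def\<close>)
          then have "cmod (\<Sum>Q\<in>A. P (b Q) z) \<le> S z" unfolding S_def by (intro sum_norm_le)
          moreover have "cmod (P f z) \<le> cmod (P g z) + cmod (\<Sum>Q\<in>A. P (b Q) z)"
            unfolding Pf_eq[OF zD] by (rule norm_triangle_ineq)
          ultimately have "t / 2 \<le> cmod (P g z) \<or> t / 2 \<le> S z" using z by auto
          then show ?thesis using zD t by (auto simp: B1_def B2_def intro: power_mono)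
        qed simp
      qed
      have "measure \<mu> {z \<in> unit_disk. t < cmod (P f z)} \<le> measure \<mu> (E \<union> (B1 \<union> B2))"
        using Es B12 by (intro mu.finite_measure_mono[OF sub]) auto
      also have "\<dots> \<le> measure \<mu> E + (measure \<mu> B1 + measure \<mu> B2)"
        using Es B12 by (intro order_trans[OF measure_Un_le] add_left_mono measure_Un_le) auto
      finally have "t * measure \<mu> {z \<in> unit_disk. t < cmod (P f z)} \<le> t * (measure \<mu> E + (measure \<mu> B1 + measure \<mu> B2))"
        using t by (intro mult_left_mono) auto
      also have "\<dots> \<le> 32 * D ^ 5 * nf + (8 * L * nf + 2 * Cl * nf)"
        using mE mB1 mB2 by (simp add: distrib_left)
      also have "\<dots> \<le> C * nf" using nf0 by (simp add: C_def algebra_simps)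
      finally show ?thesis by (simp add: nf_def)
    qed
  qed
  have C0: "0 \<le> C" using C1 by simp
  show ?thesis by (rule that[OF C0 main])
qed

text \<open>The decomposition needs a finite tree, so \<open>f\<close> is truncated to smaller
  disks. The projections of the truncations converge pointwise by dominated convergence, and since
  the level sets are given by a strict inequality, Fatou's lemma for their indicators passes the
  uniform bound to \<open>f\<close>.\<close>

lemma weak_type_of_doubling: "\<exists>C. weak_type C"
proof -
  obtain C where C: "0 \<le> C" "\<And>f N t. integrable \<mu> f \<Longrightarrow>
    (\<And>z. z \<in> unit_disk \<Longrightarrow> 1 - 1 / 2 ^ Suc N \<le> cmod z \<Longrightarrow> f z = 0) \<Longrightarrow> 0 < t \<Longrightarrow>
    t * measure \<mu> {z \<in> unit_disk. t < cmod (P f z)} \<le> C * (LINT z|\<mu>. cmod (f z))"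
    using weak_type_truncated by blast
  have "t * measure \<mu> {z \<in> unit_disk. t < cmod (P f z)} \<le> C * (LINT z|\<mu>. cmod (f z))"
    if f: "integrable \<mu> f" and t: "0 < t" for f t
  proof -
    have [measurable]: "f \<in> borel_measurable \<mu>" using f by auto
    define nf where "nf = (LINT z|\<mu>. cmod (f z))"
    define h where "h N z = (if cmod z < 1 - 1 / 2 ^ Suc N then f z else 0)" for N z
    have hm [measurable]: "h N \<in> borel_measurable \<mu>" for N unfolding h_def[abs_def] by measurable
    have hi: "integrable \<mu> (h N)" for N
      by (rule Bochner_Integration.integrable_bound[OF f]) (auto simp: h_def)
    have hn: "(LINT z|\<mu>. cmod (h N z)) \<le> nf" for N
      unfolding nf_def by (rule integral_mono[OF integrable_norm[OF hi] integrable_norm[OF f]]) (simp add: h_def)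
    have hlim: "(\<lambda>N. h N z) \<longlonglongrightarrow> f z" if z: "z \<in> unit_disk" for z
    proof (rule tendsto_eventually)
      have "(\<lambda>N. 1 - (1 / 2) ^ Suc N :: real) \<longlonglongrightarrow> 1 - 0"
        by (intro tendsto_intros LIMSEQ_Suc LIMSEQ_power_zero) auto
      then have "\<forall>\<^sub>F N in sequentially. cmod z < 1 - (1 / 2) ^ Suc N" by (rule order_tendstoD) (use z in simp)
      then show "\<forall>\<^sub>F N in sequentially. h N z = f z"
        by eventually_elim (simp add: h_def power_one_over)
    qed
    have Plim: "(\<lambda>N. P (h N) z) \<longlonglongrightarrow> P f z" if z: "z \<in> unit_disk" for z
    proof -
      have "(\<lambda>N. LINT \<zeta>|\<mu>. h N \<zeta> * cnj (K (cnj z * \<zeta>))) \<longlonglongrightarrow> (LINT \<zeta>|\<mu>. f \<zeta> * cnj (K (cnj z * \<zeta>)))"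
      proof (rule integral_dominated_convergence[where w = "\<lambda>\<zeta>. norm (f \<zeta> * cnj (K (cnj z * \<zeta>)))"])
        show "integrable \<mu> (\<lambda>\<zeta>. norm (f \<zeta> * cnj (K (cnj z * \<zeta>))))"
          using integrable_mult_K[OF f, of z] z by (intro integrable_norm) auto
        show "AE \<zeta> in \<mu>. (\<lambda>N. h N \<zeta> * cnj (K (cnj z * \<zeta>))) \<longlonglongrightarrow> f \<zeta> * cnj (K (cnj z * \<zeta>))"
          by (rule AE_I2) (auto intro!: tendsto_mult hlim)
        show "AE \<zeta> in \<mu>. norm (h N \<zeta> * cnj (K (cnj z * \<zeta>))) \<le> norm (f \<zeta> * cnj (K (cnj z * \<zeta>)))" for N
          by (rule AE_I2) (auto simp: h_def)
      qed measurable
      then show ?thesis using f hi by (simp add: P_eq)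
    qed
    have [measurable]: "P f \<in> borel_measurable \<mu>" "P (h N) \<in> borel_measurable \<mu>" for N
      using f hi by (auto intro: P_measurable)
    define U where "U g = {z \<in> space \<mu>. t < cmod (g z)}" for g :: "complex \<Rightarrow> complex"
    have Us [measurable]: "U (P f) \<in> sets \<mu>" "U (P (h N)) \<in> sets \<mu>" for N unfolding U_def by measurable
    have "emeasure \<mu> (U (P f)) = (\<integral>\<^sup>+z. indicator (U (P f)) z \<partial>\<mu>)" by simp
    also have "\<dots> \<le> (\<integral>\<^sup>+z. liminf (\<lambda>N. indicator (U (P (h N))) z) \<partial>\<mu>)"
    proof (rule nn_integral_mono)
      fix z assume z: "z \<in> space \<mu>"
      show "indicator (U (P f)) z \<le> liminf (\<lambda>N. indicator (U (P (h N))) z :: ennreal)"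
      proof (cases "z \<in> U (P f)")
        case True
        have "(\<lambda>N. cmod (P (h N) z)) \<longlonglongrightarrow> cmod (P f z)" using z by (intro tendsto_norm Plim) auto
        then have "\<forall>\<^sub>F N in sequentially. t < cmod (P (h N) z)"
          by (rule order_tendstoD) (use True in \<open>simp add: U_def\<close>)
        then have "\<forall>\<^sub>F N in sequentially. 1 \<le> (indicator (U (P (h N))) z :: ennreal)"
          by eventually_elim (use z in \<open>simp add: U_def\<close>)
        then have "1 \<le> liminf (\<lambda>N. indicator (U (P (h N))) z :: ennreal)" by (rule Liminf_bounded)
        then show ?thesis using True by simp
      qed simp
    qed
    also have "\<dots> \<le> liminf (\<lambda>N. \<integral>\<^sup>+z. indicator (U (P (h N))) z \<partial>\<mu>)"
      by (rule nn_integral_liminf) measurable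
    also have "\<dots> \<le> limsup (\<lambda>N. \<integral>\<^sup>+z. indicator (U (P (h N))) z \<partial>\<mu>)"
      by (rule Liminf_le_Limsup) simp
    also have "\<dots> \<le> ennreal (C * nf / t)"
    proof (rule Limsup_bounded, rule always_eventually, rule allI)
      fix N
      have "t * measure \<mu> {z \<in> unit_disk. t < cmod (P (h N) z)} \<le> C * (LINT z|\<mu>. cmod (h N z))"
        by (rule C(2)[OF hi _ t, of N N]) (simp add: h_def)
      also have "\<dots> \<le> C * nf" by (rule mult_left_mono[OF hn C(1)])
      finally have "measure \<mu> (U (P (h N))) \<le> C * nf / t" using t by (simp add: U_def field_simps)
      then show "(\<integral>\<^sup>+z. indicator (U (P (h N))) z \<partial>\<mu>) \<le> ennreal (C * nf / t)"
        by (simp add: mu.emeasure_eq_measure ennreal_leI)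
    qed
    finally have "measure \<mu> (U (P f)) \<le> C * nf / t"
      using C(1) t by (simp add: mu.emeasure_eq_measure nf_def)
    then show ?thesis using t by (simp add: U_def nf_def field_simps)
  qed
  then show ?thesis using C(1) unfolding weak_type_def by blast
qed

end

theorem theorem1p1:
  fixes \<omega> :: "real \<Rightarrow> real"
  assumes "radial_weight \<omega>"
  shows "(bounded_weak_11 \<omega> \<longleftrightarrow> (\<forall>p>1. bounded_Lp \<omega> p)) \<and>
         ((\<forall>p>1. bounded_Lp \<omega> p) \<longleftrightarrow> (\<exists>p. 1 < p \<and> p \<noteq> 2 \<and> bounded_Lp \<omega> p)) \<and>
         ((\<exists>p. 1 < p \<and> p \<noteq> 2 \<and> bounded_Lp \<omega> p) \<longleftrightarrow> \<omega> \<in> D_hat)"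
proof -
  interpret radial \<omega> by unfold_locales (rule assms)
  have 12: "\<forall>p>1. bounded_Lp \<omega> p" if "bounded_weak_11 \<omega>"
    using that strong_type_of_weak_type bounded_Lp_iff bounded_weak_11_iff by (meson less_imp_le)
  have 23: "\<exists>p. 1 < p \<and> p \<noteq> 2 \<and> bounded_Lp \<omega> p" if "\<forall>p>1. bounded_Lp \<omega> p"
    using that by (intro exI[of _ 3]) auto
  have 34: "\<omega> \<in> D_hat" if "\<exists>p. 1 < p \<and> p \<noteq> 2 \<and> bounded_Lp \<omega> p"
    using that D_hat_of_strong_type bounded_Lp_iff by (meson less_imp_le)
  have 41: "bounded_weak_11 \<omega>" if D_hat: "\<omega> \<in> D_hat"
  proof -
    obtain D where D: "1 \<le> D" "\<And>k. W k \<le> D * W (Suc k)" using D_hat_dyadicD[OF D_hat] by blast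
    interpret dyadic_doubling \<omega> D by unfold_locales (use D in auto)
    show ?thesis using weak_type_of_doubling bounded_weak_11_iff by blast
  qed
  show ?thesis using 12 23 34 41 by blast
qed

end
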